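(* Let $d\in\{2,3\}$, $\tilde d=d(d-1)/2$, and let $\Omega\subset\mathbb{R}^d$ be a bounded domain with Lipschitz boundary. Then $H_0(\operatorname{div},\Omega)^*=H^{-1}(\operatorname{curl},\Omega)$ algebraically and topologically: every $F\in H_0(\operatorname{div},\Omega)^*$, regarded as a distribution, lies in $H^{-1}(\operatorname{curl},\Omega)$; every $g\in H^{-1}(\operatorname{curl},\Omega)$ is (the distribution associated with) an element of $H_0(\operatorname{div},\Omega)^*$; and the norms $\|f\|_{H_0(\operatorname{div},\Omega)^*}$ and $\|f\|_{H^{-1}(\operatorname{curl},\Omega)}:=\|f\|_{H^{-1}(\Omega,\mathbb{R}^d)}+\|\operatorname{curl}f\|_{H^{-1}(\Omega,\mathbb{R}^{\tilde d})}$ are equivalent.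
   Context: $H_0(\operatorname{div},\Omega)=\{u\in L^2(\Omega,\mathbb{R}^d):\operatorname{div}u\in L^2(\Omega),\ u\cdot n=0 \text{ on }\partial\Omega\}$ with the graph norm. An element of $H_0(\operatorname{div},\Omega)^*$ is identified with a distribution through its action on $\mathcal{D}(\Omega,\mathbb{R}^d)$ (which is dense in $H_0(\operatorname{div},\Omega)$). The curl is: for $d=2$, $\operatorname{curl}\phi=(-\partial_2\phi,\partial_1\phi)^T$ for scalar $\phi$ and $\operatorname{curl}\phi=-\partial_2\phi_1+\partial_1\phi_2$ for vector $\phi$; for $d=3$ the usual curl (distributional sense). $H^{-1}(\operatorname{curl},\Omega)=\{\phi\in H^{-1}(\Omega,\mathbb{R}^d):\operatorname{curl}\phi\in H^{-1}(\Omega,\mathbb{R}^{\tilde d})\}$, with $H^{-1}=(H_0^1)^*$. *)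

theory Defs
  imports "HOL-Analysis.Analysis"
begin

definition partial :: "'n::finite \<Rightarrow> (real^'n \<Rightarrow> real) \<Rightarrow> real^'n \<Rightarrow> real" where
  "partial i f x = frechet_derivative f (at x) (axis i 1)"

fun dpartials :: "'n::finite list \<Rightarrow> (real^'n \<Rightarrow> real) \<Rightarrow> real^'n \<Rightarrow> real" where
  "dpartials [] f = f"
| "dpartials (i # is) f = partial i (dpartials is f)"

definition smooth_fun :: "(real^'n::finite \<Rightarrow> real) \<Rightarrow> bool" where
  "smooth_fun f \<longleftrightarrow> (\<forall>is x. dpartials is f differentiable (at x))"

definition tsupport :: "(real^'n::finite \<Rightarrow> real) \<Rightarrow> (real^'n) set" where
  "tsupport f = closure {x. f x \<noteq> 0}"

definition test_fun :: "(real^'n::finite) set \<Rightarrow> (real^'n \<Rightarrow> real) \<Rightarrow> bool" where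
  "test_fun \<Omega> f \<longleftrightarrow> smooth_fun f \<and> compact (tsupport f) \<and> tsupport f \<subseteq> \<Omega>"

definition test_field :: "(real^'n::finite) set \<Rightarrow> (real^'n \<Rightarrow> real^'m::finite) \<Rightarrow> bool" where
  "test_field \<Omega> u \<longleftrightarrow> (\<forall>k. test_fun \<Omega> (\<lambda>x. u x $ k))"

definition divg :: "(real^'n::finite \<Rightarrow> real^'n) \<Rightarrow> real^'n \<Rightarrow> real" where
  "divg u x = (\<Sum>i\<in>UNIV. partial i (\<lambda>y. u y $ i) x)"

definition L2sq :: "(real^'n::finite) set \<Rightarrow> (real^'n \<Rightarrow> real) \<Rightarrow> real" where
  "L2sq \<Omega> f = integral \<Omega> (\<lambda>x. (f x)\<^sup>2)"

definition hdiv_norm :: "(real^'n::finite) set \<Rightarrow> (real^'n \<Rightarrow> real^'n) \<Rightarrow> real" where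
  "hdiv_norm \<Omega> u = sqrt ((\<Sum>i\<in>UNIV. L2sq \<Omega> (\<lambda>x. u x $ i)) + L2sq \<Omega> (divg u))"

definition h1_norm :: "(real^'n::finite) set \<Rightarrow> (real^'n \<Rightarrow> real) \<Rightarrow> real" where
  "h1_norm \<Omega> f = sqrt (L2sq \<Omega> f + (\<Sum>i\<in>UNIV. L2sq \<Omega> (partial i f)))"

definition h1v_norm :: "(real^'n::finite) set \<Rightarrow> (real^'n \<Rightarrow> real^'m::finite) \<Rightarrow> real" where
  "h1v_norm \<Omega> u = sqrt (\<Sum>k\<in>UNIV. (h1_norm \<Omega> (\<lambda>x. u x $ k))\<^sup>2)"

text \<open>An R^d-valued distribution is identified with a linear functional on D(Omega,R^d),
  T(u) = sum_j T_j(u_j).  (Continuity is automatic whenever any of the norms below is finite.)\<close>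
definition lin_on_tests :: "(real^'n::finite) set \<Rightarrow> ((real^'n \<Rightarrow> real^'n) \<Rightarrow> real) \<Rightarrow> bool" where
  "lin_on_tests \<Omega> T \<longleftrightarrow> (\<forall>u v a b. test_field \<Omega> u \<longrightarrow> test_field \<Omega> v \<longrightarrow>
      T (\<lambda>x. a *\<^sub>R u x + b *\<^sub>R v x) = a * T u + b * T v)"

text \<open>Norm in H_0(div,Omega)^*, computed on the dense subspace D(Omega,R^d).\<close>
definition hdiv_dual_norm :: "(real^'n::finite) set \<Rightarrow> ((real^'n \<Rightarrow> real^'n) \<Rightarrow> real) \<Rightarrow> ereal" where
  "hdiv_dual_norm \<Omega> T = (SUP u\<in>{u. test_field \<Omega> u \<and> hdiv_norm \<Omega> u \<le> 1}. ereal \<bar>T u\<bar>)"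

text \<open>Norm in H^{-1}(Omega,R^d) = (H_0^1(Omega,R^d))^*, computed on D(Omega,R^d).\<close>
definition hm1_norm :: "(real^'n::finite) set \<Rightarrow> ((real^'n \<Rightarrow> real^'n) \<Rightarrow> real) \<Rightarrow> ereal" where
  "hm1_norm \<Omega> T = (SUP u\<in>{u. test_field \<Omega> u \<and> h1v_norm \<Omega> u \<le> 1}. ereal \<bar>T u\<bar>)"

definition curl_idx :: "('n::{finite,linorder} \<times> 'n) set" where
  "curl_idx = {(i, j). i < j}"

text \<open>Distributional curl component (i,j): < d_i T_j - d_j T_i , psi >
  = T_i(d_j psi) - T_j(d_i psi).  For d = 2 this is the scalar curl; for d = 3 the three
  components are those of the usual curl up to order and the sign of one component.\<close>
definition curl_comp :: "(((real, 'n) vec \<Rightarrow> (real, 'n) vec) \<Rightarrow> real) \<Rightarrow> 'n::{finite,linorder} \<times> 'n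
     \<Rightarrow> ((real, 'n) vec \<Rightarrow> real) \<Rightarrow> real" where
  "curl_comp T p \<psi> = T (\<lambda>x. \<chi> k. if k = fst p then partial (snd p) \<psi> x
                                 else if k = snd p then - partial (fst p) \<psi> x else 0)"

definition curl_hm1_norm :: "((real, 'n::{finite,linorder}) vec) set \<Rightarrow> (((real, 'n) vec \<Rightarrow> (real, 'n) vec) \<Rightarrow> real) \<Rightarrow> ereal" where
  "curl_hm1_norm \<Omega> T = (SUP \<psi>\<in>{\<psi>. (\<forall>p\<in>curl_idx. test_fun \<Omega> (\<psi> p)) \<and>
            sqrt (\<Sum>p\<in>curl_idx. (h1_norm \<Omega> (\<psi> p))\<^sup>2) \<le> 1}.
        ereal \<bar>\<Sum>p\<in>curl_idx. curl_comp T p (\<psi> p)\<bar>)"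

definition hm1curl_norm :: "((real, 'n::{finite,linorder}) vec) set \<Rightarrow> (((real, 'n) vec \<Rightarrow> (real, 'n) vec) \<Rightarrow> real) \<Rightarrow> ereal" where
  "hm1curl_norm \<Omega> T = hm1_norm \<Omega> T + curl_hm1_norm \<Omega> T"

definition lipschitz_domain :: "(real^'n::finite) set \<Rightarrow> bool" where
  "lipschitz_domain \<Omega> \<longleftrightarrow> open \<Omega> \<and> connected \<Omega> \<and> \<Omega> \<noteq> {} \<and>
     (\<forall>x\<in>frontier \<Omega>. \<exists>r>0. \<exists>(R :: real^'n \<Rightarrow> real^'n) (k :: 'n) (g :: real^'n \<Rightarrow> real) (L :: real).
        orthogonal_transformation R \<and>
        L-lipschitz_on UNIV g \<and>
        (\<forall>y z. (\<forall>i. i \<noteq> k \<longrightarrow> y $ i = z $ i) \<longrightarrow> g y = g z) \<and>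
        \<Omega> \<inter> ball x r = {y \<in> ball x r. (R y) $ k < g (R y)})"

end

theory Submission
  imports Defs
begin

text \<open>
  Since \<open>div curl = 0\<close>, the norm of \<open>H\<^sub>0(div)\<^sup>*\<close> dominates the other one. For the converse it
  suffices to write a test field \<open>u\<close> as \<open>w + v + curl \<psi>\<close> with test functions such that the \<open>H\<^sup>1\<close> norms of \<open>v\<close>
  and \<open>\<psi>\<close> are bounded by \<open>\<parallel>u\<parallel> + \<parallel>div u\<parallel>\<close> and that of \<open>w\<close> is arbitrarily small. A smooth cutoff reduces
  this to fields supported near one point of the closure of \<open>\<Omega>\<close>, where the domain is stable under
  short translations along a cone spanned by a basis \<open>a\<close>.

  The decomposition is a homotopy formula \<open>u = G * div u + curl (G \<times> u) + smoothing\<close> for a vector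
  kernel \<open>G\<close> with \<open>div G = \<delta>\<close> supported in the cone, so that all terms are supported in \<open>\<Omega>\<close>. The only
  analytic difficulty is the \<open>L\<^sup>2\<close> bound for \<open>f \<mapsto> \<partial>\<^sub>i (G\<^sub>j * f)\<close>, a singular integral operator. Here \<open>G\<close>
  is a dyadic sum built from means \<open>M\<^sub>b f(x) = \<integral>\<^sub>0\<^sup>1 f(x - t b) dt\<close> over segments. The parallelogram law gives
  \<open>\<parallel>M\<^sub>b f\<parallel>\<^sup>2 = \<parallel>M\<^bsub>2b\<^esub> f\<parallel>\<^sup>2 + \<parallel>(M\<^sub>b - M\<^bsub>2b\<^esub>) f\<parallel>\<^sup>2\<close>, hence the squares of the differences over dyadic scales sum to
  at most \<open>\<parallel>f\<parallel>\<^sup>2\<close>; the kernel is arranged so that each term of \<open>\<partial>\<^sub>i (G\<^sub>j * f)\<close> contains two such differences,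
  and duality and Cauchy-Schwarz finish the estimate without Fourier transform.
\<close>

subsection \<open>Smooth functions\<close>

text \<open>Every piece of the decomposition must again be a test field in \<open>\<Omega>\<close>,
  so only one-sided averages are available. For the same reason the dyadic sum is stopped at the
  scale \<open>S / 2^N\<close>: it is then a finite sum of operators on test functions, and the
  whole point is to have constants independent of \<open>N\<close>. The truncation leaves the error
  \<open>F - H \<epsilon> F\<close>, whose H^1 norm is O(\<epsilon>) with a constant depending on
  \<open>F\<close>; it disappears in the limit for each fixed field. The coarse term
  \<open>H S F\<close> costs a factor 1/S, and \<open>S\<close> is fixed by the geometry. The
  mollifier has its form for this reason: on the Fourier side \<open>mean_diff b\<close> has a
  simple zero where b is orthogonal to the frequency. A change of scale of a one-sided kernel with
  nonzero first moment has just one such zero. Writing it as a derivative spends that zero, and a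
  further derivative would bring back only one difference. Cancelling the first moment provides the
  second zero, and the product over a basis lets a derivative in any direction produce a
  difference.\<close>

lemma partial_eq: "(f has_derivative f') (at x) \<Longrightarrow> partial i f x = f' (axis i 1)"
  unfolding partial_def using frechet_derivative_at by metis

lemma has_derivative_partial:
  fixes f :: "real^'n::finite \<Rightarrow> real"
  assumes "f differentiable (at x)"
  shows "(f has_derivative (\<lambda>h. h \<bullet> (\<chi> i. partial i f x))) (at x)"
proof -
  let ?f' = "frechet_derivative f (at x)"
  have d: "(f has_derivative ?f') (at x)"
    using assms frechet_derivative_works by blast
  then have lin: "linear ?f'"
    by (rule has_derivative_linear)
  have "?f' = (\<lambda>h. h \<bullet> (\<chi> i. partial i f x))"
  proof
    fix h
    have "?f' h = ?f' (\<Sum>i\<in>UNIV. h $ i *\<^sub>R axis i 1)"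
      by (simp add: basis_expansion flip: scalar_mult_eq_scaleR)
    also have "\<dots> = (\<Sum>i\<in>UNIV. h $ i * partial i f x)"
      by (simp add: linear_sum[OF lin] linear_scale[OF lin] partial_def)
    finally show "?f' h = h \<bullet> (\<chi> i. partial i f x)"
      by (simp add: inner_vec_def)
  qed
  with d show ?thesis
    by simp
qed

lemma
  assumes "f differentiable (at x)" "g differentiable (at x)"
  shows partial_add: "partial i (\<lambda>x. f x + g x) x = partial i f x + partial i g x"
    and partial_mult: "partial i (\<lambda>x. f x * g x) x = f x * partial i g x + partial i f x * g x"
  using partial_eq[OF has_derivative_add[OF assms[THEN has_derivative_partial]]]
    partial_eq[OF has_derivative_mult[OF assms[THEN has_derivative_partial]]]
  by (auto simp: inner_vec_def axis_def if_distrib if_distribR cong: if_cong)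

text \<open>Iterated partials never leave \<open>P\<close>, so smoothness reduces to an invariant
  class that is checked for a single differentiation.\<close>

lemma smooth_fun_coinduct:
  assumes "P f"
    and "\<And>f. P f \<Longrightarrow> (\<forall>x. f differentiable (at x)) \<and> (\<forall>i. P (partial i f))"
  shows "smooth_fun f"
proof -
  have "P (dpartials is f)" for "is"
    by (induction "is") (use assms in auto)
  then show ?thesis
    using assms(2) by (auto simp: smooth_fun_def)
qed

lemma smooth_fun_differentiable: "smooth_fun f \<Longrightarrow> f differentiable (at x)"
  unfolding smooth_fun_def by (metis dpartials.simps(1))

lemma smooth_fun_partial: "smooth_fun f \<Longrightarrow> smooth_fun (partial i f)"
proof -
  have "dpartials is (partial i f) = dpartials (is @ [i]) f" for "is"
    by (induction "is") auto
  then show "smooth_fun f \<Longrightarrow> smooth_fun (partial i f)"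
    by (simp add: smooth_fun_def)
qed

lemma smooth_fun_continuous: "smooth_fun f \<Longrightarrow> continuous_on A f"
  by (meson continuous_at_imp_continuous_on differentiable_imp_continuous_within
      smooth_fun_differentiable)

lemmas smooth_fun_has_derivative = has_derivative_partial[OF smooth_fun_differentiable]

text \<open>A smooth function \<open>H 0\<close> of one real variable together with names for all
  its derivatives; the chain rule then leads from \<open>H n\<close> to \<open>H (Suc n)\<close>
  inside the same family.\<close>

definition derivative_chain :: "(nat \<Rightarrow> real \<Rightarrow> real) \<Rightarrow> bool" where
  "derivative_chain H \<longleftrightarrow> (\<forall>n t. (H n has_real_derivative H (Suc n) t) (at t))"

text \<open>Differentiating a composite yields a product and differentiating a product yields a sum,
  so the closure properties are proved together, by one invariant that contains all three
  operations.\<close>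

inductive smooth_closure :: "(real^'n::finite \<Rightarrow> real) \<Rightarrow> bool" where
  base: "smooth_fun f \<Longrightarrow> smooth_closure f"
| add: "smooth_closure f \<Longrightarrow> smooth_closure g \<Longrightarrow> smooth_closure (\<lambda>x. f x + g x)"
| mult: "smooth_closure f \<Longrightarrow> smooth_closure g \<Longrightarrow> smooth_closure (\<lambda>x. f x * g x)"
| comp: "derivative_chain H \<Longrightarrow> smooth_fun q \<Longrightarrow> smooth_closure (\<lambda>x. H n (q x))"

lemma smooth_closure_step:
  "smooth_closure f \<Longrightarrow> (\<forall>x. f differentiable (at x)) \<and> (\<forall>i. smooth_closure (partial i f))"
proof (induction rule: smooth_closure.induct)
  case (base f)
  then show ?case
    by (auto intro: smooth_closure.base smooth_fun_partial smooth_fun_differentiable)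
next
  case (add f g)
  have "partial i (\<lambda>x. f x + g x) = (\<lambda>x. partial i f x + partial i g x)" for i
    using add.IH by (auto simp: partial_add)
  then show ?case
    using add by (auto intro: smooth_closure.add)
next
  case (mult f g)
  have "partial i (\<lambda>x. f x * g x) = (\<lambda>x. f x * partial i g x + partial i f x * g x)" for i
    using mult.IH by (auto simp: partial_mult)
  then show ?case
    using mult by (auto intro!: smooth_closure.add smooth_closure.mult)
next
  case (comp H q n)
  have d: "((\<lambda>x. H n (q x)) has_derivative (\<lambda>h. H (Suc n) (q x) * (h \<bullet> (\<chi> i. partial i q x)))) (at x)" for x
    using has_derivative_compose[OF smooth_fun_has_derivative[OF comp(2)], of "H n" "\<lambda>y. H (Suc n) (q x) * y" x] comp(1)
    by (auto simp: derivative_chain_def has_field_derivative_def)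
  have "partial i (\<lambda>x. H n (q x)) = (\<lambda>x. H (Suc n) (q x) * partial i q x)" for i
    using partial_eq[OF d] by (auto simp: fun_eq_iff inner_vec_def axis_def if_distrib if_distribR cong: if_cong)
  moreover have "smooth_closure (\<lambda>x. H (Suc n) (q x) * partial i q x)" for i
    by (rule smooth_closure.mult[OF smooth_closure.comp smooth_closure.base])
      (use comp smooth_fun_partial in auto)
  ultimately show ?case
    using d by (auto simp: differentiable_def)
qed

lemma smooth_closure_smooth: "smooth_closure f \<Longrightarrow> smooth_fun f"
  by (rule smooth_fun_coinduct[where P = smooth_closure]) (use smooth_closure_step in auto)

lemma smooth_fun_add: "smooth_fun f \<Longrightarrow> smooth_fun g \<Longrightarrow> smooth_fun (\<lambda>x. f x + g x)"
  and smooth_fun_mult: "smooth_fun f \<Longrightarrow> smooth_fun g \<Longrightarrow> smooth_fun (\<lambda>x. f x * g x)"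
  and smooth_fun_compose: "derivative_chain H \<Longrightarrow> smooth_fun f \<Longrightarrow> smooth_fun (\<lambda>x. H n (f x))"
  by (auto intro!: smooth_closure_smooth intro: smooth_closure.intros)

lemma partial_const: "partial i (\<lambda>x. c) = (\<lambda>x. 0)"
  using partial_eq[OF has_derivative_const] by blast

lemma smooth_fun_const: "smooth_fun (\<lambda>x. c)"
  by (rule smooth_fun_coinduct[where P = "\<lambda>f. \<exists>c. f = (\<lambda>x. c)"]) (auto simp: partial_const)

lemma smooth_fun_component: "smooth_fun (\<lambda>x::real^'n::finite. x $ k)"
proof -
  have d: "((\<lambda>x::real^'n. x $ k) has_derivative (\<lambda>h. h $ k)) (at x)" for x
    by (rule bounded_linear_imp_has_derivative[OF bounded_linear_vec_nth])
  have "partial i (\<lambda>x::real^'n. x $ k) = (\<lambda>x. axis i 1 $ k)" for i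
    using partial_eq[OF d] by blast
  then show ?thesis
    using d by (intro smooth_fun_coinduct[where P = "\<lambda>f. f = (\<lambda>x. x $ k) \<or> (\<exists>c. f = (\<lambda>x. c))"])
      (auto simp: partial_const intro: differentiableI)
qed

lemma smooth_fun_sum:
  assumes "\<And>i. i \<in> I \<Longrightarrow> smooth_fun (f i)"
  shows "smooth_fun (\<lambda>x. \<Sum>i\<in>I. f i x)"
proof (cases "finite I")
  case True
  then show ?thesis
    using assms by (induction I) (auto intro: smooth_fun_add simp: smooth_fun_const)
qed (auto simp: smooth_fun_const)

subsection \<open>The space of test functions with the \<open>L\<^sup>2\<close> inner product\<close>

lemma tsupport_subset: "closed K \<Longrightarrow> {x. f x \<noteq> 0} \<subseteq> K \<Longrightarrow> tsupport f \<subseteq> K"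
  unfolding tsupport_def by (rule closure_minimal)

lemma in_tsupport: "f x \<noteq> 0 \<Longrightarrow> x \<in> tsupport f"
  unfolding tsupport_def by (meson closure_subset mem_Collect_eq subset_iff)

lemma compact_tsupportI:
  assumes "compact K" "{x. f x \<noteq> 0} \<subseteq> K"
  shows "compact (tsupport f)"
proof -
  have "tsupport f = K \<inter> tsupport f"
    using tsupport_subset[OF compact_imp_closed] assms by blast
  moreover have "closed (tsupport f)"
    by (simp add: tsupport_def)
  ultimately show ?thesis
    using compact_Int_closed[OF assms(1)] by metis
qed

lemma tsupport_partial: "tsupport (partial i f) \<subseteq> tsupport f"
proof (rule tsupport_subset)
  show "closed (tsupport f)"
    by (simp add: tsupport_def)
  show "{x. partial i f x \<noteq> 0} \<subseteq> tsupport f"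
  proof (rule ccontr)
    assume "\<not> ?thesis"
    then obtain x where x: "partial i f x \<noteq> 0" "x \<in> - tsupport f"
      by auto
    have "(f has_derivative (\<lambda>h. 0)) (at x)"
    proof (rule has_derivative_transform_within_open[where f = "\<lambda>y. 0"])
      show "open (- tsupport f)"
        by (simp add: tsupport_def open_Compl)
    qed (use x in_tsupport in force)+
    from partial_eq[OF this] x show False
      by simp
  qed
qed

lemma has_integral_compact_support:
  fixes F :: "'a::euclidean_space \<Rightarrow> real"
  assumes "continuous_on UNIV F" "\<And>x. x \<notin> cbox a b \<Longrightarrow> F x = 0"
  shows "(F has_integral integral (cbox a b) F) UNIV"
proof (rule has_integral_on_superset[where S = "cbox a b"])
  show "(F has_integral integral (cbox a b) F) (cbox a b)"
    using assms(1) by (meson continuous_on_subset integrable_continuous integrable_integral subset_UNIV)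
qed (use assms in auto)

text \<open>Test functions on the whole space; supports in \<open>\<Omega>\<close> are tracked
  separately by \<open>supported_in\<close>. As a type they carry the L^2 inner product as a class
  instance, and all estimates take place in this incomplete inner product space.\<close>

typedef (overloaded) ('n::finite) tf = "{f :: real^'n \<Rightarrow> real. smooth_fun f \<and> compact (tsupport f)}"
  morphisms fn Tf
proof
  show "(\<lambda>x. 0) \<in> {f :: real^'n \<Rightarrow> real. smooth_fun f \<and> compact (tsupport f)}"
    by (auto simp: smooth_fun_const tsupport_def)
qed

lemma fn_Tf: "smooth_fun f \<Longrightarrow> compact K \<Longrightarrow> {x. f x \<noteq> 0} \<subseteq> K \<Longrightarrow> fn (Tf f) = f"
  by (simp add: Tf_inverse compact_tsupportI)

lemma smooth_fn: "smooth_fun (fn f)" and compact_fn: "compact (tsupport (fn f))"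
  using fn by auto

lemma fn_box: obtains a where "\<And>x. x \<notin> cbox (- a) a \<Longrightarrow> fn f x = 0"
proof -
  obtain a where "tsupport (fn f) \<subseteq> cbox (- a) a"
    using bounded_subset_cbox_symmetric compact_fn compact_imp_bounded by metis
  then show thesis
    using that in_tsupport by blast
qed

lemma continuous_fn [continuous_intros]:
  "continuous_on A g \<Longrightarrow> continuous_on A (\<lambda>x. fn f (g x))"
  by (rule continuous_on_compose2[OF smooth_fun_continuous[OF smooth_fn, of UNIV]]) auto

lemma fn_times_integrable:
  assumes "continuous_on UNIV g"
  shows "(\<lambda>x. fn f x * g x) integrable_on UNIV"
proof -
  obtain a where "\<And>x. x \<notin> cbox (- a) a \<Longrightarrow> fn f x = 0"
    using fn_box by blast
  moreover have "continuous_on UNIV (\<lambda>x. fn f x * g x)"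
    using assms by (intro continuous_intros)
  ultimately show ?thesis
    using has_integral_compact_support[of "\<lambda>x. fn f x * g x" "- a" a]
    unfolding integrable_on_def by (metis mult_zero_left)
qed

lemma fn_has_derivative: "(fn f has_derivative (\<lambda>h. h \<bullet> (\<chi> i. partial i (fn f) x))) (at x)"
  by (rule smooth_fun_has_derivative[OF smooth_fn])

lemma tf_eqI: "(\<And>x. fn f x = fn g x) \<Longrightarrow> f = g"
  by (simp add: fn_inject[symmetric] fun_eq_iff)

instantiation tf :: (finite) real_vector
begin

definition zero_tf :: "'a tf" where "zero_tf = Tf (\<lambda>x. 0)"

definition plus_tf :: "'a tf \<Rightarrow> 'a tf \<Rightarrow> 'a tf" where "plus_tf f g = Tf (\<lambda>x. fn f x + fn g x)"

definition scaleR_tf :: "real \<Rightarrow> 'a tf \<Rightarrow> 'a tf" where "scaleR_tf r f = Tf (\<lambda>x. r * fn f x)"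

definition uminus_tf :: "'a tf \<Rightarrow> 'a tf" where "uminus_tf f = (-1) *\<^sub>R f"

definition minus_tf :: "'a tf \<Rightarrow> 'a tf \<Rightarrow> 'a tf" where "minus_tf f g = f + (-1) *\<^sub>R g"

lemma fn_zero [simp]: "fn (0 :: 'a tf) x = 0"
proof -
  have "fn (Tf (\<lambda>x. 0) :: 'a tf) = (\<lambda>x. 0)"
    by (rule fn_Tf[OF smooth_fun_const compact_empty]) auto
  then show ?thesis
    by (simp add: zero_tf_def)
qed

lemma fn_add [simp]: "fn (f + g) x = fn f x + fn g x" for f g :: "'a tf"
proof -
  have "fn (Tf (\<lambda>x. fn f x + fn g x)) = (\<lambda>x. fn f x + fn g x)"
  proof (rule fn_Tf[OF smooth_fun_add[OF smooth_fn smooth_fn] compact_Un[OF compact_fn compact_fn]])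
    show "{x. fn f x + fn g x \<noteq> 0} \<subseteq> tsupport (fn f) \<union> tsupport (fn g)"
    proof
      fix x assume "x \<in> {x. fn f x + fn g x \<noteq> 0}"
      then have "fn f x \<noteq> 0 \<or> fn g x \<noteq> 0"
        by auto
      then show "x \<in> tsupport (fn f) \<union> tsupport (fn g)"
        using in_tsupport[of "fn f" x] in_tsupport[of "fn g" x] by blast
    qed
  qed
  then show ?thesis
    by (simp add: plus_tf_def)
qed

lemma fn_scale [simp]: "fn (r *\<^sub>R f) x = r * fn f x" for f :: "'a tf"
proof -
  have "fn (Tf (\<lambda>x. r * fn f x)) = (\<lambda>x. r * fn f x)"
  proof (rule fn_Tf[OF smooth_fun_mult[OF smooth_fun_const smooth_fn] compact_fn])
    show "{x. r * fn f x \<noteq> 0} \<subseteq> tsupport (fn f)"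
    proof
      fix x assume "x \<in> {x. r * fn f x \<noteq> 0}"
      then show "x \<in> tsupport (fn f)"
        using in_tsupport[of "fn f" x] by auto
    qed
  qed
  then show ?thesis
    by (simp add: scaleR_tf_def)
qed

instance
proof
  fix f g h :: "'a tf" and r s :: real
  show "f + g + h = f + (g + h)" "f + g = g + f" "0 + f = f"
    "r *\<^sub>R (f + g) = r *\<^sub>R f + r *\<^sub>R g" "(r + s) *\<^sub>R f = r *\<^sub>R f + s *\<^sub>R f"
    "r *\<^sub>R s *\<^sub>R f = (r * s) *\<^sub>R f" "1 *\<^sub>R f = f"
    by (rule tf_eqI, simp add: algebra_simps)+
  show "- f + f = 0" "f - g = f + - g"
    by (rule tf_eqI, simp only: uminus_tf_def minus_tf_def fn_add fn_scale fn_zero)+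
qed

end

lemma fn_minus [simp]: "fn (- f) x = - fn f x"
  and fn_diff [simp]: "fn (f - g) x = fn f x - fn g x"
  by (simp_all only: uminus_tf_def minus_tf_def fn_add fn_scale)

lemma fn_sum [simp]: "fn (sum f I) x = (\<Sum>i\<in>I. fn (f i) x)"
  by (induction I rule: infinite_finite_induct) auto

instantiation tf :: (finite) real_inner
begin

definition inner_tf :: "'a tf \<Rightarrow> 'a tf \<Rightarrow> real" where
  "inner_tf f g = integral UNIV (\<lambda>x. fn f x * fn g x)"

definition norm_tf :: "'a tf \<Rightarrow> real" where "norm_tf f = sqrt (inner f f)"

definition sgn_tf :: "'a tf \<Rightarrow> 'a tf" where "sgn_tf f = inverse (norm f) *\<^sub>R f"

definition dist_tf :: "'a tf \<Rightarrow> 'a tf \<Rightarrow> real" where "dist_tf f g = norm (f - g)"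

definition uniformity_tf :: "('a tf \<times> 'a tf) filter" where
  "uniformity_tf = (INF e\<in>{0<..}. principal {(x, y). dist x y < e})"

definition open_tf :: "'a tf set \<Rightarrow> bool" where
  "open_tf U \<longleftrightarrow> (\<forall>x\<in>U. eventually (\<lambda>(x', y). x' = x \<longrightarrow> y \<in> U) uniformity)"

instance
proof
  fix f g h :: "'a tf" and r :: real and U :: "'a tf set"
  have int: "(\<lambda>x. fn f x * fn g x) integrable_on UNIV" for f g :: "'a tf"
    by (intro fn_times_integrable continuous_intros)
  show "dist f g = norm (f - g)" "sgn f = inverse (norm f) *\<^sub>R f"
    "uniformity = (INF e\<in>{0<..}. principal {(x, y :: 'a tf). dist x y < e})"
    "open U \<longleftrightarrow> (\<forall>x\<in>U. eventually (\<lambda>(x', y). x' = x \<longrightarrow> y \<in> U) uniformity)"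
    "norm f = sqrt (inner f f)"
    by (simp_all add: dist_tf_def sgn_tf_def uniformity_tf_def open_tf_def norm_tf_def)
  show "inner f g = inner g f"
    by (simp add: inner_tf_def mult.commute)
  show "inner (f + g) h = inner f h + inner g h"
    by (simp add: inner_tf_def ring_distribs integral_add int)
  show "inner (r *\<^sub>R f) g = r * inner f g"
    by (simp add: inner_tf_def mult.assoc)
  show "0 \<le> inner f f"
    unfolding inner_tf_def by (rule integral_nonneg[OF int]) auto
  show "inner f f = 0 \<longleftrightarrow> f = 0"
  proof
    assume 0: "inner f f = 0"
    show "f = 0"
    proof (rule tf_eqI)
      fix x
      obtain a where a: "\<And>x. x \<notin> cbox (- a) a \<Longrightarrow> fn f x = 0"
        using fn_box by blast
      \<comment> \<open>The point \<open>x\<close> may lie outside the support box. The larger box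
        contains it and has nonempty interior, so a continuous nonnegative integrand with integral
        zero vanishes at \<open>x\<close>.\<close>
      obtain b where b: "cbox (- a) a \<union> cball x 1 \<subseteq> box (- b) b"
        using bounded_subset_box_symmetric[of "cbox (- a) a \<union> cball x 1"] by auto
      then have *: "\<And>x. x \<notin> cbox (- b) b \<Longrightarrow> fn f x = 0" and "x \<in> box (- b) b"
        using a box_subset_cbox[of "- b" b] centre_in_cball[of x 1] by (meson UnI1 subsetD, meson UnI2 subsetD zero_le_one)
      have "((\<lambda>x. fn f x * fn f x) has_integral integral (cbox (- b) b) (\<lambda>x. fn f x * fn f x)) UNIV"
        by (rule has_integral_compact_support) (auto intro!: continuous_intros simp: *)
      then have "integral (cbox (- b) b) (\<lambda>x. fn f x * fn f x) = 0"
        using 0 by (simp add: inner_tf_def integral_unique)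
      then have "((\<lambda>x. fn f x * fn f x) has_integral 0) (cbox (- b) b)"
        by (auto simp: has_integral_iff intro!: integrable_continuous continuous_intros)
      then have "fn f x * fn f x = 0"
        using \<open>x \<in> box (- b) b\<close> box_subset_cbox
        by (intro has_integral_0_cbox_imp_0[of "- b" b "\<lambda>x. fn f x * fn f x"])
          (auto intro!: continuous_intros)
      then show "fn f x = fn 0 x"
        by simp
    qed
  qed (simp add: inner_tf_def)
qed

end

subsection \<open>Translations, directional means and derivatives\<close>

definition partial_tf :: "'n \<Rightarrow> 'n::finite tf \<Rightarrow> 'n tf" where
  "partial_tf i f = Tf (partial i (fn f))"

definition times_tf :: "'n::finite tf \<Rightarrow> 'n tf \<Rightarrow> 'n tf" where
  "times_tf f g = Tf (\<lambda>x. fn f x * fn g x)"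

definition translate :: "real^'n::finite \<Rightarrow> 'n tf \<Rightarrow> 'n tf" where
  "translate a f = Tf (\<lambda>x. fn f (x - a))"

text \<open>The average is one-sided: the value at \<open>x\<close> uses only points behind it along
  \<open>a\<close>, so supports move forwards only. This keeps them inside a domain that is stable
  along a cone.\<close>

definition segment_mean :: "real^'n::finite \<Rightarrow> 'n tf \<Rightarrow> 'n tf" where
  "segment_mean a f = Tf (\<lambda>x. integral {0..1} (\<lambda>t. fn f (x - t *\<^sub>R a)))"

definition dir_deriv :: "real^'n::finite \<Rightarrow> 'n tf \<Rightarrow> 'n tf" where
  "dir_deriv a f = (\<Sum>i\<in>UNIV. a $ i *\<^sub>R partial_tf i f)"

lemma fn_partial_tf: "fn (partial_tf i f) x = partial i (fn f) x"
proof -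
  have "fn (Tf (partial i (fn f))) = partial i (fn f)"
  proof (rule fn_Tf[OF smooth_fun_partial[OF smooth_fn] compact_fn[of f]])
    show "{x. partial i (fn f) x \<noteq> 0} \<subseteq> tsupport (fn f)"
      using in_tsupport[of "partial i (fn f)"] tsupport_partial[of i "fn f"] by auto
  qed
  then show ?thesis
    by (simp add: partial_tf_def)
qed

lemma fn_times_tf: "fn (times_tf f g) x = fn f x * fn g x"
proof -
  have "fn (Tf (\<lambda>x. fn f x * fn g x)) = (\<lambda>x. fn f x * fn g x)"
  proof (rule fn_Tf[OF smooth_fun_mult[OF smooth_fn smooth_fn] compact_fn[of f]])
    show "{x. fn f x * fn g x \<noteq> 0} \<subseteq> tsupport (fn f)"
    proof
      fix x assume "x \<in> {x. fn f x * fn g x \<noteq> 0}"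
      then show "x \<in> tsupport (fn f)"
        using in_tsupport[of "fn f" x] by auto
    qed
  qed
  then show ?thesis
    by (simp add: times_tf_def)
qed

lemma partial_translate:
  assumes "smooth_fun f"
  shows "partial i (\<lambda>x. f (x - a)) = (\<lambda>x. partial i f (x - a))"
    and "(\<lambda>x. f (x - a)) differentiable (at x)"
proof -
  have d: "((\<lambda>x. f (x - a)) has_derivative (\<lambda>h. h \<bullet> (\<chi> i. partial i f (x - a)))) (at x)" for x
    by (rule has_derivative_compose[OF _ smooth_fun_has_derivative[OF assms], of "\<lambda>x. x - a" "\<lambda>h. h"])
      (auto intro!: derivative_eq_intros)
  show "partial i (\<lambda>x. f (x - a)) = (\<lambda>x. partial i f (x - a))"
    using partial_eq[OF d] by (auto simp: fun_eq_iff inner_axis' )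
  show "(\<lambda>x. f (x - a)) differentiable (at x)"
    using d by (auto simp: differentiable_def)
qed

lemma fn_translate: "fn (translate a f) x = fn f (x - a)"
proof -
  have "smooth_fun (\<lambda>x. fn f (x - a))"
    by (rule smooth_fun_coinduct[where P = "\<lambda>g. \<exists>f. smooth_fun f \<and> g = (\<lambda>x. f (x - a))"])
      (use smooth_fn in \<open>auto simp: partial_translate intro: smooth_fun_partial\<close>)
  then have "fn (Tf (\<lambda>x. fn f (x - a))) = (\<lambda>x. fn f (x - a))"
  proof (rule fn_Tf[OF _ compact_translation[OF compact_fn[of f], of a]])
    show "{x. fn f (x - a) \<noteq> 0} \<subseteq> (+) a ` tsupport (fn f)"
    proof
      fix x assume "x \<in> {x. fn f (x - a) \<noteq> 0}"
      then have "x - a \<in> tsupport (fn f)"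
        by (simp add: in_tsupport)
      then show "x \<in> (+) a ` tsupport (fn f)"
        by (rule rev_image_eqI) simp
    qed
  qed
  then show ?thesis
    by (simp add: translate_def)
qed

text \<open>Differentiation under the integral sign; the gradient is bundled as a bounded linear
  map, so the Leibniz rule treats all partials at once.\<close>

lemma partial_mean:
  assumes "smooth_fun f"
  shows "partial i (\<lambda>x. integral {0..1} (\<lambda>t. f (x - t *\<^sub>R a)))
       = (\<lambda>x. integral {0..1} (\<lambda>t. partial i f (x - t *\<^sub>R a)))"
    and "(\<lambda>x. integral {0..1} (\<lambda>t. f (x - t *\<^sub>R a))) differentiable (at x)"
proof -
  let ?f' = "\<lambda>x t. blinfun_inner_left (\<chi> i. partial i f (x - t *\<^sub>R a))"
  have cp: "continuous_on A (\<lambda>x. partial i f (g x))" if "continuous_on A g" for A i and g :: "'b::topological_space \<Rightarrow> real^'a"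
    by (rule continuous_on_compose2[OF smooth_fun_continuous[OF smooth_fun_partial[OF assms]] that]) auto
  have cf: "continuous_on A (\<lambda>x. f (g x))" if "continuous_on A g" for A and g :: "'b::topological_space \<Rightarrow> real^'a"
    by (rule continuous_on_compose2[OF smooth_fun_continuous[OF assms] that]) auto
  have c: "continuous_on (UNIV \<times> cbox 0 1) (\<lambda>(x, t). ?f' x t)"
    unfolding case_prod_unfold
    by (intro bounded_linear.continuous_on[OF bounded_linear_blinfun_inner_left]
        continuous_on_vec_lambda cp continuous_intros)
  have d: "((\<lambda>x. integral (cbox 0 1) (\<lambda>t. f (x - t *\<^sub>R a))) has_derivative
      integral (cbox 0 1) (?f' x)) (at x)" for x
  proof (rule leibniz_rule[where U = UNIV, OF _ _ c])
    fix x :: "real^'a" and t :: real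
    show "((\<lambda>x. f (x - t *\<^sub>R a)) has_derivative ?f' x t) (at x)"
      unfolding blinfun_inner_left.rep_eq
      by (rule has_derivative_compose[OF _ smooth_fun_has_derivative[OF assms], of "\<lambda>x. x - t *\<^sub>R a" "\<lambda>h. h"])
        (auto intro!: derivative_eq_intros)
    show "(\<lambda>t. f (x - t *\<^sub>R a)) integrable_on cbox 0 1"
      by (intro integrable_continuous cf continuous_intros)
  qed auto
  have i: "?f' x integrable_on {0..1}" for x
    by (intro integrable_continuous_interval bounded_linear.continuous_on[OF bounded_linear_blinfun_inner_left]
        continuous_on_vec_lambda cp continuous_intros)
  show "partial i (\<lambda>x. integral {0..1} (\<lambda>t. f (x - t *\<^sub>R a)))
       = (\<lambda>x. integral {0..1} (\<lambda>t. partial i f (x - t *\<^sub>R a)))"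
    using partial_eq[OF d] by (auto simp: fun_eq_iff blinfun_apply_integral[OF i] inner_axis')
  show "(\<lambda>x. integral {0..1} (\<lambda>t. f (x - t *\<^sub>R a))) differentiable (at x)"
    using d by (auto simp: differentiable_def)
qed

lemma mean_nonzero:
  fixes f :: "real^'n::finite \<Rightarrow> real"
  assumes "integral {0..1} (\<lambda>t. f (x - t *\<^sub>R a)) \<noteq> (0::real)"
  obtains t y where "0 \<le> t" "t \<le> 1" "f y \<noteq> 0" "x = y + t *\<^sub>R a"
proof -
  have "\<exists>t\<in>{0..1}. f (x - t *\<^sub>R a) \<noteq> 0"
    using assms by (metis (no_types, lifting) integral_0 integral_cong)
  then obtain t where "t \<in> {0..1}" "f (x - t *\<^sub>R a) \<noteq> 0"
    by blast
  then show thesis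
    using that[of t "x - t *\<^sub>R a"] by simp
qed

lemma fn_segment_mean: "fn (segment_mean a f) x = integral {0..1} (\<lambda>t. fn f (x - t *\<^sub>R a))"
proof -
  let ?g = "\<lambda>f x. integral {0..1} (\<lambda>t. f (x - t *\<^sub>R a))"
  have "smooth_fun (?g (fn f))"
    by (rule smooth_fun_coinduct[where P = "\<lambda>g. \<exists>f. smooth_fun f \<and> g = ?g f"])
      (use smooth_fn in \<open>auto simp: partial_mean intro: smooth_fun_partial\<close>)
  moreover have "compact ((\<lambda>(x, t). x + t *\<^sub>R a) ` (tsupport (fn f) \<times> {0..1}))"
    by (intro compact_continuous_image compact_Times compact_fn)
      (auto simp: case_prod_unfold intro!: continuous_intros)
  moreover have "{x. ?g (fn f) x \<noteq> 0} \<subseteq> (\<lambda>(x, t). x + t *\<^sub>R a) ` (tsupport (fn f) \<times> {0..1})"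
  proof
    fix x assume "x \<in> {x. ?g (fn f) x \<noteq> 0}"
    then obtain t y where "0 \<le> t" "t \<le> 1" "fn f y \<noteq> 0" "x = y + t *\<^sub>R a"
      using mean_nonzero by blast
    then show "x \<in> (\<lambda>(x, t). x + t *\<^sub>R a) ` (tsupport (fn f) \<times> {0..1})"
      by (intro image_eqI[of _ _ "(y, t)"]) (auto intro: in_tsupport)
  qed
  ultimately have "fn (Tf (?g (fn f))) = ?g (fn f)"
    by (rule fn_Tf)
  then show ?thesis
    by (simp add: segment_mean_def)
qed

section \<open>Linearity and commutation relations\<close>

lemma linear_translate: "linear (translate a)"
  by (rule linearI; rule tf_eqI) (simp_all add: fn_translate)

lemma linear_times_tf: "linear (times_tf f)"
  by (rule linearI; rule tf_eqI) (simp_all add: fn_times_tf algebra_simps)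

lemma integrable_fn: "continuous_on {0..1::real} g \<Longrightarrow> (\<lambda>t. fn f (g t)) integrable_on {0..1}"
  by (intro integrable_continuous_interval continuous_intros)

lemma linear_segment_mean: "linear (segment_mean a)"
  by (rule linearI; rule tf_eqI)
    (simp_all add: fn_segment_mean integral_add integrable_fn continuous_intros)

lemma linear_partial_tf: "linear (partial_tf i)"
proof (rule linearI; rule tf_eqI)
  fix f g :: "'a tf" and r x
  have "fn (f + g) = (\<lambda>x. fn f x + fn g x)"
    by auto
  then show "fn (partial_tf i (f + g)) x = fn (partial_tf i f + partial_tf i g) x"
    by (simp add: fn_partial_tf partial_add smooth_fun_differentiable[OF smooth_fn])
  have "fn (r *\<^sub>R f) = (\<lambda>x. r * fn f x)"
    by auto
  then show "fn (partial_tf i (r *\<^sub>R f)) x = fn (r *\<^sub>R partial_tf i f) x"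
    by (simp add: fn_partial_tf partial_mult smooth_fun_differentiable[OF smooth_fn] partial_const
        smooth_fun_differentiable[OF smooth_fun_const])
qed

lemma partial_tf_times_tf: "partial_tf i (times_tf f g) = times_tf f (partial_tf i g) + times_tf (partial_tf i f) g"
proof (rule tf_eqI)
  fix x
  have "fn (times_tf f g) = (\<lambda>x. fn f x * fn g x)"
    by (auto simp: fn_times_tf)
  then show "fn (partial_tf i (times_tf f g)) x = fn (times_tf f (partial_tf i g) + times_tf (partial_tf i f) g) x"
    by (simp add: fn_partial_tf fn_times_tf partial_mult smooth_fun_differentiable[OF smooth_fn])
qed

lemma linear_dir_deriv: "linear (dir_deriv a)"
  by (rule linearI) (simp_all add: dir_deriv_def linear_add[OF linear_partial_tf] linear_scale[OF linear_partial_tf]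
      scaleR_add_right sum.distrib scaleR_sum_right ac_simps)

lemmas tf_linear = linear_translate linear_segment_mean linear_partial_tf linear_dir_deriv linear_times_tf
lemmas tf_add = tf_linear[THEN linear_add]
lemmas tf_scale = tf_linear[THEN linear_scale]
lemmas tf_diff = tf_linear[THEN linear_diff]
lemmas tf_neg = tf_linear[THEN linear_neg]
lemmas tf_0 = tf_linear[THEN linear_0]
lemmas tf_sum = tf_linear[THEN linear_sum]

lemma translate_translate: "translate a (translate b f) = translate (a + b) f"
  by (rule tf_eqI) (simp add: fn_translate algebra_simps)

lemma translate_0: "translate 0 f = f"
  by (rule tf_eqI) (simp add: fn_translate)

lemma segment_mean_translate: "segment_mean a (translate b f) = translate b (segment_mean a f)"
  by (rule tf_eqI) (simp add: fn_translate fn_segment_mean algebra_simps)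

lemma partial_tf_translate: "partial_tf i (translate b f) = translate b (partial_tf i f)"
proof (rule tf_eqI)
  fix x
  have "fn (translate b f) = (\<lambda>x. fn f (x - b))"
    by (auto simp: fn_translate)
  then show "fn (partial_tf i (translate b f)) x = fn (translate b (partial_tf i f)) x"
    by (simp add: fn_partial_tf fn_translate partial_translate smooth_fn)
qed

lemma partial_tf_segment_mean: "partial_tf i (segment_mean b f) = segment_mean b (partial_tf i f)"
proof (rule tf_eqI)
  fix x
  have "fn (segment_mean b f) = (\<lambda>x. integral {0..1} (\<lambda>t. fn f (x - t *\<^sub>R b)))"
    by (auto simp: fn_segment_mean)
  then show "fn (partial_tf i (segment_mean b f)) x = fn (segment_mean b (partial_tf i f)) x"
    by (simp add: fn_partial_tf fn_segment_mean partial_mean smooth_fn)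
qed

text \<open>Fubini for a continuous integrand on the unit square.\<close>

lemma segment_mean_segment_mean: "segment_mean a (segment_mean b f) = segment_mean b (segment_mean a f)"
proof (rule tf_eqI)
  fix x
  have "integral (cbox 0 1) (\<lambda>t. integral (cbox 0 1) (\<lambda>s. fn f (x - t *\<^sub>R a - s *\<^sub>R b))) =
     integral (cbox 0 1) (\<lambda>s. integral (cbox 0 1) (\<lambda>t. fn f (x - t *\<^sub>R a - s *\<^sub>R b)))"
    by (rule integral_swap_continuous) (auto simp: case_prod_unfold intro!: continuous_intros)
  then show "fn (segment_mean a (segment_mean b f)) x = fn (segment_mean b (segment_mean a f)) x"
    by (simp add: fn_segment_mean algebra_simps)
qed

lemma dir_deriv_segment_mean: "dir_deriv a (segment_mean b f) = segment_mean b (dir_deriv a f)"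
  by (simp add: dir_deriv_def tf_sum tf_scale partial_tf_segment_mean)

lemma dir_deriv_scale: "dir_deriv (r *\<^sub>R a) f = r *\<^sub>R dir_deriv a f"
  by (simp add: dir_deriv_def scaleR_sum_right)

lemma fn_dir_deriv: "fn (dir_deriv a f) x = a \<bullet> (\<chi> i. partial i (fn f) x)"
  by (simp add: dir_deriv_def fn_partial_tf inner_vec_def)

text \<open>Fundamental theorem of calculus along the segment: a derivative in the direction of
  averaging becomes a difference. Every L^2 bound for a derivative goes back to this
  identity.\<close>

lemma dir_deriv_segment_mean_self: "dir_deriv a (segment_mean a f) = f - translate a f"
proof (rule tf_eqI)
  fix x
  have "((\<lambda>t. - fn f (x - t *\<^sub>R a)) has_vector_derivative fn (dir_deriv a f) (x - t *\<^sub>R a)) (at t within {0..1})" for t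
  proof -
    have "((\<lambda>t. fn f (x - t *\<^sub>R a)) has_derivative
        (\<lambda>s. (- (s *\<^sub>R a)) \<bullet> (\<chi> i. partial i (fn f) (x - t *\<^sub>R a)))) (at t within {0..1})"
      by (rule has_derivative_compose[OF _ fn_has_derivative, of "\<lambda>t. x - t *\<^sub>R a" "\<lambda>s. - (s *\<^sub>R a)"])
        (auto intro!: derivative_eq_intros)
    from has_derivative_minus[OF this] show ?thesis
      by (simp add: has_vector_derivative_def fn_dir_deriv)
  qed
  then have "((\<lambda>t. fn (dir_deriv a f) (x - t *\<^sub>R a)) has_integral (- fn f (x - 1 *\<^sub>R a)) - (- fn f (x - 0 *\<^sub>R a))) {0..1}"
    by (intro fundamental_theorem_of_calculus) auto
  then show "fn (dir_deriv a (segment_mean a f)) x = fn (f - translate a f) x"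
    by (simp add: dir_deriv_segment_mean fn_segment_mean fn_translate integral_unique)
qed

text \<open>The segment of \<open>2 *\<^sub>R b\<close> is cut at its midpoint, and its second half
  is the first one translated by \<open>b\<close>. On the Fourier side this is m(2z) = m(z) (1 +
  exp(-iz)) / 2.\<close>

lemma segment_mean_double: "segment_mean (2 *\<^sub>R b) f = segment_mean b ((1/2) *\<^sub>R (f + translate b f))"
proof (rule tf_eqI)
  fix x
  define g where "g t = fn f (x - t *\<^sub>R b)" for t
  define A where "A = integral {0..1} g"
  define B where "B = integral {0..1} (\<lambda>t. g (t + 1))"
  have "(g has_integral A) {0..1}"
    unfolding A_def g_def by (intro integrable_integral integrable_fn continuous_intros)
  moreover have h: "((\<lambda>t. g (t + 1)) has_integral B) {0..1}"
    unfolding B_def g_def by (intro integrable_integral integrable_fn continuous_intros)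
  then have "(g has_integral B) {1..2}"
    using has_integral_shift_real_ivl[OF h, of "-1"] by simp
  ultimately have "(g has_integral (A + B)) (cbox 0 2)"
    using has_integral_combine[of 0 1 2 g A B] by simp
  from has_integral_affinity'[OF this, of 2 0]
  have "((\<lambda>t. g (2 * t)) has_integral (A + B) / 2) {0..1}"
    by (simp del: scaleR_add_right flip: divide_inverse_commute)
  then have "fn (segment_mean (2 *\<^sub>R b) f) x = (A + B) / 2"
    by (simp add: fn_segment_mean g_def integral_unique mult.commute)
  moreover have "fn (segment_mean b (translate b f)) x = B"
    by (simp add: fn_segment_mean fn_translate B_def g_def algebra_simps)
  ultimately show "fn (segment_mean (2 *\<^sub>R b) f) x = fn (segment_mean b ((1/2) *\<^sub>R (f + translate b f))) x"
    by (simp add: tf_add tf_scale A_def g_def[abs_def] fn_segment_mean[of b f])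
qed

section \<open>Adjoints and norm bounds\<close>

lemma inner_translate_translate: "inner (translate a f) (translate a g) = inner f g"
proof -
  obtain c where c: "\<And>x. x \<notin> cbox (- c) c \<Longrightarrow> fn f x = 0"
    using fn_box by blast
  let ?F = "\<lambda>x. fn f x * fn g x"
  have "((\<lambda>x. ?F (x + - a)) has_integral integral (cbox (- c - - a) (c - - a)) (\<lambda>x. ?F (x + - a))) UNIV"
    by (rule has_integral_compact_support) (auto intro!: continuous_intros c simp: mem_box algebra_simps)
  moreover have "(?F has_integral integral (cbox (- c) c) ?F) UNIV"
    by (rule has_integral_compact_support) (auto intro!: continuous_intros c)
  ultimately show ?thesis
    using integral_shift_cbox[of "- c" "- a" c ?F]
    by (simp add: inner_tf_def fn_translate integral_unique)
qed

lemma norm_translate [simp]: "norm (translate a f) = norm f"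
  by (simp add: norm_eq_sqrt_inner inner_translate_translate)

lemma inner_translate_left: "inner (translate a f) g = inner f (translate (- a) g)"
  using inner_translate_translate[of "- a" "translate a f" g] by (simp add: translate_translate translate_0)

text \<open>By Fubini the average can be pulled out of a pairing, so bounds for means follow from
  bounds for single translates by integrating real functions of t.\<close>

lemma inner_segment_mean:
  "((\<lambda>t. inner (translate (t *\<^sub>R a) f) g) has_integral inner (segment_mean a f) g) {0..1}"
proof -
  obtain c where c: "\<And>x. x \<notin> cbox (- c) c \<Longrightarrow> fn g x = 0"
    using fn_box by blast
  have int: "inner h g = integral (cbox (- c) c) (\<lambda>x. fn h x * fn g x)" for h
    unfolding inner_tf_def
    by (intro integral_unique has_integral_compact_support) (auto intro!: continuous_intros c)
  have "inner (segment_mean a f) g = integral (cbox (- c) c) (\<lambda>x. integral (cbox 0 1) (\<lambda>t. fn f (x - t *\<^sub>R a) * fn g x))"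
    by (simp add: int fn_segment_mean)
  also have "\<dots> = integral (cbox 0 1) (\<lambda>t. integral (cbox (- c) c) (\<lambda>x. fn f (x - t *\<^sub>R a) * fn g x))"
    by (rule integral_swap_continuous) (auto simp: case_prod_unfold intro!: continuous_intros)
  also have "\<dots> = integral {0..1} (\<lambda>t. inner (translate (t *\<^sub>R a) f) g)"
    by (simp add: int fn_translate)
  finally have *: "inner (segment_mean a f) g = \<dots>" .
  have "continuous_on (cbox 0 1) (\<lambda>t. integral (cbox (- c) c) (\<lambda>x. fn f (x - t *\<^sub>R a) * fn g x))"
    by (rule integral_continuous_on_param) (auto simp: case_prod_unfold intro!: continuous_intros)
  then have "(\<lambda>t. inner (translate (t *\<^sub>R a) f) g) integrable_on {0..1}"
    by (auto simp: int fn_translate intro: integrable_continuous_interval)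
  then show ?thesis
    unfolding * by (rule integrable_integral)
qed

lemma inner_segment_mean_le:
  assumes "\<And>t. 0 \<le> t \<Longrightarrow> t \<le> 1 \<Longrightarrow> inner (translate (t *\<^sub>R a) f) g \<le> B"
  shows "inner (segment_mean a f) g \<le> B"
  using has_integral_le[OF inner_segment_mean has_integral_const_real[of B 0 1]] assms by auto

text \<open>Duality in the form used throughout: the vector is tested against itself.\<close>

lemma norm_le_inner: "inner x x \<le> B * norm x \<Longrightarrow> 0 \<le> B \<Longrightarrow> norm (x::'a::real_inner) \<le> B"
  by (metis dot_square_norm mult_right_le_imp_le norm_ge_zero order_le_less power2_eq_square)

lemma norm_segment_mean: "norm (segment_mean a f) \<le> norm f"
  by (rule norm_le_inner[OF inner_segment_mean_le]) (auto intro: order.trans[OF norm_cauchy_schwarz])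

text \<open>Up to sign, \<open>translate (t *\<^sub>R b) f - f\<close> is the derivative of a mean
  over the segment of \<open>t *\<^sub>R b\<close>, hence bounded by the derivative of
  \<open>f\<close>. The average over t is taken after pairing with the difference itself.\<close>

lemma norm_segment_mean_diff: "norm (segment_mean b f - f) \<le> norm (dir_deriv b f)"
proof (rule norm_le_inner)
  let ?g = "segment_mean b f - f"
  have *: "inner (translate (t *\<^sub>R b) f) ?g \<le> norm (dir_deriv b f) * norm ?g + inner f ?g" if "0 \<le> t" "t \<le> 1" for t
  proof -
    have "norm (translate (t *\<^sub>R b) f - f) = norm (dir_deriv (t *\<^sub>R b) (segment_mean (t *\<^sub>R b) f))"
      by (simp add: dir_deriv_segment_mean_self norm_minus_commute)
    also have "\<dots> \<le> norm (dir_deriv (t *\<^sub>R b) f)"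
      unfolding dir_deriv_segment_mean by (rule norm_segment_mean)
    also have "\<dots> \<le> norm (dir_deriv b f)"
      using that by (simp add: dir_deriv_scale mult_left_le_one_le)
    finally have "inner (translate (t *\<^sub>R b) f - f) ?g \<le> norm (dir_deriv b f) * norm ?g"
      by (meson norm_cauchy_schwarz mult_right_mono norm_ge_zero order_trans)
    then show ?thesis
      by (simp add: inner_diff_left)
  qed
  show "inner ?g ?g \<le> norm (dir_deriv b f) * norm ?g"
    using inner_segment_mean_le[OF *] by (simp add: inner_diff_left)
qed simp

text \<open>The adjoint averages over the reversed segment, which is the forward segment shifted by
  \<open>- a\<close>; substituting 1 - t for t makes this precise. Adjoints thus stay in the same
  family up to a translation.\<close>

lemma inner_segment_mean_left: "inner (segment_mean a f) g = inner f (translate (- a) (segment_mean a g))"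
proof -
  have eq: "inner (translate (t *\<^sub>R a) (translate (- a) g)) f = inner (translate ((1 - t) *\<^sub>R a) f) g" for t
  proof -
    have "inner (translate ((1 - t) *\<^sub>R a) f) g = inner f (translate (- ((1 - t) *\<^sub>R a)) g)"
      by (rule inner_translate_left)
    also have "\<dots> = inner (translate (t *\<^sub>R a) (translate (- a) g)) f"
      by (simp add: inner_commute translate_translate algebra_simps)
    finally show ?thesis ..
  qed
  have "((\<lambda>t. inner (translate ((1 - t) *\<^sub>R a) f) g) has_integral inner (segment_mean a (translate (- a) g)) f) {0..1}"
    using inner_segment_mean[of a "translate (- a) g" f] by (simp only: eq)
  from has_integral_affinity[OF this[folded cbox_interval], of "-1" 1]
  have "((\<lambda>t. inner (translate (t *\<^sub>R a) f) g) has_integral inner (segment_mean a (translate (- a) g)) f) {0..1}"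
    by simp
  then show ?thesis
    using inner_segment_mean[of a f g] by (metis has_integral_unique inner_commute segment_mean_translate)
qed

subsection \<open>Square functions\<close>

definition mean_diff :: "real^'n::finite \<Rightarrow> 'n tf \<Rightarrow> 'n tf" where
  "mean_diff b f = segment_mean b f - segment_mean (2 *\<^sub>R b) f"

definition half_sum :: "real^'n::finite \<Rightarrow> 'n tf \<Rightarrow> 'n tf" where
  "half_sum b f = (1/2) *\<^sub>R (f + translate b f)"

lemma segment_mean_double_half_sum: "segment_mean (2 *\<^sub>R b) f = segment_mean b (half_sum b f)"
  by (simp add: segment_mean_double half_sum_def)

lemma mean_diff_eq: "mean_diff b f = (1/2) *\<^sub>R segment_mean b (f - translate b f)"
proof -
  have "f - half_sum b f = (1/2) *\<^sub>R (f - translate b f)"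
    by (rule tf_eqI) (simp add: half_sum_def field_simps)
  then show ?thesis
    by (metis mean_diff_def segment_mean_double_half_sum tf_diff(2) tf_scale(2))
qed

text \<open>One mean is consumed in turning the derivative into a first difference, and the other
  makes that difference a \<open>mean_diff\<close>. Read backwards, \<open>mean_diff\<close> is an
  exact derivative, with an antiderivative built from two means.\<close>

lemma dir_deriv_segment_mean_segment_mean: "dir_deriv b (segment_mean b (segment_mean b f)) = 2 *\<^sub>R mean_diff b f"
  by (simp add: dir_deriv_segment_mean_self mean_diff_eq segment_mean_translate tf_diff)

text \<open>The longer mean and \<open>mean_diff\<close> are the half sum and the half difference of
  \<open>segment_mean b f\<close> and its translate, and these two have equal norms.\<close>

lemma norm_segment_mean_square: "(norm (segment_mean b f))\<^sup>2 = (norm (segment_mean (2 *\<^sub>R b) f))\<^sup>2 + (norm (mean_diff b f))\<^sup>2"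
proof -
  let ?g = "segment_mean b f"
  have "segment_mean (2 *\<^sub>R b) f = (1/2) *\<^sub>R (?g + translate b ?g)" "mean_diff b f = (1/2) *\<^sub>R (?g - translate b ?g)"
    by (simp_all add: segment_mean_double mean_diff_eq tf_add tf_diff tf_scale segment_mean_translate)
  moreover have "(norm g)\<^sup>2 = (norm ((1/2) *\<^sub>R (g + h)))\<^sup>2 + (norm ((1/2) *\<^sub>R (g - h)))\<^sup>2"
    if "inner h h = inner g g" for g h :: "'a tf"
    using that by (simp add: power_divide power2_norm_eq_inner inner_add inner_diff inner_commute[of h g]
        del: scaleR_add_right scaleR_diff_right) (simp add: field_simps)
  ultimately show ?thesis
    using inner_translate_translate by metis
qed

lemma sum_norm_mean_diff: "(\<Sum>n<N. (norm (mean_diff (2^n *\<^sub>R b) f))\<^sup>2) \<le> (norm f)\<^sup>2"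
proof -
  have "(\<Sum>n<N. (norm (mean_diff (2^n *\<^sub>R b) f))\<^sup>2) = (norm (segment_mean b f))\<^sup>2 - (norm (segment_mean (2^N *\<^sub>R b) f))\<^sup>2"
  proof (induction N)
    case (Suc N)
    then show ?case
      using norm_segment_mean_square[of "2^N *\<^sub>R b" f] by simp
  qed simp
  also have "\<dots> \<le> (norm f)\<^sup>2"
    using norm_segment_mean[of b f] by (smt (verit) norm_ge_zero power_mono zero_le_power2)
  finally show ?thesis .
qed

text \<open>The adjoints of the two means carry shifts by -b and -2b. Extracting the larger shift
  leaves the translate by b of the shorter mean minus the longer mean, and the doubling relation
  turns this into \<open>- mean_diff b g\<close>.\<close>

lemma inner_mean_diff: "inner (mean_diff b f) g = - inner f (translate (- (2 *\<^sub>R b)) (mean_diff b g))"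
proof -
  have "translate (- b) (segment_mean b g) - translate (- (2 *\<^sub>R b)) (segment_mean (2 *\<^sub>R b) g) = - translate (- (2 *\<^sub>R b)) (mean_diff b g)"
  proof -
    have "translate (- b) (segment_mean b g) = translate (- (2 *\<^sub>R b)) (translate b (segment_mean b g))"
      by (simp add: translate_translate scaleR_2)
    moreover have "translate b (segment_mean b g) - segment_mean (2 *\<^sub>R b) g = - mean_diff b g"
      by (rule tf_eqI) (simp add: mean_diff_eq segment_mean_double tf_add tf_scale tf_diff segment_mean_translate field_simps)
    ultimately show ?thesis
      by (metis tf_diff(1) tf_neg(1))
  qed
  then show ?thesis
    by (simp add: mean_diff_def inner_diff_left inner_segment_mean_left flip: inner_diff_right inner_minus_right)
qed

lemma inner_mean_diff_le: "inner (mean_diff b f) g \<le> norm f * norm (mean_diff b g)"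
  using norm_cauchy_schwarz[of f "- translate (- (2 *\<^sub>R b)) (mean_diff b g)"] by (simp add: inner_mean_diff)

text \<open>The adjoint of \<^term>\<open>mean_diff b\<close> is \<^term>\<open>mean_diff b\<close> itself up to a sign and a translation, so the outer factor
  is controlled by testing against the sum and the inner one by assumption.\<close>
lemma norm_sum_mean_diff:
  assumes "\<And>n. n < N \<Longrightarrow> norm (Y n) \<le> C * norm (mean_diff (2^n *\<^sub>R c) f)" "0 \<le> C"
  shows "norm (\<Sum>n<N. mean_diff (2^n *\<^sub>R b) (Y n)) \<le> C * norm f"
proof (rule norm_le_inner)
  let ?w = "\<Sum>n<N. mean_diff (2^n *\<^sub>R b) (Y n)"
  let ?F = "\<lambda>n. norm (mean_diff (2^n *\<^sub>R c) f)" and ?W = "\<lambda>n. norm (mean_diff (2^n *\<^sub>R b) ?w)"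
  have "inner ?w ?w = (\<Sum>n<N. inner (mean_diff (2^n *\<^sub>R b) (Y n)) ?w)"
    by (rule inner_sum_left)
  also have "\<dots> \<le> (\<Sum>n<N. C * (\<bar>?F n\<bar> * \<bar>?W n\<bar>))"
  proof (rule sum_mono)
    fix n assume n: "n \<in> {..<N}"
    have "inner (mean_diff (2^n *\<^sub>R b) (Y n)) ?w \<le> norm (Y n) * ?W n"
      by (rule inner_mean_diff_le)
    also have "\<dots> \<le> (C * ?F n) * ?W n"
      using n assms by (intro mult_right_mono) auto
    finally show "inner (mean_diff (2^n *\<^sub>R b) (Y n)) ?w \<le> C * (\<bar>?F n\<bar> * \<bar>?W n\<bar>)"
      by simp
  qed
  also have "\<dots> \<le> C * (L2_set ?F {..<N} * L2_set ?W {..<N})"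
    unfolding sum_distrib_left[symmetric] by (rule mult_left_mono[OF L2_set_mult_ineq assms(2)])
  also have "\<dots> \<le> C * (norm f * norm ?w)"
    by (intro mult_left_mono mult_mono assms(2))
      (auto simp: L2_set_def intro!: real_le_lsqrt sum_norm_mean_diff sum_nonneg)
  finally show "inner ?w ?w \<le> C * norm f * norm ?w"
    by simp
qed (use assms in auto)

subsection \<open>Convolution operators and scaled families\<close>

text \<open>Convolution operators are described by the commutation relations that are used; their
  kernels, in general only measures, stay unnamed.\<close>

definition conv_op :: "('n::finite tf \<Rightarrow> 'n tf) \<Rightarrow> bool" where
  "conv_op Y \<longleftrightarrow> linear Y \<and> (\<forall>i f. Y (partial_tf i f) = partial_tf i (Y f)) \<and>
     (\<forall>b f. Y (translate b f) = translate b (Y f)) \<and> (\<forall>b f. Y (segment_mean b f) = segment_mean b (Y f))"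

lemma conv_op_id: "conv_op (\<lambda>f. f)" and conv_op_translate: "conv_op (translate b)" and conv_op_segment_mean: "conv_op (segment_mean b)"
  unfolding conv_op_def by (auto simp: tf_linear partial_tf_translate partial_tf_segment_mean segment_mean_translate segment_mean_segment_mean translate_translate add.commute linear_ident)

lemma conv_op_comp: "conv_op Y \<Longrightarrow> conv_op Y' \<Longrightarrow> conv_op (\<lambda>f. Y (Y' f))"
  unfolding conv_op_def using linear_compose[of Y' Y] by (auto simp: o_def)

lemma conv_op_add: "conv_op Y \<Longrightarrow> conv_op Y' \<Longrightarrow> conv_op (\<lambda>f. Y f + Y' f)"
  unfolding conv_op_def by (auto simp: tf_add linear_compose_add)

lemma conv_op_scale: "conv_op Y \<Longrightarrow> conv_op (\<lambda>f. r *\<^sub>R Y f)"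
  unfolding conv_op_def by (auto simp: tf_scale linear_compose_scale_right)

lemma conv_op_linear: "conv_op Y \<Longrightarrow> linear Y"
  by (simp add: conv_op_def)

lemma conv_op_partial_tf: "conv_op Y \<Longrightarrow> Y (partial_tf i f) = partial_tf i (Y f)"
  and conv_op_segment_mean_commute: "conv_op Y \<Longrightarrow> Y (segment_mean b f) = segment_mean b (Y f)"
  by (simp_all add: conv_op_def)

lemma conv_op_dir_deriv: "conv_op Y \<Longrightarrow> Y (dir_deriv b f) = dir_deriv b (Y f)"
  by (simp add: dir_deriv_def linear_sum[OF conv_op_linear] linear_scale[OF conv_op_linear] conv_op_partial_tf)

lemma conv_op_mean_diff_commute: "conv_op Y \<Longrightarrow> Y (mean_diff b f) = mean_diff b (Y f)"
  by (simp add: mean_diff_def linear_diff[OF conv_op_linear] conv_op_segment_mean_commute)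

section \<open>Operators that move supports along a cone\<close>

definition box_cone :: "('n::finite \<Rightarrow> real^'n) \<Rightarrow> real \<Rightarrow> (real^'n) set" where
  "box_cone a \<tau> = {\<Sum>k\<in>UNIV. t k *\<^sub>R a k |t. \<forall>k. 0 \<le> t k \<and> t k \<le> \<tau>}"

text \<open>Stands for a kernel supported in \<open>K\<close>. Points of nonvanishing are easily
  followed through compositions and sums; closed supports are taken only when the domain
  enters.\<close>

definition spread :: "(real^'n::finite) set \<Rightarrow> ('n tf \<Rightarrow> 'n tf) \<Rightarrow> bool" where
  "spread K Y \<longleftrightarrow> (\<forall>f x. fn (Y f) x \<noteq> 0 \<longrightarrow> (\<exists>y. fn f y \<noteq> 0 \<and> x - y \<in> K))"

lemma box_cone_mono: "\<tau> \<le> \<tau>' \<Longrightarrow> box_cone a \<tau> \<subseteq> box_cone a \<tau>'"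
  unfolding box_cone_def by (intro subsetI, elim CollectE exE conjE, intro CollectI exI conjI)
    (assumption, meson order_trans)

lemma box_cone_add:
  assumes "x \<in> box_cone a \<tau>" "y \<in> box_cone a \<tau>'"
  shows "x + y \<in> box_cone a (\<tau> + \<tau>')"
proof -
  obtain t t' where t: "x = (\<Sum>k\<in>UNIV. t k *\<^sub>R a k)" "\<And>k. 0 \<le> t k \<and> t k \<le> \<tau>"
    and t': "y = (\<Sum>k\<in>UNIV. t' k *\<^sub>R a k)" "\<And>k. 0 \<le> t' k \<and> t' k \<le> \<tau>'"
    using assms unfolding box_cone_def by blast
  have "x + y = (\<Sum>k\<in>UNIV. (t k + t' k) *\<^sub>R a k)"
    by (simp add: t t' scaleR_add_left sum.distrib)
  moreover have "\<forall>k. 0 \<le> t k + t' k \<and> t k + t' k \<le> \<tau> + \<tau>'"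
    using t(2) t'(2) by (simp add: add_mono)
  ultimately show ?thesis
    unfolding box_cone_def by (intro CollectI exI[of _ "\<lambda>k. t k + t' k"]) simp
qed

lemma box_cone_0: "0 \<le> \<tau> \<Longrightarrow> 0 \<in> box_cone a \<tau>"
  unfolding box_cone_def by (auto intro!: exI[of _ "\<lambda>k. 0"])

lemma box_cone_single:
  assumes "0 \<le> t" "t \<le> \<tau>"
  shows "t *\<^sub>R a k \<in> box_cone a \<tau>"
proof -
  have "(\<Sum>j\<in>UNIV. (if j = k then t else 0) *\<^sub>R a j) = t *\<^sub>R a k"
    by (simp add: if_distrib[of "\<lambda>c. c *\<^sub>R _"] cong: if_cong)
  then show ?thesis
    unfolding box_cone_def using assms by (intro CollectI exI[of _ "\<lambda>j. if j = k then t else 0"]) auto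
qed

text \<open>\<open>\<tau>\<close> bounds the reach along each basis vector and \<open>c\<close> the
  L^2 operator norm. Under composition the first parameter adds and the second multiplies.\<close>

definition adm_op :: "('n::finite \<Rightarrow> real^'n) \<Rightarrow> real \<Rightarrow> real \<Rightarrow> ('n tf \<Rightarrow> 'n tf) \<Rightarrow> bool" where
  "adm_op a \<tau> c Y \<longleftrightarrow> 0 \<le> \<tau> \<and> 0 \<le> c \<and> conv_op Y \<and> (\<forall>f. norm (Y f) \<le> c * norm f) \<and> spread (box_cone a \<tau>) Y"

lemma adm_op_mono: "adm_op a \<tau> c Y \<Longrightarrow> \<tau> \<le> \<tau>' \<Longrightarrow> c \<le> c' \<Longrightarrow> adm_op a \<tau>' c' Y"
  unfolding adm_op_def spread_def
  by (meson box_cone_mono mult_right_mono norm_ge_zero order_trans subsetD)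

lemma adm_op_comp:
  assumes "adm_op a \<tau> c Y" "adm_op a \<tau>' c' Y'"
  shows "adm_op a (\<tau> + \<tau>') (c * c') (\<lambda>f. Y (Y' f))"
  unfolding adm_op_def
proof (intro conjI allI)
  show "norm (Y (Y' f)) \<le> c * c' * norm f" for f
  proof -
    have "norm (Y (Y' f)) \<le> c * norm (Y' f)"
      using assms by (simp add: adm_op_def)
    also have "\<dots> \<le> c * (c' * norm f)"
      using assms by (intro mult_left_mono) (auto simp: adm_op_def)
    finally show ?thesis
      by simp
  qed
  show "spread (box_cone a (\<tau> + \<tau>')) (\<lambda>f. Y (Y' f))"
    unfolding spread_def
  proof (intro allI impI)
    fix f x assume "fn (Y (Y' f)) x \<noteq> 0"
    then obtain y where y: "fn (Y' f) y \<noteq> 0" "x - y \<in> box_cone a \<tau>"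
      using assms unfolding adm_op_def spread_def by blast
    then obtain z where z: "fn f z \<noteq> 0" "y - z \<in> box_cone a \<tau>'"
      using assms unfolding adm_op_def spread_def by blast
    from box_cone_add[OF y(2) z(2)] z show "\<exists>y. fn f y \<noteq> 0 \<and> x - y \<in> box_cone a (\<tau> + \<tau>')"
      by (metis diff_add_cancel add_diff_eq)
  qed
qed (use assms in \<open>auto simp: adm_op_def intro: conv_op_comp\<close>)

lemma adm_op_add:
  assumes "adm_op a \<tau> c Y" "adm_op a \<tau> c' Y'"
  shows "adm_op a \<tau> (c + c') (\<lambda>f. Y f + Y' f)"
  unfolding adm_op_def
proof (intro conjI allI)
  show "norm (Y f + Y' f) \<le> (c + c') * norm f" for f
    using assms norm_triangle_mono[of "Y f" "c * norm f" "Y' f" "c' * norm f"]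
    by (simp add: adm_op_def ring_distribs)
  show "spread (box_cone a \<tau>) (\<lambda>f. Y f + Y' f)"
    using assms unfolding adm_op_def spread_def by (metis (no_types, lifting) add_0 fn_add)
qed (use assms in \<open>auto simp: adm_op_def intro: conv_op_add\<close>)

lemma adm_op_scale:
  assumes "adm_op a \<tau> c Y"
  shows "adm_op a \<tau> (\<bar>r\<bar> * c) (\<lambda>f. r *\<^sub>R Y f)"
  unfolding adm_op_def
proof (intro conjI allI)
  show "norm (r *\<^sub>R Y f) \<le> \<bar>r\<bar> * c * norm f" for f
    using assms by (auto simp: adm_op_def mult.assoc intro!: mult_left_mono)
  show "spread (box_cone a \<tau>) (\<lambda>f. r *\<^sub>R Y f)"
    using assms by (auto simp: adm_op_def spread_def)
qed (use assms in \<open>auto simp: adm_op_def intro: conv_op_scale\<close>)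

lemma adm_op_id: "0 \<le> \<tau> \<Longrightarrow> adm_op a \<tau> 1 (\<lambda>f. f)"
  by (simp add: adm_op_def conv_op_id spread_def) (metis box_cone_0 diff_self)

lemma adm_op_sum:
  assumes "finite I" "\<And>i. i \<in> I \<Longrightarrow> adm_op a \<tau> (c i) (Y i)" "0 \<le> \<tau>"
  shows "adm_op a \<tau> (\<Sum>i\<in>I. c i) (\<lambda>f. \<Sum>i\<in>I. Y i f)"
  using assms(1,2)
proof (induction I)
  case empty
  then show ?case
    using adm_op_scale[OF adm_op_id[OF assms(3)], where r = 0] by simp
next
  case (insert i I)
  then show ?case
    by (simp add: adm_op_add)
qed

lemma adm_op_translate: "0 \<le> s \<Longrightarrow> adm_op a s 1 (translate (s *\<^sub>R a k))"
  unfolding adm_op_def spread_def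
  by (auto simp: conv_op_translate fn_translate intro!: exI[of _ "_ - s *\<^sub>R a k"] box_cone_single)

lemma adm_op_segment_mean: 
  assumes "0 \<le> s"
  shows "adm_op a s 1 (segment_mean (s *\<^sub>R a k))"
  unfolding adm_op_def
proof (intro conjI allI)
  show "spread (box_cone a s) (segment_mean (s *\<^sub>R a k))"
    unfolding spread_def
  proof (intro allI impI)
    fix f x assume "fn (segment_mean (s *\<^sub>R a k) f) x \<noteq> 0"
    then obtain t y where t: "0 \<le> t" "t \<le> 1" "fn f y \<noteq> 0" "x = y + t *\<^sub>R (s *\<^sub>R a k)"
      unfolding fn_segment_mean using mean_nonzero by blast
    then have "x - y \<in> box_cone a s"
      using assms by (auto intro!: box_cone_single mult_left_le_one_le)
    with t show "\<exists>y. fn f y \<noteq> 0 \<and> x - y \<in> box_cone a s"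
      by blast
  qed
qed (use assms in \<open>auto simp: conv_op_segment_mean norm_segment_mean\<close>)

text \<open>Families of operators whose translation lengths are proportional to the scale \<open>s\<close>, with norms
  bounded uniformly in \<open>s\<close>.\<close>
definition scaled_family :: "('n::finite \<Rightarrow> real^'n) \<Rightarrow> (real \<Rightarrow> 'n tf \<Rightarrow> 'n tf) \<Rightarrow> bool" where
  "scaled_family a Y \<longleftrightarrow> (\<exists>C. \<forall>s\<ge>0. adm_op a (C * s) C (Y s))"

lemma scaled_family_conv_op: "scaled_family a Y \<Longrightarrow> 0 \<le> s \<Longrightarrow> conv_op (Y s)"
  by (auto simp: scaled_family_def adm_op_def)

lemma scaled_familyD: "scaled_family a Y \<Longrightarrow> \<exists>C\<ge>0. \<forall>s\<ge>0. adm_op a (C * s) C (Y s)"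
  unfolding scaled_family_def by (metis adm_op_def order_refl)

lemma scaled_familyI: "(\<And>s. 0 \<le> s \<Longrightarrow> adm_op a (C * s) C' (Y s)) \<Longrightarrow> scaled_family a Y"
  unfolding scaled_family_def
  by (rule exI[of _ "max C C'"]) (meson adm_op_mono max.cobounded1 max.cobounded2 mult_right_mono)

lemma scaled_family_id: "scaled_family a (\<lambda>s f. f)"
  by (rule scaled_familyI[of a 0 1]) (auto intro: adm_op_id)

lemma scaled_family_comp:
  assumes "scaled_family a Y" "scaled_family a Y'"
  shows "scaled_family a (\<lambda>s f. Y s (Y' s f))"
proof -
  obtain C where C: "0 \<le> C" "\<forall>s\<ge>0. adm_op a (C * s) C (Y s)"
    using scaled_familyD[OF assms(1)] by blast
  obtain C' where C': "0 \<le> C'" "\<forall>s\<ge>0. adm_op a (C' * s) C' (Y' s)"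
    using scaled_familyD[OF assms(2)] by blast
  have "adm_op a ((C + C') * s) (C * C') (\<lambda>f. Y s (Y' s f))" if "0 \<le> s" for s
    using adm_op_comp[OF C(2)[rule_format, OF that] C'(2)[rule_format, OF that]] by (simp add: ring_distribs)
  then show ?thesis
    by (rule scaled_familyI)
qed

lemma scaled_family_add: 
  assumes "scaled_family a Y" "scaled_family a Y'"
  shows "scaled_family a (\<lambda>s f. Y s f + Y' s f)"
proof -
  obtain C where C: "0 \<le> C" "\<forall>s\<ge>0. adm_op a (C * s) C (Y s)"
    using scaled_familyD[OF assms(1)] by blast
  obtain C' where C': "0 \<le> C'" "\<forall>s\<ge>0. adm_op a (C' * s) C' (Y' s)"
    using scaled_familyD[OF assms(2)] by blast
  have "adm_op a ((C + C') * s) (C + C') (\<lambda>f. Y s f + Y' s f)" if "0 \<le> s" for s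
  proof (rule adm_op_add)
    show "adm_op a ((C + C') * s) C (Y s)" "adm_op a ((C + C') * s) C' (Y' s)"
      using adm_op_mono[OF C(2)[rule_format, OF that], of "(C + C') * s" C] adm_op_mono[OF C'(2)[rule_format, OF that], of "(C + C') * s" C']
        C C' that by (simp_all add: mult_right_mono)
  qed
  then show ?thesis
    by (rule scaled_familyI)
qed

lemma scaled_family_scale:
  assumes "scaled_family a Y"
  shows "scaled_family a (\<lambda>s f. r *\<^sub>R Y s f)"
proof -
  obtain C where C: "0 \<le> C" "\<forall>s\<ge>0. adm_op a (C * s) C (Y s)"
    using scaled_familyD[OF assms] by blast
  show ?thesis
    by (rule scaled_familyI[OF adm_op_scale[OF C(2)[rule_format]]])
qed

lemma scaled_family_diff: "scaled_family a Y \<Longrightarrow> scaled_family a Y' \<Longrightarrow> scaled_family a (\<lambda>s f. Y s f - Y' s f)"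
  using scaled_family_add[OF _ scaled_family_scale[of a Y' "-1"]] by simp

lemma scaled_family_rescale:
  assumes "scaled_family a Y" "0 \<le> c"
  shows "scaled_family a (\<lambda>s. Y (c * s))"
proof -
  obtain C where C: "0 \<le> C" "\<forall>s\<ge>0. adm_op a (C * s) C (Y s)"
    using scaled_familyD[OF assms(1)] by blast
  show ?thesis
    using C(2) assms(2) by (intro scaled_familyI[of a "C * c" C]) (simp add: mult.assoc)
qed

lemma scaled_family_translate: "scaled_family a (\<lambda>s. translate (s *\<^sub>R a k))" and scaled_family_segment_mean: "scaled_family a (\<lambda>s. segment_mean (s *\<^sub>R a k))"
  by (rule scaled_familyI[of a 1 1]; simp add: adm_op_translate adm_op_segment_mean)+

lemma scaled_family_half_sum: "scaled_family a (\<lambda>s. half_sum (s *\<^sub>R a k))"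
  unfolding half_sum_def by (intro scaled_family_scale scaled_family_add scaled_family_id scaled_family_translate)

subsection \<open>The telescoping homotopy\<close>

text \<open>The combination \<open>2 M\<^sub>b\<^sup>2 - M\<^bsub>2b\<^esub>\<^sup>2\<close> has vanishing first moment; this is what makes its change from
  \<open>b\<close> to \<open>2b\<close> divisible by the square of \<^term>\<open>mean_diff b\<close>.\<close>
definition mollifier :: "real^'n::finite \<Rightarrow> 'n tf \<Rightarrow> 'n tf" where
  "mollifier b f = 2 *\<^sub>R segment_mean b (segment_mean b f) - segment_mean (2 *\<^sub>R b) (segment_mean (2 *\<^sub>R b) f)"

text \<open>Write s for \<open>half_sum b\<close> and M for \<open>segment_mean b\<close>. Then
  \<open>segment_mean (2 *\<^sub>R b)\<close> is M s, \<open>mean_diff b\<close> is M (1 - s), and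
  \<open>half_sum (2 *\<^sub>R b)\<close> is 1 - 2 s + 2 s^2. The change of the mollifier from b to
  2b becomes M^2 (2 - 2 s^2 - 4 s^3 + 8 s^4 - 8 s^5 + 4 s^6), and division by M^2 (1 - s)^2 leaves 2
  + 4 s + 4 s^2 + 4 s^4.\<close>

definition cofactor :: "real^'n::finite \<Rightarrow> 'n tf \<Rightarrow> 'n tf" where
  "cofactor b f = 2 *\<^sub>R f + 4 *\<^sub>R half_sum b f + 4 *\<^sub>R half_sum b (half_sum b f) + 4 *\<^sub>R half_sum b (half_sum b (half_sum b (half_sum b f)))"

lemma segment_mean_half_sum: "segment_mean a (half_sum b f) = half_sum b (segment_mean a f)"
  by (simp add: half_sum_def tf_add tf_scale segment_mean_translate)

lemma mollifier_eq: "mollifier b f = segment_mean b (segment_mean b (2 *\<^sub>R f - half_sum b (half_sum b f)))"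
  by (simp add: mollifier_def segment_mean_double_half_sum segment_mean_half_sum tf_diff tf_scale)

lemma mollifier_diff: "mollifier b f - mollifier (2 *\<^sub>R b) f = mean_diff b (mean_diff b (cofactor b f))"
proof -
  let ?s = "half_sum b" and ?t = "translate b"
  have tr2: "translate (2 *\<^sub>R b) f = ?t (?t f)" for f
    by (simp add: translate_translate scaleR_2)
  have "mollifier (2 *\<^sub>R b) f = segment_mean b (segment_mean b (?s (?s (2 *\<^sub>R f - half_sum (2 *\<^sub>R b) (half_sum (2 *\<^sub>R b) f)))))"
    unfolding mollifier_eq[of "2 *\<^sub>R b"] segment_mean_double_half_sum segment_mean_half_sum ..
  moreover have "mean_diff b (mean_diff b (cofactor b f)) = segment_mean b (segment_mean b ((1/4) *\<^sub>R (cofactor b f - ?t (cofactor b f) - ?t (cofactor b f - ?t (cofactor b f)))))"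
    by (rule tf_eqI) (simp add: mean_diff_eq tf_scale tf_diff segment_mean_translate fn_translate diff_divide_distrib)
  \<comment> \<open>With the two means factored out, both sides are the same polynomial in
    \<open>translate b\<close> applied to \<open>f\<close>, which is checked pointwise.\<close>
  moreover have "2 *\<^sub>R f - ?s (?s f) - ?s (?s (2 *\<^sub>R f - half_sum (2 *\<^sub>R b) (half_sum (2 *\<^sub>R b) f)))
      = (1/4) *\<^sub>R (cofactor b f - ?t (cofactor b f) - ?t (cofactor b f - ?t (cofactor b f)))"
    by (rule tf_eqI) (simp add: cofactor_def half_sum_def tr2 fn_translate add_divide_distrib diff_divide_distrib)
  ultimately show ?thesis
    by (metis mollifier_eq tf_diff(2))
qed

text \<open>With s for \<open>half_sum b\<close> and M for \<open>segment_mean b\<close>, the left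
  side is M s (2 s - 2 s^2) = 2 s^2 M (1 - s). This brings a difference at the doubled scale back to
  the scale b, so that one index of the dyadic sum involves one scale only.\<close>

lemma mean_diff_double: "mean_diff (2 *\<^sub>R b) f = 2 *\<^sub>R mean_diff b (half_sum b (half_sum b f))"
proof -
  have "mean_diff (2 *\<^sub>R b) f = segment_mean b (half_sum b ((1/2) *\<^sub>R (f - translate b (translate b f))))"
    unfolding mean_diff_eq[of "2 *\<^sub>R b"] segment_mean_double_half_sum[symmetric] by (simp add: translate_translate scaleR_2 tf_scale)
  moreover have "2 *\<^sub>R mean_diff b (half_sum b (half_sum b f)) = segment_mean b (half_sum b (half_sum b f) - translate b (half_sum b (half_sum b f)))"
    by (simp add: mean_diff_eq)
  moreover have "half_sum b ((1/2) *\<^sub>R (f - translate b (translate b f))) = half_sum b (half_sum b f) - translate b (half_sum b (half_sum b f))"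
    by (rule tf_eqI) (simp add: half_sum_def fn_translate field_simps)
  ultimately show ?thesis
    by simp
qed

lemma conv_op_diff: "conv_op Y \<Longrightarrow> conv_op Y' \<Longrightarrow> conv_op (\<lambda>f. Y f - Y' f)"
  using conv_op_add[OF _ conv_op_scale[of Y' "-1"]] by simp

lemma conv_op_mean_diff: "conv_op (mean_diff b)" and conv_op_half_sum: "conv_op (half_sum b)" and conv_op_mollifier: "conv_op (mollifier b)"
proof -
  show "conv_op (mean_diff b)"
    unfolding mean_diff_def by (intro conv_op_diff conv_op_segment_mean)
  show "conv_op (half_sum b)"
    unfolding half_sum_def by (intro conv_op_scale conv_op_add conv_op_id conv_op_translate)
  show "conv_op (mollifier b)"
    unfolding mollifier_def by (intro conv_op_diff conv_op_scale conv_op_comp[OF conv_op_segment_mean conv_op_segment_mean])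
qed

lemma scaled_family_mean_diff: "scaled_family a (\<lambda>s. mean_diff (s *\<^sub>R a k))" and scaled_family_mollifier: "scaled_family a (\<lambda>s. mollifier (s *\<^sub>R a k))"
  and scaled_family_cofactor: "scaled_family a (\<lambda>s. cofactor (s *\<^sub>R a k))"
proof -
  have 2: "scaled_family a (\<lambda>s. segment_mean (2 *\<^sub>R s *\<^sub>R a k))"
    using scaled_family_rescale[OF scaled_family_segment_mean, of 2 a k] by simp
  show "scaled_family a (\<lambda>s. mean_diff (s *\<^sub>R a k))"
    unfolding mean_diff_def by (intro scaled_family_diff scaled_family_segment_mean 2)
  show "scaled_family a (\<lambda>s. mollifier (s *\<^sub>R a k))"
    unfolding mollifier_def by (intro scaled_family_diff scaled_family_scale scaled_family_comp[OF scaled_family_segment_mean scaled_family_segment_mean] scaled_family_comp[OF 2 2])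
  show "scaled_family a (\<lambda>s. cofactor (s *\<^sub>R a k))"
    unfolding cofactor_def by (intro scaled_family_add scaled_family_scale scaled_family_id scaled_family_half_sum scaled_family_comp[OF scaled_family_half_sum scaled_family_comp[OF scaled_family_half_sum scaled_family_comp[OF scaled_family_half_sum scaled_family_half_sum]]]
        scaled_family_comp[OF scaled_family_half_sum scaled_family_half_sum])
qed

lemma dir_deriv_mollifier: "dir_deriv b (mollifier b f) = mean_diff b (2 *\<^sub>R (2 *\<^sub>R f - half_sum b (half_sum b f)))"
  by (simp add: mollifier_eq dir_deriv_segment_mean_segment_mean linear_scale[OF conv_op_linear[OF conv_op_mean_diff]])

lemma dir_deriv_mollifier_double: "dir_deriv b (mollifier (2 *\<^sub>R b) f) = mean_diff b (half_sum b (half_sum b (2 *\<^sub>R (2 *\<^sub>R f - half_sum (2 *\<^sub>R b) (half_sum (2 *\<^sub>R b) f)))))"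
proof -
  have "dir_deriv b (mollifier (2 *\<^sub>R b) f) = (1/2) *\<^sub>R dir_deriv (2 *\<^sub>R b) (mollifier (2 *\<^sub>R b) f)"
    by (simp add: dir_deriv_scale)
  then show ?thesis
    by (simp add: dir_deriv_mollifier mean_diff_double)
qed

text \<open>One mollifier for each direction, so that a derivative along any listed direction meets
  a factor turning it into a difference. The list form lets the scale be changed in one factor at a
  time.\<close>

primrec mollifier_prod :: "('n::finite \<Rightarrow> real^'n) \<Rightarrow> 'n list \<Rightarrow> real \<Rightarrow> 'n tf \<Rightarrow> 'n tf" where
  "mollifier_prod a [] s f = f"
| "mollifier_prod a (k # ks) s f = mollifier (s *\<^sub>R a k) (mollifier_prod a ks s f)"

lemma mollifier_prod_Nil: "mollifier_prod a [] = (\<lambda>s f. f)"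
  and mollifier_prod_Cons: "mollifier_prod a (k # ks) = (\<lambda>s f. mollifier (s *\<^sub>R a k) (mollifier_prod a ks s f))"
  by (simp_all add: fun_eq_iff)

lemma scaled_family_mollifier_prod: "scaled_family a (mollifier_prod a ks)"
  by (induction ks) (unfold mollifier_prod_Nil mollifier_prod_Cons, auto intro: scaled_family_id scaled_family_comp[OF scaled_family_mollifier])

lemma conv_op_mollifier_prod: "conv_op (mollifier_prod a ks s)"
  by (induction ks) (unfold mollifier_prod_Nil mollifier_prod_Cons, auto intro: conv_op_id conv_op_comp[OF conv_op_mollifier])

text \<open>The factor of direction \<open>l\<close> converts the derivative by
  \<open>dir_deriv_mollifier\<close>; the factors in front of it commute with both the derivative
  and the difference.\<close>

lemma dir_deriv_mollifier_prod:
  assumes "l \<in> set ks"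
  shows "\<exists>Y. scaled_family a Y \<and> (\<forall>s f. dir_deriv (s *\<^sub>R a l) (mollifier_prod a ks s f) = mean_diff (s *\<^sub>R a l) (Y s f))"
  using assms
proof (induction ks)
  case (Cons k ks)
  show ?case
  proof (cases "l = k")
    case True
    let ?Y = "\<lambda>s f. 2 *\<^sub>R (2 *\<^sub>R mollifier_prod a ks s f - half_sum (s *\<^sub>R a k) (half_sum (s *\<^sub>R a k) (mollifier_prod a ks s f)))"
    have "scaled_family a ?Y"
      by (intro scaled_family_scale scaled_family_diff scaled_family_mollifier_prod scaled_family_comp[OF scaled_family_half_sum scaled_family_comp[OF scaled_family_half_sum scaled_family_mollifier_prod]])
    then show ?thesis
      using True by (intro exI[of _ ?Y]) (simp add: dir_deriv_mollifier)
  next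
    case False
    then obtain Y where Y: "scaled_family a Y" "\<And>s f. dir_deriv (s *\<^sub>R a l) (mollifier_prod a ks s f) = mean_diff (s *\<^sub>R a l) (Y s f)"
      using Cons by auto
    have "dir_deriv (s *\<^sub>R a l) (mollifier_prod a (k # ks) s f) = mean_diff (s *\<^sub>R a l) (mollifier (s *\<^sub>R a k) (Y s f))" for s f
      by (simp add: conv_op_dir_deriv[OF conv_op_mollifier, symmetric] Y(2) conv_op_mean_diff_commute[OF conv_op_mollifier])
    with scaled_family_comp[OF scaled_family_mollifier Y(1)] show ?thesis
      by blast
  qed
qed simp

text \<open>Product rule for differences: one factor changes its scale while those earlier in the
  list are already doubled. Each change is a derivative along its own direction of an operator that
  still contains a \<open>mean_diff\<close>, and a further derivative creates a second one. The form
  with one difference outermost and one next to \<open>f\<close> is what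
  \<open>norm_sum_mean_diff\<close> requires.\<close>

lemma mollifier_prod_diff:
  assumes "distinct ks"
  shows "\<exists>A. (\<forall>s f. mollifier_prod a ks s f - mollifier_prod a ks (2 * s) f = (\<Sum>k\<in>set ks. dir_deriv (s *\<^sub>R a k) (A k s f))) \<and>
    (\<forall>k\<in>set ks. \<exists>Y. scaled_family a Y \<and> (\<forall>s\<ge>0. \<forall>f. A k s f = Y s (mean_diff (s *\<^sub>R a k) f))) \<and>
    (\<forall>k\<in>set ks. \<forall>l\<in>set ks. \<exists>Y. scaled_family a Y \<and>
       (\<forall>s\<ge>0. \<forall>f. dir_deriv (s *\<^sub>R a l) (A k s f) = mean_diff (s *\<^sub>R a l) (Y s (mean_diff (s *\<^sub>R a k) f))))"
  using assms
proof (induction ks)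
  case (Cons k ks)
  obtain A where
    A: "\<And>s f. mollifier_prod a ks s f - mollifier_prod a ks (2 * s) f = (\<Sum>j\<in>set ks. dir_deriv (s *\<^sub>R a j) (A j s f))"
    and AY: "\<And>j. j \<in> set ks \<Longrightarrow> \<exists>Y. scaled_family a Y \<and> (\<forall>s\<ge>0. \<forall>f. A j s f = Y s (mean_diff (s *\<^sub>R a j) f))"
    and ddA: "\<And>j l. j \<in> set ks \<Longrightarrow> l \<in> set ks \<Longrightarrow> \<exists>Y. scaled_family a Y \<and>
       (\<forall>s\<ge>0. \<forall>f. dir_deriv (s *\<^sub>R a l) (A j s f) = mean_diff (s *\<^sub>R a l) (Y s (mean_diff (s *\<^sub>R a j) f)))"
    using Cons by auto
  have k: "k \<notin> set ks"
    using Cons.prems by simp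
  \<comment> \<open>The derivative of \<open>Q\<close> along \<open>s *\<^sub>R a k\<close> is a
    \<open>mean_diff\<close> of the cofactor, so \<open>Q\<close> integrates one of the two
    differences in \<open>mollifier_diff\<close>. The factor 1/2 cancels the 2 in
    \<open>dir_deriv_segment_mean_segment_mean\<close>.\<close>
  define Q where "Q s f = (1/2) *\<^sub>R segment_mean (s *\<^sub>R a k) (segment_mean (s *\<^sub>R a k) (cofactor (s *\<^sub>R a k) f))" for s f
  define A' where "A' j s f = (if j = k then Q s (mean_diff (s *\<^sub>R a k) (mollifier_prod a ks s f))
    else mollifier (2 *\<^sub>R s *\<^sub>R a k) (A j s f))" for j s f
  have famQ: "scaled_family a Q"
    unfolding Q_def by (intro scaled_family_scale scaled_family_comp[OF scaled_family_segment_mean scaled_family_comp[OF scaled_family_segment_mean scaled_family_cofactor]])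
  have fam2: "scaled_family a (\<lambda>s. mollifier (2 *\<^sub>R s *\<^sub>R a k))"
    using scaled_family_rescale[OF scaled_family_mollifier, of 2 a k] by simp
  have conv_op_cofactor: "conv_op (cofactor b)" for b
    unfolding cofactor_def by (intro conv_op_add conv_op_scale conv_op_id conv_op_half_sum conv_op_comp[OF conv_op_half_sum] )
  have ddQ: "dir_deriv (s *\<^sub>R a k) (Q s f) = mean_diff (s *\<^sub>R a k) (cofactor (s *\<^sub>R a k) f)" for s f
    by (simp add: Q_def tf_scale dir_deriv_segment_mean_segment_mean)
  have Ah: "A' k s f = Q s (mollifier_prod a ks s (mean_diff (s *\<^sub>R a k) f))" for s f
    by (simp add: A'_def conv_op_mean_diff_commute[OF conv_op_mollifier_prod])
  have sum: "mollifier_prod a (k # ks) s f - mollifier_prod a (k # ks) (2 * s) f = (\<Sum>j\<in>set (k # ks). dir_deriv (s *\<^sub>R a j) (A' j s f))" for s f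
  proof -
    let ?E = "mollifier (s *\<^sub>R a k)" and ?E' = "mollifier (2 *\<^sub>R s *\<^sub>R a k)" and ?h = "mollifier_prod a ks s f" and ?h' = "mollifier_prod a ks (2 * s) f"
    have "?E ?h - ?E' ?h' = (?E ?h - ?E' ?h) + ?E' (?h - ?h')"
      by (simp add: linear_diff[OF conv_op_linear[OF conv_op_mollifier]])
    also have "?E ?h - ?E' ?h = dir_deriv (s *\<^sub>R a k) (A' k s f)"
      using mollifier_diff[of "s *\<^sub>R a k" ?h] by (simp add: A'_def ddQ conv_op_mean_diff_commute[OF conv_op_cofactor])
    also have "?E' (?h - ?h') = (\<Sum>j\<in>set ks. dir_deriv (s *\<^sub>R a j) (?E' (A j s f)))"
      by (simp add: A linear_sum[OF conv_op_linear[OF conv_op_mollifier]] conv_op_dir_deriv[OF conv_op_mollifier])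
    also have "\<dots> = (\<Sum>j\<in>set ks. dir_deriv (s *\<^sub>R a j) (A' j s f))"
      using k by (intro sum.cong) (auto simp: A'_def)
    finally show ?thesis
      using k by simp
  qed
  have AY': "\<exists>Y. scaled_family a Y \<and> (\<forall>s\<ge>0. \<forall>f. A' j s f = Y s (mean_diff (s *\<^sub>R a j) f))" if "j \<in> set (k # ks)" for j
  proof (cases "j = k")
    case True
    with Ah scaled_family_comp[OF famQ scaled_family_mollifier_prod] show ?thesis
      by blast
  next
    case False
    with that obtain Y where "scaled_family a Y" "\<forall>s\<ge>0. \<forall>f. A j s f = Y s (mean_diff (s *\<^sub>R a j) f)"
      using AY[of j] by auto
    with scaled_family_comp[OF fam2 this(1)] False show ?thesis
      by (auto simp: A'_def)
  qed
  have ddA': "\<exists>Y. scaled_family a Y \<and> (\<forall>s\<ge>0. \<forall>f. dir_deriv (s *\<^sub>R a l) (A' j s f) = mean_diff (s *\<^sub>R a l) (Y s (mean_diff (s *\<^sub>R a j) f)))"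
    if j: "j \<in> set (k # ks)" and l: "l \<in> set (k # ks)" for j l
  proof (cases "j = k"; cases "l = k")
    assume jl: "j = k" "l = k"
    have "dir_deriv (s *\<^sub>R a l) (A' j s f) = mean_diff (s *\<^sub>R a l) (cofactor (s *\<^sub>R a k) (mollifier_prod a ks s (mean_diff (s *\<^sub>R a j) f)))" for s f
      by (simp add: jl Ah ddQ)
    with scaled_family_comp[OF scaled_family_cofactor scaled_family_mollifier_prod] show ?thesis
      by blast
  next
    \<comment> \<open>The derivative falls on the factor of direction \<open>l\<close> in the
      remaining product, and the inner difference along \<open>a k\<close> is untouched.\<close>
    assume jl: "j = k" "l \<noteq> k"
    then obtain Y where Y: "scaled_family a Y" "\<forall>s f. dir_deriv (s *\<^sub>R a l) (mollifier_prod a ks s f) = mean_diff (s *\<^sub>R a l) (Y s f)"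
      using dir_deriv_mollifier_prod l by fastforce
    have "dir_deriv (s *\<^sub>R a l) (A' j s f) = mean_diff (s *\<^sub>R a l) (Q s (Y s (mean_diff (s *\<^sub>R a j) f)))" if "0 \<le> s" for s f
      using Y scaled_family_conv_op[OF famQ that] by (simp add: jl(1) Ah conv_op_dir_deriv[symmetric] conv_op_mean_diff_commute)
    with scaled_family_comp[OF famQ Y(1)] show ?thesis
      by blast
  next
    assume jl: "j \<noteq> k" "l = k"
    then obtain Y where Y: "scaled_family a Y" "\<forall>s\<ge>0. \<forall>f. A j s f = Y s (mean_diff (s *\<^sub>R a j) f)"
      using AY[of j] j by auto
    \<comment> \<open>The derivative now falls on the mollifier whose scale is already doubled;
      \<open>?R\<close> is what remains after the resulting difference has been rewritten at the
      scale \<open>s\<close>.\<close>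
    let ?R = "\<lambda>s f. half_sum (s *\<^sub>R a k) (half_sum (s *\<^sub>R a k) (2 *\<^sub>R (2 *\<^sub>R f -
        half_sum (2 *\<^sub>R s *\<^sub>R a k) (half_sum (2 *\<^sub>R s *\<^sub>R a k) f))))"
    have sg2: "scaled_family a (\<lambda>s. half_sum (2 *\<^sub>R s *\<^sub>R a k))"
      using scaled_family_rescale[OF scaled_family_half_sum, of 2 a k] by simp
    have R: "scaled_family a ?R"
      by (intro scaled_family_comp[OF scaled_family_half_sum scaled_family_comp[OF scaled_family_half_sum]] scaled_family_scale scaled_family_diff scaled_family_id scaled_family_comp[OF sg2 sg2])
    have "dir_deriv (s *\<^sub>R a l) (A' j s f) = mean_diff (s *\<^sub>R a l) (?R s (Y s (mean_diff (s *\<^sub>R a j) f)))" if "0 \<le> s" for s f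
      using jl Y that by (simp add: A'_def dir_deriv_mollifier_double del: scaleR_scaleR)
    with scaled_family_comp[OF R Y(1)] show ?thesis
      by blast
  next
    assume jl: "j \<noteq> k" "l \<noteq> k"
    then obtain Y where Y: "scaled_family a Y"
      "\<forall>s\<ge>0. \<forall>f. dir_deriv (s *\<^sub>R a l) (A j s f) = mean_diff (s *\<^sub>R a l) (Y s (mean_diff (s *\<^sub>R a j) f))"
      using ddA[of j l] j l by auto
    have "dir_deriv (s *\<^sub>R a l) (A' j s f) = mean_diff (s *\<^sub>R a l) (mollifier (2 *\<^sub>R s *\<^sub>R a k) (Y s (mean_diff (s *\<^sub>R a j) f)))"
      if "0 \<le> s" for s f
      using jl Y that by (simp add: A'_def conv_op_dir_deriv[OF conv_op_mollifier, symmetric] conv_op_mean_diff_commute[OF conv_op_mollifier])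
    with scaled_family_comp[OF fam2 Y(1)] show ?thesis
      by blast
  qed
  show ?case
    using sum AY' ddA' by blast
qed simp

section \<open>Quantitative bounds for mollifiers\<close>

lemma norm_mean_diff: "norm (mean_diff b f) \<le> 2 * norm f"
  unfolding mean_diff_def using norm_triangle_ineq4[of "segment_mean b f" "segment_mean (2 *\<^sub>R b) f"] norm_segment_mean[of b f] norm_segment_mean[of "2 *\<^sub>R b" f]
  by linarith

lemma norm_mollifier: "norm (mollifier b f) \<le> 3 * norm f"
proof -
  have "norm (mollifier b f) \<le> norm (2 *\<^sub>R segment_mean b (segment_mean b f)) + norm (segment_mean (2 *\<^sub>R b) (segment_mean (2 *\<^sub>R b) f))"
    unfolding mollifier_def by (rule norm_triangle_ineq4)
  moreover have "norm (segment_mean c (segment_mean c f)) \<le> norm f" for c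
    by (rule order_trans[OF norm_segment_mean norm_segment_mean])
  from this[of b] this[of "2 *\<^sub>R b"] calculation show ?thesis
    by simp
qed

text \<open>The constant is 2 * 2 from twice the squared mean at b, plus 2 * 2 from the squared mean
  at 2b, whose directional derivative is twice as large.\<close>

lemma norm_mollifier_diff: "norm (mollifier b f - f) \<le> 8 * norm (dir_deriv b f)"
proof -
  have *: "norm (segment_mean c (segment_mean c f) - f) \<le> 2 * norm (dir_deriv c f)" for c
  proof -
    have "segment_mean c (segment_mean c f) - f = segment_mean c (segment_mean c f - f) + (segment_mean c f - f)"
      by (simp add: tf_diff)
    also have "norm \<dots> \<le> norm (segment_mean c f - f) + norm (segment_mean c f - f)"
      by (rule order_trans[OF norm_triangle_ineq add_right_mono[OF norm_segment_mean]])
    finally show ?thesis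
      using norm_segment_mean_diff[of c f] by simp
  qed
  have "mollifier b f - f = 2 *\<^sub>R (segment_mean b (segment_mean b f) - f) - (segment_mean (2 *\<^sub>R b) (segment_mean (2 *\<^sub>R b) f) - f)"
    by (simp add: mollifier_def scaleR_diff_right scaleR_2)
  also have "norm \<dots> \<le> 2 * norm (segment_mean b (segment_mean b f) - f) + norm (segment_mean (2 *\<^sub>R b) (segment_mean (2 *\<^sub>R b) f) - f)"
    by (rule order_trans[OF norm_triangle_ineq4]) simp
  also have "\<dots> \<le> 8 * norm (dir_deriv b f)"
    using *[of b] *[of "2 *\<^sub>R b"] by (simp add: dir_deriv_scale)
  finally show ?thesis .
qed

text \<open>The constant may depend on \<open>f\<close> through its derivatives, because the error
  is sent to zero for a fixed field only.\<close>

lemma norm_mollifier_prod_diff: "\<exists>K. \<forall>s\<ge>0. norm (mollifier_prod a ks s f - f) \<le> K * s"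
proof (induction ks)
  case Nil
  show ?case
    by (rule exI[of _ 0]) simp
next
  case (Cons k ks)
  then obtain K where K: "\<forall>s\<ge>0. norm (mollifier_prod a ks s f - f) \<le> K * s"
    by blast
  have "norm (mollifier_prod a (k # ks) s f - f) \<le> (3 * K + 8 * norm (dir_deriv (a k) f)) * s" if s: "0 \<le> s" for s
  proof -
    let ?E = "mollifier (s *\<^sub>R a k)"
    have "mollifier_prod a (k # ks) s f - f = ?E (mollifier_prod a ks s f - f) + (?E f - f)"
      by (simp add: linear_diff[OF conv_op_linear[OF conv_op_mollifier]])
    also have "norm \<dots> \<le> 3 * norm (mollifier_prod a ks s f - f) + 8 * norm (dir_deriv (s *\<^sub>R a k) f)"
      by (rule order_trans[OF norm_triangle_ineq add_mono[OF norm_mollifier norm_mollifier_diff]])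
    also have "\<dots> \<le> 3 * (K * s) + 8 * (norm (dir_deriv (a k) f) * s)"
      using K s by (simp add: dir_deriv_scale)
    finally show ?thesis
      by (simp add: algebra_simps)
  qed
  then show ?case
    by blast
qed

lemma scaled_family_norm: "scaled_family a Y \<Longrightarrow> \<exists>C\<ge>0. \<forall>s\<ge>0. \<forall>f. norm (Y s f) \<le> C * norm f"
  using scaled_familyD unfolding adm_op_def by meson

text \<open>A derivative of a mollified function costs the inverse of the scale. With
  \<open>s\<close> on the left nothing is divided, and \<open>s = 0\<close> is harmless.\<close>

lemma dir_deriv_mollifier_prod_bound: "\<exists>C\<ge>0. \<forall>l\<in>set ks. \<forall>s\<ge>0. \<forall>f. s * norm (dir_deriv (a l) (mollifier_prod a ks s f)) \<le> C * norm f"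
proof -
  have "\<exists>C\<ge>0. \<forall>s\<ge>0. \<forall>f. s * norm (dir_deriv (a l) (mollifier_prod a ks s f)) \<le> C * norm f" if "l \<in> set ks" for l
  proof -
    obtain Y where Y: "scaled_family a Y" "\<And>s f. dir_deriv (s *\<^sub>R a l) (mollifier_prod a ks s f) = mean_diff (s *\<^sub>R a l) (Y s f)"
      using dir_deriv_mollifier_prod \<open>l \<in> set ks\<close> by blast
    obtain C where C: "0 \<le> C" "\<forall>s\<ge>0. \<forall>f. norm (Y s f) \<le> C * norm f"
      using scaled_family_norm[OF Y(1)] by blast
    have "s * norm (dir_deriv (a l) (mollifier_prod a ks s f)) \<le> 2 * C * norm f" if "0 \<le> s" for s f
    proof -
      have "s * norm (dir_deriv (a l) (mollifier_prod a ks s f)) = norm (mean_diff (s *\<^sub>R a l) (Y s f))"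
        using Y(2)[of s f] that by (simp add: dir_deriv_scale flip: Y(2))
      also have "\<dots> \<le> 2 * norm (Y s f)"
        by (rule norm_mean_diff)
      also have "\<dots> \<le> 2 * (C * norm f)"
        using C that by simp
      finally show ?thesis
        by simp
    qed
    then show ?thesis
      using C by (intro exI[of _ "2 * C"]) auto
  qed
  then obtain C where C: "\<And>l. l \<in> set ks \<Longrightarrow> 0 \<le> C l"
    "\<And>l s f. l \<in> set ks \<Longrightarrow> 0 \<le> s \<Longrightarrow> s * norm (dir_deriv (a l) (mollifier_prod a ks s f)) \<le> C l * norm f"
    by metis
  have "C l \<le> sum C (set ks)" if "l \<in> set ks" for l
    using C that by (intro member_le_sum) auto
  then show ?thesis
    using C by (intro exI[of _ "sum C (set ks)"]) (auto intro!: sum_nonneg order_trans[OF C(2) mult_right_mono])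
qed

lemma axis_sum_dir_deriv:
  assumes "axis i 1 = (\<Sum>l\<in>UNIV. c l *\<^sub>R a l)"
  shows "partial_tf i f = (\<Sum>l\<in>UNIV. c l *\<^sub>R dir_deriv (a l) f)"
proof (rule tf_eqI)
  fix x
  have "fn (partial_tf i f) x = axis i 1 \<bullet> (\<chi> i. partial i (fn f) x)"
    by (simp add: fn_partial_tf inner_axis')
  also have "\<dots> = fn (\<Sum>l\<in>UNIV. c l *\<^sub>R dir_deriv (a l) f) x"
    unfolding assms by (simp add: inner_sum_left fn_dir_deriv)
  finally show "fn (partial_tf i f) x = fn (\<Sum>l\<in>UNIV. c l *\<^sub>R dir_deriv (a l) f) x" .
qed

text \<open>Two different gains bound the sum over the scales from \<open>S / 2^N\<close> to
  \<open>S\<close>. For \<open>A\<close> itself the weights form a geometric series with sum at most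
  \<open>S\<close>. For its derivatives the weights are used up and all scales count equally, so
  independence of \<open>N\<close> rests on the square function estimate.\<close>

lemma telescoping:
  assumes ks: "distinct ks" "set ks = UNIV"
  shows "\<exists>C\<ge>0. \<forall>S>0. \<forall>N. \<exists>A. (\<forall>j. adm_op a (C * S) (C * S) (A j)) \<and>
    (\<forall>j l f. norm (dir_deriv (a l) (A j f)) \<le> C * norm f) \<and>
    (\<forall>f. mollifier_prod a ks (S / 2^N) f - mollifier_prod a ks S f = (\<Sum>k\<in>UNIV. dir_deriv (a k) (A k f)))"
proof -
  obtain A where
    A: "\<And>s f. mollifier_prod a ks s f - mollifier_prod a ks (2 * s) f = (\<Sum>k\<in>UNIV. dir_deriv (s *\<^sub>R a k) (A k s f))"
    and AY: "\<forall>k. \<exists>Y. scaled_family a Y \<and> (\<forall>s\<ge>0. \<forall>f. A k s f = Y s (mean_diff (s *\<^sub>R a k) f))"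
    and ddA: "\<forall>k l. \<exists>Y. scaled_family a Y \<and>
       (\<forall>s\<ge>0. \<forall>f. dir_deriv (s *\<^sub>R a l) (A k s f) = mean_diff (s *\<^sub>R a l) (Y s (mean_diff (s *\<^sub>R a k) f)))"
    using mollifier_prod_diff[OF ks(1), of a] unfolding ks(2) by auto
  have "\<exists>C\<ge>0. \<forall>s\<ge>0. adm_op a (C * s) C (A k s)" for k
  proof -
    obtain Y where Y: "scaled_family a Y" "\<forall>s\<ge>0. \<forall>f. A k s f = Y s (mean_diff (s *\<^sub>R a k) f)"
      using AY by blast
    have "A k s = (\<lambda>f. Y s (mean_diff (s *\<^sub>R a k) f))" if "0 \<le> s" for s
      using Y that by auto
    then show ?thesis
      using scaled_familyD[OF scaled_family_comp[OF Y(1) scaled_family_mean_diff]] by metis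
  qed
  then obtain C where C: "\<And>k. 0 \<le> C k" "\<And>k s. 0 \<le> s \<Longrightarrow> adm_op a (C k * s) (C k) (A k s)"
    by metis
  obtain Y where Y: "\<And>k l. scaled_family a (Y k l)"
    "\<And>k l s f. 0 \<le> s \<Longrightarrow> dir_deriv (s *\<^sub>R a l) (A k s f) = mean_diff (s *\<^sub>R a l) (Y k l s (mean_diff (s *\<^sub>R a k) f))"
    using ddA by metis
  obtain D where D: "\<And>k l. 0 \<le> D k l" "\<And>k l s f. 0 \<le> s \<Longrightarrow> norm (Y k l s f) \<le> D k l * norm f"
    using scaled_family_norm[OF Y(1)] by metis
  define B where "B = (\<Sum>k\<in>UNIV. C k) + (\<Sum>k\<in>UNIV. \<Sum>l\<in>UNIV. D k l)"
  have CB: "C k \<le> B" for k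
    unfolding B_def using C D by (intro add_increasing2 sum_nonneg member_le_sum) auto
  have "D k l \<le> (\<Sum>k\<in>UNIV. \<Sum>l\<in>UNIV. D k l)" for k l
    by (rule order_trans[OF member_le_sum[of l UNIV "D k"] member_le_sum[of k UNIV "\<lambda>k. \<Sum>l\<in>UNIV. D k l"]])
      (auto intro: sum_nonneg D)
  then have DB: "D k l \<le> B" for k l
    unfolding B_def using C by (intro add_increasing sum_nonneg) auto
  have B0: "0 \<le> B"
    unfolding B_def by (intro add_nonneg_nonneg sum_nonneg C D)
  have "\<exists>A. (\<forall>j. adm_op a (B * S) (B * S) (A j)) \<and>
    (\<forall>j l f. norm (dir_deriv (a l) (A j f)) \<le> B * norm f) \<and>
    (\<forall>f. mollifier_prod a ks (S / 2^N) f - mollifier_prod a ks S f = (\<Sum>k\<in>UNIV. dir_deriv (a k) (A k f)))" if S: "0 < S" for S :: real and N :: nat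
  proof -
    define s where "s n = 2^n * (S / 2^N)" for n
    have s: "0 \<le> s n" "s (Suc n) = 2 * s n" for n
      using S by (auto simp: s_def)
    have sS: "s n \<le> S" if "n < N" for n
    proof -
      have "(2::real)^n \<le> 2^N"
        using that by (intro power_increasing) auto
      then show ?thesis
        using S by (simp add: s_def field_simps)
    qed
    have sum_s: "(\<Sum>n<M. s n) = s M - s 0" for M
      by (induction M) (auto simp: s(2))
    have s0N: "s 0 = S / 2^N" "s N = S"
      by (auto simp: s_def)
    \<comment> \<open>The weight \<open>s n\<close> compensates for differentiating along
      \<open>a k\<close> in place of \<open>s n *\<^sub>R a k\<close>.\<close>
    define AA where "AA j f = (\<Sum>n<N. s n *\<^sub>R A j (s n) f)" for j f
    have "adm_op a (B * S) (B * S) (AA j)" for j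
    proof -
      have 1: "adm_op a (B * S) (\<bar>s n\<bar> * B) (\<lambda>f. s n *\<^sub>R A j (s n) f)" if "n \<in> {..<N}" for n
      proof (rule adm_op_scale, rule adm_op_mono[OF C(2)[OF s(1)] _ CB])
        show "C j * s n \<le> B * S"
          using that sS[of n] s(1) CB B0 by (intro mult_mono) auto
      qed
      have "adm_op a (B * S) (\<Sum>n<N. \<bar>s n\<bar> * B) (AA j)"
        unfolding AA_def[abs_def] using B0 S by (intro adm_op_sum 1) auto
      moreover have "(\<Sum>n<N. \<bar>s n\<bar> * B) \<le> B * S"
      proof -
        have "(\<Sum>n<N. \<bar>s n\<bar> * B) = (s N - s 0) * B"
          using s(1) by (simp add: sum_s flip: sum_distrib_right)
        also have "\<dots> \<le> S * B"
          using B0 s(1)[of 0] s0N(2) by (intro mult_right_mono) auto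
        finally show ?thesis
          by (simp add: mult.commute)
      qed
      ultimately show ?thesis
        by (rule adm_op_mono[OF _ order_refl])
    qed
    moreover have "norm (dir_deriv (a l) (AA j f)) \<le> B * norm f" for j l f
    proof -
      \<comment> \<open>The weight is absorbed into the direction of the derivative. What is left
        has a difference along \<open>a l\<close> outside and one along \<open>a j\<close> inside,
        both at the scale \<open>s n\<close>.\<close>
      have "dir_deriv (a l) (AA j f) = (\<Sum>n<N. mean_diff (2^n *\<^sub>R (s 0 *\<^sub>R a l)) (Y j l (s n) (mean_diff (s n *\<^sub>R a j) f)))"
        using s(1) by (simp add: AA_def tf_sum tf_scale Y(2) flip: dir_deriv_scale) (simp add: s_def)
      moreover have "norm (\<Sum>n<N. mean_diff (2^n *\<^sub>R (s 0 *\<^sub>R a l)) (Y j l (s n) (mean_diff (s n *\<^sub>R a j) f))) \<le> B * norm f"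
      proof (rule norm_sum_mean_diff[where c = "s 0 *\<^sub>R a j", OF _ B0])
        fix n
        have "2^n *\<^sub>R (s 0 *\<^sub>R a j) = s n *\<^sub>R a j"
          by (simp add: s_def)
        then show "norm (Y j l (s n) (mean_diff (s n *\<^sub>R a j) f)) \<le> B * norm (mean_diff (2^n *\<^sub>R (s 0 *\<^sub>R a j)) f)"
          using order_trans[OF D(2)[OF s(1)] mult_right_mono[OF DB norm_ge_zero]] by metis
      qed
      ultimately show ?thesis
        by simp
    qed
    moreover have "mollifier_prod a ks (S / 2^N) f - mollifier_prod a ks S f = (\<Sum>k\<in>UNIV. dir_deriv (a k) (AA k f))" for f
    proof -
      have "mollifier_prod a ks (s 0) f - mollifier_prod a ks (s M) f = (\<Sum>n<M. mollifier_prod a ks (s n) f - mollifier_prod a ks (s (Suc n)) f)" for M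
        by (simp add: sum_lessThan_telescope'[of "\<lambda>n. mollifier_prod a ks (s n) f"])
      then have "mollifier_prod a ks (S / 2^N) f - mollifier_prod a ks S f = (\<Sum>n<N. mollifier_prod a ks (s n) f - mollifier_prod a ks (s (Suc n)) f)"
        using s0N by metis
      also have "\<dots> = (\<Sum>n<N. \<Sum>k\<in>UNIV. dir_deriv (s n *\<^sub>R a k) (A k (s n) f))"
        by (simp add: s(2) A)
      also have "\<dots> = (\<Sum>k\<in>UNIV. dir_deriv (a k) (AA k f))"
        unfolding AA_def by (subst sum.swap) (simp add: tf_sum tf_scale dir_deriv_scale)
      finally show ?thesis .
    qed
    ultimately show ?thesis
      by blast
  qed
  with B0 show ?thesis
    by blast
qed

text \<open>The operators \<open>G j\<close> are convolutions with the components of a vector field whose divergence is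
  the difference of two mollifying kernels.\<close>
theorem homotopy:
  fixes a :: "'n::finite \<Rightarrow> real^'n"
  assumes c: "\<And>i. axis i 1 = (\<Sum>l\<in>UNIV. c i l *\<^sub>R a l)"
  shows "\<exists>C\<ge>0. \<exists>H. (\<forall>s\<ge>0. adm_op a (C * s) C (H s)) \<and>
    (\<forall>f. \<exists>K. \<forall>s\<ge>0. norm (H s f - f) \<le> K * s) \<and>
    (\<forall>s\<ge>0. \<forall>i f. s * norm (partial_tf i (H s f)) \<le> C * norm f) \<and>
    (\<forall>S>0. \<forall>N. \<exists>G. (\<forall>j. adm_op a (C * S) (C * S) (G j)) \<and>
      (\<forall>i j f. norm (partial_tf i (G j f)) \<le> C * norm f) \<and>
      (\<forall>f. H (S / 2^N) f - H S f = (\<Sum>j\<in>UNIV. partial_tf j (G j f))))"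
proof -
  obtain ks :: "'n list" where ks: "set ks = UNIV" "distinct ks"
    using finite_distinct_list[of "UNIV :: 'n set"] by auto
  obtain C0 where C0: "0 \<le> C0" "\<forall>s\<ge>0. adm_op a (C0 * s) C0 (mollifier_prod a ks s)"
    using scaled_familyD[OF scaled_family_mollifier_prod] by blast
  obtain C1 where C1: "0 \<le> C1" "\<And>l s f. 0 \<le> s \<Longrightarrow> s * norm (dir_deriv (a l) (mollifier_prod a ks s f)) \<le> C1 * norm f"
    using dir_deriv_mollifier_prod_bound[of ks a] unfolding ks(1) by auto
  obtain C2 where C2: "0 \<le> C2" "\<And>S N. 0 < S \<Longrightarrow> \<exists>A. (\<forall>j. adm_op a (C2 * S) (C2 * S) (A j)) \<and>
    (\<forall>j l f. norm (dir_deriv (a l) (A j f)) \<le> C2 * norm f) \<and>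
    (\<forall>f. mollifier_prod a ks (S / 2^N) f - mollifier_prod a ks S f = (\<Sum>k\<in>UNIV. dir_deriv (a k) (A k f)))"
    using telescoping[OF ks(2,1), of a] by auto
  \<comment> \<open>\<open>c'\<close> pays for expressing coordinate derivatives through derivatives
    along the basis, \<open>a'\<close> for the coordinates of the basis vectors.\<close>
  define c' where "c' = (\<Sum>i\<in>UNIV. \<Sum>l\<in>UNIV. \<bar>c i l\<bar>)"
  define a' where "a' = (\<Sum>j\<in>UNIV. \<Sum>k\<in>UNIV. \<bar>a k $ j\<bar>)"
  have c': "(\<Sum>l\<in>UNIV. \<bar>c i l\<bar>) \<le> c'" for i
    unfolding c'_def by (rule member_le_sum) (auto intro: sum_nonneg)
  have a': "(\<Sum>k\<in>UNIV. \<bar>a k $ j\<bar>) \<le> a'" for j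
    unfolding a'_def by (rule member_le_sum) (auto intro: sum_nonneg)
  have nn: "0 \<le> c'" "0 \<le> a'"
    unfolding c'_def a'_def by (auto intro: sum_nonneg)
  have partial_tf_le: "norm (partial_tf i f) \<le> c' * m" if "\<And>l. norm (dir_deriv (a l) f) \<le> m" "0 \<le> m" for i f m
  proof -
    have "norm (partial_tf i f) \<le> (\<Sum>l\<in>UNIV. norm (c i l *\<^sub>R dir_deriv (a l) f))"
      unfolding axis_sum_dir_deriv[OF c] by (rule norm_sum)
    also have "\<dots> \<le> (\<Sum>l\<in>UNIV. \<bar>c i l\<bar> * m)"
      by (intro sum_mono) (simp add: mult_left_mono that)
    also have "\<dots> \<le> c' * m"
      using c'[of i] that(2) by (simp add: mult_right_mono flip: sum_distrib_right)
    finally show ?thesis .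
  qed
  define C where "C = C0 + c' * C1 + C2 + a' * C2 + c' * (a' * C2)"
  have C: "0 \<le> C" "C0 \<le> C" "c' * C1 \<le> C" "C2 \<le> C" "a' * C2 \<le> C" "c' * (a' * C2) \<le> C"
    unfolding C_def using C0 C1 C2(1) nn by simp_all
  have H: "adm_op a (C * s) C (mollifier_prod a ks s)" if "0 \<le> s" for s
    using adm_op_mono[of a "C0 * s" C0 "mollifier_prod a ks s" "C * s" C] C0 C that by (simp add: mult_right_mono)
  have pdH: "s * norm (partial_tf i (mollifier_prod a ks s f)) \<le> C * norm f" if "0 \<le> s" for s i f
  proof -
    have "norm (partial_tf i (s *\<^sub>R mollifier_prod a ks s f)) \<le> c' * (C1 * norm f)"
      using C1 that by (intro partial_tf_le) (auto simp: tf_scale)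
    also have "\<dots> \<le> C * norm f"
      using mult_right_mono[OF C(3), of "norm f"] by (simp add: mult.assoc)
    finally show ?thesis
      using that by (simp add: tf_scale)
  qed
  have G: "\<exists>G. (\<forall>j. adm_op a (C * S) (C * S) (G j)) \<and>
      (\<forall>i j f. norm (partial_tf i (G j f)) \<le> C * norm f) \<and>
      (\<forall>f. mollifier_prod a ks (S / 2^N) f - mollifier_prod a ks S f = (\<Sum>j\<in>UNIV. partial_tf j (G j f)))" if S: "0 < S" for S :: real and N :: nat
  proof -
    obtain A where A: "\<And>j. adm_op a (C2 * S) (C2 * S) (A j)"
      "\<And>j l f. norm (dir_deriv (a l) (A j f)) \<le> C2 * norm f"
      "\<And>f. mollifier_prod a ks (S / 2^N) f - mollifier_prod a ks S f = (\<Sum>k\<in>UNIV. dir_deriv (a k) (A k f))"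
      using C2(2)[OF S, of N] by blast
    \<comment> \<open>Weighting the operators by the components of the \<open>a k\<close> turns the
      sum of derivatives along the basis into a divergence in coordinates.\<close>
    define G where "G j f = (\<Sum>k\<in>UNIV. a k $ j *\<^sub>R A k f)" for j f
    have "adm_op a (C * S) (C * S) (G j)" for j
    proof (rule adm_op_mono)
      show "adm_op a (C2 * S) (\<Sum>k\<in>UNIV. \<bar>a k $ j\<bar> * (C2 * S)) (G j)"
        unfolding G_def[abs_def] using C2(1) S by (intro adm_op_sum adm_op_scale A(1)) auto
      show "C2 * S \<le> C * S"
        using C S by (simp add: mult_right_mono)
      have "(\<Sum>k\<in>UNIV. \<bar>a k $ j\<bar> * (C2 * S)) \<le> a' * (C2 * S)"
        using a'[of j] C2(1) S by (simp add: mult_right_mono flip: sum_distrib_right)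
      also have "\<dots> \<le> C * S"
        using mult_right_mono[OF C(5), of S] S by (simp add: mult.assoc)
      finally show "(\<Sum>k\<in>UNIV. \<bar>a k $ j\<bar> * (C2 * S)) \<le> C * S" .
    qed
    moreover have "norm (partial_tf i (G j f)) \<le> C * norm f" for i j f
    proof -
      have "norm (dir_deriv (a l) (G j f)) \<le> a' * (C2 * norm f)" for l
      proof -
        have "norm (dir_deriv (a l) (G j f)) \<le> (\<Sum>k\<in>UNIV. norm (a k $ j *\<^sub>R dir_deriv (a l) (A k f)))"
          unfolding G_def tf_sum tf_scale by (rule norm_sum)
        also have "\<dots> \<le> (\<Sum>k\<in>UNIV. \<bar>a k $ j\<bar> * (C2 * norm f))"
          by (intro sum_mono) (simp add: mult_left_mono A(2))
        also have "\<dots> \<le> a' * (C2 * norm f)"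
          using a'[of j] C2(1) by (simp add: mult_right_mono flip: sum_distrib_right)
        finally show ?thesis .
      qed
      then have "norm (partial_tf i (G j f)) \<le> c' * (a' * (C2 * norm f))"
        using nn C2(1) by (intro partial_tf_le) auto
      also have "\<dots> \<le> C * norm f"
        using mult_right_mono[OF C(6), of "norm f"] by (simp add: mult.assoc)
      finally show ?thesis .
    qed
    moreover have "(\<Sum>k\<in>UNIV. dir_deriv (a k) (A k f)) = (\<Sum>j\<in>UNIV. partial_tf j (G j f))" for f
      unfolding dir_deriv_def G_def tf_sum tf_scale by (rule sum.swap)
    ultimately show ?thesis
      using A(3) by (intro exI[of _ G]) simp
  qed
  show ?thesis
    using C(1) H norm_mollifier_prod_diff pdH G by (intro exI[of _ C] conjI exI[of _ "mollifier_prod a ks"]) blast+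
qed

subsection \<open>Smooth cutoff functions\<close>

lemma derivative_chain_coinduct:
  assumes "P f" "\<And>f. P f \<Longrightarrow> \<exists>f'. P f' \<and> (\<forall>t. (f has_real_derivative f' t) (at t))"
  shows "\<exists>H. derivative_chain H \<and> H 0 = f"
proof -
  obtain d where d: "\<And>f. P f \<Longrightarrow> P (d f) \<and> (\<forall>t. (f has_real_derivative d f t) (at t))"
    using assms(2) by metis
  have "P ((d ^^ n) f)" for n
    by (induction n) (use assms(1) d in auto)
  then show ?thesis
    using d by (intro exI[of _ "\<lambda>n. (d ^^ n) f"]) (auto simp: derivative_chain_def)
qed

definition flat :: "real poly \<Rightarrow> real \<Rightarrow> real" where
  "flat p t = (if t \<le> 0 then 0 else poly p (1 / t) * exp (- 1 / t))"

lemma poly_exp_tendsto_0: "((\<lambda>x. poly p x * exp (- x)) \<longlongrightarrow> (0::real)) at_top"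
proof -
  have "((\<lambda>x. \<Sum>i\<le>degree p. coeff p i * (x ^ i / exp x)) \<longlongrightarrow> (\<Sum>i\<le>degree p. coeff p i * 0)) at_top"
    by (intro tendsto_intros tendsto_power_div_exp_0)
  then show ?thesis
    by (simp add: poly_altdef sum_distrib_right exp_minus divide_inverse mult.assoc)
qed

text \<open>With u = 1/t, the derivative of p(u) exp(-u) in t is u^2 (p - p')(u) exp(-u), hence the
  polynomial factor. At t = 0 the difference quotient from the right is u p(u) exp(-u), which tends
  to 0 as u grows.\<close>

lemma flat_has_derivative:
  "(flat p has_real_derivative flat ([:0, 0, 1:] * (p - pderiv p)) t) (at t)"
proof -
  consider "t < 0" | "t = 0" | "0 < t"
    by linarith
  then show ?thesis
  proof cases
    case 1
    have "((\<lambda>t. 0) has_real_derivative 0) (at t)"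
      by simp
    then have "(flat p has_real_derivative 0) (at t)"
      by (rule has_field_derivative_transform_within_open[where S = "{..<0}"]) (use 1 in \<open>auto simp: flat_def\<close>)
    then show ?thesis
      using 1 by (simp add: flat_def)
  next
    case 3
    have "((\<lambda>t. poly p (1 / t) * exp (- 1 / t)) has_real_derivative flat ([:0, 0, 1:] * (p - pderiv p)) t) (at t)"
      using 3 by (auto simp: flat_def power2_eq_square field_simps intro!: derivative_eq_intros DERIV_chain2[OF poly_DERIV])
    then show ?thesis
      by (rule has_field_derivative_transform_within_open[where S = "{0<..}"]) (use 3 in \<open>auto simp: flat_def\<close>)
  next
    case 2
    have "((\<lambda>u. poly ([:0, 1:] * p) u * exp (- u)) \<longlongrightarrow> 0) at_top"
      by (rule poly_exp_tendsto_0)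
    then have "((\<lambda>h. poly ([:0, 1:] * p) (inverse h) * exp (- inverse h)) \<longlongrightarrow> 0) (at_right 0)"
      by (rule filterlim_compose[OF _ filterlim_inverse_at_top_right])
    then have "((\<lambda>h. (flat p (0 + h) - flat p 0) / h) \<longlongrightarrow> 0) (at_right 0)"
      by (rule Lim_transform_eventually)
        (auto simp: flat_def eventually_at_filter field_simps intro!: always_eventually)
    moreover have "((\<lambda>h. (flat p (0 + h) - flat p 0) / h) \<longlongrightarrow> 0) (at_left 0)"
      by (rule Lim_transform_eventually[OF tendsto_const])
        (auto simp: flat_def eventually_at_filter intro!: always_eventually)
    ultimately have "((\<lambda>h. (flat p (0 + h) - flat p 0) / h) \<longlongrightarrow> 0) (at 0)"
      by (simp add: filterlim_split_at)
    then have "(flat p has_real_derivative 0) (at 0)"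
      by (simp add: DERIV_def)
    then show ?thesis
      using 2 by (simp add: flat_def)
  qed
qed

text \<open>The algebra generated by the flat functions and their reflections is stable under
  differentiation; negation is included because reflecting changes the sign of the
  derivative.\<close>

inductive bump_closure :: "(real \<Rightarrow> real) \<Rightarrow> bool" where
  flat: "bump_closure (flat p)"
| reflect: "bump_closure (\<lambda>t. flat p (1 - t))"
| uminus: "bump_closure f \<Longrightarrow> bump_closure (\<lambda>t. - f t)"
| add: "bump_closure f \<Longrightarrow> bump_closure g \<Longrightarrow> bump_closure (\<lambda>t. f t + g t)"
| mult: "bump_closure f \<Longrightarrow> bump_closure g \<Longrightarrow> bump_closure (\<lambda>t. f t * g t)"

lemma bump_closure_step:
  "bump_closure f \<Longrightarrow> \<exists>f'. bump_closure f' \<and> (\<forall>t. (f has_real_derivative f' t) (at t))"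
proof (induction rule: bump_closure.induct)
  case (flat p)
  then show ?case
    using flat_has_derivative bump_closure.flat by blast
next
  case (reflect p)
  have "((\<lambda>t. flat p (1 - t)) has_real_derivative - flat ([:0, 0, 1:] * (p - pderiv p)) (1 - t)) (at t)" for t
  proof -
    have "((\<lambda>t. 1 - t) has_real_derivative - 1) (at t)"
      by (auto intro!: derivative_eq_intros)
    from DERIV_chain2[OF flat_has_derivative this] show ?thesis
      by simp
  qed
  moreover have "bump_closure (\<lambda>t. - flat ([:0, 0, 1:] * (p - pderiv p)) (1 - t))"
    by (rule bump_closure.uminus[OF bump_closure.reflect])
  ultimately show ?case
    by blast
next
  case (uminus f)
  then obtain f' where "bump_closure f'" "\<forall>t. (f has_real_derivative f' t) (at t)"
    by blast
  then show ?case
    by (intro exI[of _ "\<lambda>t. - f' t"]) (auto intro: bump_closure.uminus DERIV_minus)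
next
  case (add f g)
  then obtain f' g' where "bump_closure f'" "\<forall>t. (f has_real_derivative f' t) (at t)"
    "bump_closure g'" "\<forall>t. (g has_real_derivative g' t) (at t)"
    by blast
  then show ?case
    by (intro exI[of _ "\<lambda>t. f' t + g' t"]) (auto intro: bump_closure.add DERIV_add)
next
  case (mult f g)
  then obtain f' g' where "bump_closure f'" "\<forall>t. (f has_real_derivative f' t) (at t)"
    "bump_closure g'" "\<forall>t. (g has_real_derivative g' t) (at t)"
    by blast
  with mult.hyps show ?case
    by (intro exI[of _ "\<lambda>t. f' t * g t + g' t * f t"]) (auto intro: bump_closure.intros DERIV_mult)
qed

text \<open>The step is the normalised antiderivative of a smooth bump that vanishes outside the
  unit interval; it is constant on either side by the mean value theorem.\<close>

lemma smooth_step: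
  "\<exists>H. derivative_chain H \<and> (\<forall>t\<le>0. H 0 t = 0) \<and> (\<forall>t\<ge>1. H 0 t = 1)"
proof -
  define m where "m t = flat 1 t * flat 1 (1 - t)" for t
  have m: "m t = (if 0 < t \<and> t < 1 then exp (- 1 / t) * exp (- 1 / (1 - t)) else 0)" for t
    by (auto simp: m_def flat_def)
  have "bump_closure m"
    unfolding m_def[abs_def] by (intro bump_closure.intros)
  then obtain H where H: "derivative_chain H" "H 0 = m"
    using derivative_chain_coinduct[of bump_closure m] bump_closure_step by blast
  have "isCont m t" for t
    using H DERIV_isCont unfolding derivative_chain_def by metis
  then obtain F where F: "\<And>t. (F has_real_derivative m t) (at t)"
    using einterval_antiderivative[of "-\<infinity>" "\<infinity>" m] by (auto simp: has_real_derivative_iff_has_vector_derivative)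
  have pos: "F 0 < F 1"
  proof (rule DERIV_pos_imp_increasing_open[of 0 1 F])
    show "\<exists>y. (F has_real_derivative y) (at x) \<and> 0 < y" if "0 < x" "x < 1" for x
      using F[of x] that by (auto simp: m)
    show "continuous_on {0..1} F"
      using F by (meson DERIV_continuous_on has_field_derivative_at_within)
  qed simp
  have const: "F s = F t" if "s \<le> t" "t \<le> 0 \<or> 1 \<le> s" for s t
  proof (cases "s = t")
    case False
    then have "s < t"
      using that by simp
    then obtain z where "s < z" "z < t" "F t - F s = (t - s) * m z"
      using MVT2[of s t F m] F by blast
    with that show ?thesis
      by (auto simp: m split: if_splits)
  qed simp
  \<comment> \<open>The antiderivative is put in front of the chain of the bump, so the index into
    \<open>H\<close> drops by one.\<close>
  define H' where "H' n = (case n of 0 \<Rightarrow> (\<lambda>t. (F t - F 0) / (F 1 - F 0)) | Suc n \<Rightarrow> (\<lambda>t. H n t / (F 1 - F 0)))" for n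
  have "derivative_chain H'"
    unfolding derivative_chain_def
  proof (intro allI)
    fix n t
    show "(H' n has_real_derivative H' (Suc n) t) (at t)"
      using F[of t] H pos unfolding H'_def derivative_chain_def
      by (cases n) (auto intro!: derivative_eq_intros DERIV_cdivide)
  qed
  moreover have "H' 0 t = 0" if "t \<le> 0" for t
    using const[of t 0] that by (simp add: H'_def)
  moreover have "H' 0 t = 1" if "1 \<le> t" for t
    using const[of 1 t] that pos by (simp add: H'_def)
  ultimately show ?thesis
    by blast
qed

lemma plateau:
  fixes x :: "real^'n::finite"
  assumes r: "0 < r"
  shows "\<exists>\<phi>. (\<forall>y\<in>ball x (r / 2). fn \<phi> y = 1) \<and> (\<forall>y. y \<notin> cball x r \<longrightarrow> fn \<phi> y = 0)"
proof -
  obtain H where H: "derivative_chain H" "\<forall>t\<le>0. H 0 t = 0" "\<forall>t\<ge>1. H 0 t = 1"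
    using smooth_step by blast
  \<comment> \<open>This is (4/3) (1 - (dist/r)^2): at most 0 from radius r on, and at least (4/3)
    (3/4) = 1 within radius r/2. In coordinates it is visibly a polynomial, hence smooth.\<close>
  define q where "q y = (4 / 3) + (- 4 / (3 * r\<^sup>2)) * (\<Sum>k\<in>UNIV. (y $ k + - x $ k) * (y $ k + - x $ k))" for y :: "real^'n"
  have q: "q y = (4 / 3) * (1 - (dist y x / r)\<^sup>2)" for y
  proof -
    have "(dist y x)\<^sup>2 = (\<Sum>k\<in>UNIV. (y $ k + - x $ k) * (y $ k + - x $ k))"
      by (simp add: dist_norm power2_norm_eq_inner inner_vec_def)
    then show ?thesis
      using r by (simp add: q_def power_divide field_simps)
  qed
  have "smooth_fun q"
    unfolding q_def[abs_def]
    by (intro smooth_fun_add smooth_fun_mult smooth_fun_sum smooth_fun_const smooth_fun_component)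
  then have "smooth_fun (\<lambda>y. H 0 (q y))"
    by (rule smooth_fun_compose[OF H(1)])
  moreover have 0: "H 0 (q y) = 0" if "y \<notin> cball x r" for y
  proof -
    have "1 \<le> dist y x / r"
      using that r by (simp add: dist_commute)
    then have "q y \<le> 0"
      unfolding q by (simp add: one_le_power)
    then show ?thesis
      using H by blast
  qed
  then have "{y. H 0 (q y) \<noteq> 0} \<subseteq> cball x r"
    by blast
  ultimately have fn: "fn (Tf (\<lambda>y. H 0 (q y))) = (\<lambda>y. H 0 (q y))"
    by (intro fn_Tf[OF _ compact_cball])
  moreover have "H 0 (q y) = 1" if "y \<in> ball x (r / 2)" for y
  proof -
    have "dist y x / r \<le> 1 / 2"
      using that r by (simp add: dist_commute field_simps)
    then have "(dist y x / r)\<^sup>2 \<le> (1 / 2)\<^sup>2"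
      using r by (intro power_mono) auto
    then have "(dist y x / r)\<^sup>2 \<le> 1 / 4"
      by (simp only: power_divide) simp
    then have "(4 / 3) * (1 - 1 / 4) \<le> q y"
      unfolding q by (intro mult_left_mono diff_left_mono) auto
    then have "1 \<le> q y"
      by simp
    then show ?thesis
      using H by blast
  qed
  ultimately show ?thesis
    using 0 by (intro exI[of _ "Tf (\<lambda>y. H 0 (q y))"]) simp
qed

lemma norm_times_tf_bound: "\<exists>B\<ge>0. \<forall>f. norm (times_tf \<phi> f) \<le> B * norm f"
proof -
  have "compact (fn \<phi> ` tsupport (fn \<phi>))"
    by (intro compact_continuous_image continuous_intros compact_fn)
  then obtain B where B: "\<And>y. y \<in> tsupport (fn \<phi>) \<Longrightarrow> \<bar>fn \<phi> y\<bar> \<le> B"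
    using compact_imp_bounded[of "fn \<phi> ` tsupport (fn \<phi>)"] unfolding bounded_iff by auto
  have B': "\<bar>fn \<phi> y\<bar> \<le> max B 0" for y
    using B[of y] in_tsupport[of "fn \<phi>" y] by fastforce
  have "norm (times_tf \<phi> f) \<le> max B 0 * norm f" for f
  proof -
    have "inner (times_tf \<phi> f) (times_tf \<phi> f) \<le> inner (max B 0 *\<^sub>R f) (max B 0 *\<^sub>R f)"
      unfolding inner_tf_def
    proof (rule integral_le)
      fix x
      have "(fn \<phi> x * fn f x)\<^sup>2 \<le> (max B 0 * fn f x)\<^sup>2"
        unfolding power_mult_distrib using power_mono[OF B'[of x], of 2] by (intro mult_right_mono) auto
      then show "fn (times_tf \<phi> f) x * fn (times_tf \<phi> f) x \<le> fn (max B 0 *\<^sub>R f) x * fn (max B 0 *\<^sub>R f) x"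
        by (simp add: fn_times_tf power2_eq_square)
    qed (intro fn_times_integrable continuous_intros)+
    then have "norm (times_tf \<phi> f) \<le> norm (max B 0 *\<^sub>R f)"
      unfolding norm_eq_sqrt_inner by simp
    then show ?thesis
      by simp
  qed
  then show ?thesis
    by (intro exI[of _ "max B 0"]) auto
qed

lemma dir_deriv_axis: "dir_deriv (s *\<^sub>R axis i 1) f = s *\<^sub>R partial_tf i f"
proof -
  have "dir_deriv (axis i 1) f = partial_tf i f"
    by (rule tf_eqI) (simp add: fn_dir_deriv fn_partial_tf inner_axis')
  then show ?thesis
    by (simp add: dir_deriv_scale)
qed

text \<open>Averaging both mixed derivatives over small segments gives the same second difference.\<close>
lemma partial_tf_commute: "partial_tf i (partial_tf j f) = partial_tf j (partial_tf i f)"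
proof -
  define D where "D = partial_tf i (partial_tf j f) - partial_tf j (partial_tf i f)"
  have "norm D \<le> s * (norm (partial_tf i D) + norm (partial_tf j D))" if s: "0 < s" for s
  proof -
    let ?M = "segment_mean (s *\<^sub>R axis i 1)" and ?M' = "segment_mean (s *\<^sub>R axis j 1)"
    have M: "s *\<^sub>R partial_tf i (?M g) = g - translate (s *\<^sub>R axis i 1) g" "s *\<^sub>R partial_tf j (?M' g) = g - translate (s *\<^sub>R axis j 1) g" for g
      by (simp_all add: dir_deriv_segment_mean_self flip: dir_deriv_axis)
    have "s *\<^sub>R s *\<^sub>R ?M (?M' (partial_tf i (partial_tf j f))) = s *\<^sub>R partial_tf i (?M (s *\<^sub>R partial_tf j (?M' f)))"
      by (simp add: tf_scale partial_tf_segment_mean)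
    also have "\<dots> = (f - translate (s *\<^sub>R axis j 1) f) - translate (s *\<^sub>R axis i 1) (f - translate (s *\<^sub>R axis j 1) f)"
      unfolding M ..
    also have "\<dots> = (f - translate (s *\<^sub>R axis i 1) f) - translate (s *\<^sub>R axis j 1) (f - translate (s *\<^sub>R axis i 1) f)"
      by (simp add: tf_diff translate_translate add.commute)
    also have "\<dots> = s *\<^sub>R partial_tf j (?M' (s *\<^sub>R partial_tf i (?M f)))"
      unfolding M ..
    also have "\<dots> = s *\<^sub>R s *\<^sub>R ?M (?M' (partial_tf j (partial_tf i f)))"
      by (simp add: tf_scale partial_tf_segment_mean segment_mean_segment_mean)
    finally have "?M (?M' D) = 0"
      using s by (simp add: D_def tf_diff)
    then have "D = (D - ?M D) + ?M (D - ?M' D)"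
      by (simp add: tf_diff)
    then have "norm D \<le> norm (D - ?M D) + norm (?M (D - ?M' D))"
      using norm_triangle_ineq[of "D - ?M D" "?M (D - ?M' D)"] by simp
    also have "\<dots> \<le> norm (dir_deriv (s *\<^sub>R axis i 1) D) + norm (dir_deriv (s *\<^sub>R axis j 1) D)"
      by (intro add_mono order_trans[OF norm_segment_mean]; subst norm_minus_commute; rule norm_segment_mean_diff)
    finally show ?thesis
      using s by (simp add: dir_deriv_axis ring_distribs)
  qed
  then have "\<forall>s>0. norm D \<le> s * (norm (partial_tf i D) + norm (partial_tf j D))"
    by blast
  moreover have "((\<lambda>s. s * (norm (partial_tf i D) + norm (partial_tf j D))) \<longlongrightarrow> 0) (at_right 0)"
    by (auto intro!: tendsto_eq_intros)
  ultimately have "norm D \<le> 0"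
    by (intro tendsto_lowerbound[of _ 0 "at_right 0"]) (auto simp: eventually_at_filter)
  then show ?thesis
    by (simp add: D_def)
qed

subsection \<open>Test fields and their norms\<close>

definition supported_in :: "(real^'n::finite) set \<Rightarrow> 'n tf \<Rightarrow> bool" where
  "supported_in \<Omega> f \<longleftrightarrow> tsupport (fn f) \<subseteq> \<Omega>"

text \<open>Fields are families of scalar test functions, so the scalar operators and the inner
  product act on them componentwise.\<close>

definition vector_field :: "('n \<Rightarrow> 'n::finite tf) \<Rightarrow> real^'n \<Rightarrow> real^'n" where
  "vector_field F x = (\<chi> k. fn (F k) x)"

definition div_field :: "('n \<Rightarrow> 'n::finite tf) \<Rightarrow> 'n tf" where
  "div_field F = (\<Sum>i\<in>UNIV. partial_tf i (F i))"

definition h1_size :: "'n::finite tf \<Rightarrow> real" where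
  "h1_size f = sqrt ((norm f)\<^sup>2 + (\<Sum>i\<in>UNIV. (norm (partial_tf i f))\<^sup>2))"

text \<open>The formal adjoint of a curl component: pairing a functional with this field pairs
  component \<open>p\<close> of its distributional curl with \<open>f\<close>, as
  \<open>curl_comp_fn\<close> records.\<close>

definition curl_field :: "'n \<times> 'n \<Rightarrow> 'n::finite tf \<Rightarrow> 'n \<Rightarrow> 'n tf" where
  "curl_field p f k = (if k = fst p then partial_tf (snd p) f else if k = snd p then - partial_tf (fst p) f else 0)"

lemma closed_tsupport: "closed (tsupport f)"
  by (simp add: tsupport_def)

lemma supported_inI:
  assumes "closed K" "K \<subseteq> \<Omega>" "\<And>x. fn f x \<noteq> 0 \<Longrightarrow> x \<in> K"
  shows "supported_in \<Omega> f"
  using tsupport_subset[OF assms(1), of "fn f"] assms unfolding supported_in_def by blast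

lemma supported_in_add:
  assumes "supported_in \<Omega> f" "supported_in \<Omega> g"
  shows "supported_in \<Omega> (f + g)"
proof (rule supported_inI[of "tsupport (fn f) \<union> tsupport (fn g)"])
  fix x assume "fn (f + g) x \<noteq> 0"
  then have "fn f x \<noteq> 0 \<or> fn g x \<noteq> 0"
    by auto
  then show "x \<in> tsupport (fn f) \<union> tsupport (fn g)"
    using in_tsupport[of "fn f" x] in_tsupport[of "fn g" x] by blast
qed (use assms closed_tsupport in \<open>auto simp: supported_in_def\<close>)

lemma supported_in_scale:
  assumes "supported_in \<Omega> f"
  shows "supported_in \<Omega> (r *\<^sub>R f)"
proof (rule supported_inI[of "tsupport (fn f)"])
  fix x assume "fn (r *\<^sub>R f) x \<noteq> 0"
  then show "x \<in> tsupport (fn f)"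
    by (intro in_tsupport) auto
qed (use assms closed_tsupport in \<open>auto simp: supported_in_def\<close>)

lemma supported_in_times_tf:
  assumes "supported_in \<Omega> f"
  shows "supported_in \<Omega> (times_tf \<phi> f)"
proof (rule supported_inI[of "tsupport (fn f)"])
  fix x assume "fn (times_tf \<phi> f) x \<noteq> 0"
  then show "x \<in> tsupport (fn f)"
    by (intro in_tsupport) (auto simp: fn_times_tf)
qed (use assms closed_tsupport in \<open>auto simp: supported_in_def\<close>)

lemma supported_in_0: "supported_in \<Omega> 0"
  by (rule supported_inI[of "{}"]) auto

lemma supported_in_uminus: "supported_in \<Omega> f \<Longrightarrow> supported_in \<Omega> (- f)"
  using supported_in_scale[of \<Omega> f "-1"] by simp

lemma supported_in_diff: "supported_in \<Omega> f \<Longrightarrow> supported_in \<Omega> g \<Longrightarrow> supported_in \<Omega> (f - g)"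
  using supported_in_add[OF _ supported_in_uminus, of \<Omega> f g] by simp

lemma supported_in_sum: "(\<And>i. i \<in> I \<Longrightarrow> supported_in \<Omega> (f i)) \<Longrightarrow> supported_in \<Omega> (sum f I)"
  by (induction I rule: infinite_finite_induct) (auto intro: supported_in_0 supported_in_add)

lemma supported_in_partial_tf: "supported_in \<Omega> f \<Longrightarrow> supported_in \<Omega> (partial_tf i f)"
proof -
  have "fn (partial_tf i f) = partial i (fn f)"
    by (auto simp: fn_partial_tf)
  then show "supported_in \<Omega> f \<Longrightarrow> supported_in \<Omega> (partial_tf i f)"
    using tsupport_partial[of i "fn f"] by (auto simp: supported_in_def)
qed

lemma supported_in_curl_field: "supported_in \<Omega> f \<Longrightarrow> supported_in \<Omega> (curl_field p f k)"
  by (auto simp: curl_field_def intro: supported_in_partial_tf supported_in_uminus supported_in_0)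

lemma supported_in_div_field: "(\<And>k. supported_in \<Omega> (F k)) \<Longrightarrow> supported_in \<Omega> (div_field F)"
  unfolding div_field_def by (intro supported_in_sum supported_in_partial_tf)

section \<open>Dual norms as inequalities for families of test functions\<close>

lemma test_fun_iff: "test_fun \<Omega> \<psi> \<longleftrightarrow> (\<exists>f. fn f = \<psi> \<and> supported_in \<Omega> f)"
proof
  assume "test_fun \<Omega> \<psi>"
  then have "fn (Tf \<psi>) = \<psi>" "tsupport \<psi> \<subseteq> \<Omega>"
    by (auto simp: test_fun_def Tf_inverse)
  then show "\<exists>f. fn f = \<psi> \<and> supported_in \<Omega> f"
    unfolding supported_in_def by metis
qed (auto simp: test_fun_def supported_in_def smooth_fn compact_fn)

lemma test_field_vector_field: "(\<And>k. supported_in \<Omega> (F k)) \<Longrightarrow> test_field \<Omega> (vector_field F)"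
  by (auto simp: test_field_def test_fun_iff vector_field_def)

lemma test_fieldE:
  assumes "test_field \<Omega> u"
  obtains F where "u = vector_field F" "\<And>k. supported_in \<Omega> (F k)"
proof -
  have "\<forall>k. \<exists>f. fn f = (\<lambda>x. u x $ k) \<and> supported_in \<Omega> f"
    using assms by (simp add: test_field_def test_fun_iff)
  then obtain F where F: "\<And>k. fn (F k) = (\<lambda>x. u x $ k)" "\<And>k. supported_in \<Omega> (F k)"
    by metis
  then have "u = vector_field F"
    by (auto simp: vector_field_def fun_eq_iff vec_eq_iff)
  with F that show thesis
    by blast
qed

lemma L2sq_fn:
  assumes "supported_in \<Omega> f"
  shows "L2sq \<Omega> (fn f) = (norm f)\<^sup>2"
proof -
  have "(\<lambda>x. if x \<in> \<Omega> then (fn f x)\<^sup>2 else 0) = (\<lambda>x. (fn f x)\<^sup>2)"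
    using assms in_tsupport[of "fn f"] by (auto simp: supported_in_def fun_eq_iff)
  then have "L2sq \<Omega> (fn f) = integral UNIV (\<lambda>x. (fn f x)\<^sup>2)"
    unfolding L2sq_def by (metis integral_restrict_UNIV)
  then show ?thesis
    unfolding power2_norm_eq_inner inner_tf_def by (simp add: power2_eq_square)
qed

lemma partial_fn: "partial i (fn f) = fn (partial_tf i f)"
  by (auto simp: fn_partial_tf)

lemma h1_norm_fn: "supported_in \<Omega> f \<Longrightarrow> h1_norm \<Omega> (fn f) = h1_size f"
  by (simp add: h1_norm_def h1_size_def partial_fn L2sq_fn supported_in_partial_tf)

lemma h1v_norm_vector_field: "(\<And>k. supported_in \<Omega> (F k)) \<Longrightarrow> h1v_norm \<Omega> (vector_field F) = L2_set (\<lambda>k. h1_size (F k)) UNIV"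
  by (simp add: h1v_norm_def vector_field_def h1_norm_fn L2_set_def)

lemma divg_vector_field: "divg (vector_field F) = fn (div_field F)"
  by (simp add: divg_def vector_field_def div_field_def fun_eq_iff fn_partial_tf)

lemma hdiv_norm_vector_field:
  "(\<And>k. supported_in \<Omega> (F k)) \<Longrightarrow> hdiv_norm \<Omega> (vector_field F) = sqrt ((\<Sum>k\<in>UNIV. (norm (F k))\<^sup>2) + (norm (div_field F))\<^sup>2)"
  by (simp add: hdiv_norm_def divg_vector_field L2sq_fn supported_in_div_field) (simp add: vector_field_def L2sq_fn)

lemma curl_comp_fn: "curl_comp T p (fn f) = T (vector_field (curl_field p f))"
proof -
  have "(\<lambda>x. \<chi> k. if k = fst p then partial (snd p) (fn f) x
      else if k = snd p then - partial (fst p) (fn f) x else 0) = vector_field (curl_field p f)"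
    by (auto simp: vector_field_def curl_field_def fun_eq_iff vec_eq_iff partial_fn)
  then show ?thesis
    by (simp add: curl_comp_def)
qed

lemma lin_on_tests_vector_field:
  assumes "lin_on_tests \<Omega> T" "\<And>k. supported_in \<Omega> (F k)" "\<And>k. supported_in \<Omega> (G k)"
  shows "T (vector_field (\<lambda>k. F k + G k)) = T (vector_field F) + T (vector_field G)"
    and "T (vector_field (\<lambda>k. r *\<^sub>R F k)) = r * T (vector_field F)"
proof -
  have *: "T (\<lambda>x. a *\<^sub>R vector_field F x + b *\<^sub>R vector_field G x) = a * T (vector_field F) + b * T (vector_field G)" for a b
    using assms test_field_vector_field unfolding lin_on_tests_def by blast
  have "vector_field (\<lambda>k. F k + G k) = (\<lambda>x. 1 *\<^sub>R vector_field F x + 1 *\<^sub>R vector_field G x)"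
    "vector_field (\<lambda>k. r *\<^sub>R F k) = (\<lambda>x. r *\<^sub>R vector_field F x + 0 *\<^sub>R vector_field G x)"
    by (auto simp: vector_field_def fun_eq_iff vec_eq_iff)
  then show "T (vector_field (\<lambda>k. F k + G k)) = T (vector_field F) + T (vector_field G)" "T (vector_field (\<lambda>k. r *\<^sub>R F k)) = r * T (vector_field F)"
    using *[of 1 1] *[of r 0] by simp_all
qed

lemma lin_on_tests_sum:
  assumes "lin_on_tests \<Omega> T" "finite I" "\<And>i k. i \<in> I \<Longrightarrow> supported_in \<Omega> (F i k)"
  shows "T (vector_field (\<lambda>k. \<Sum>i\<in>I. F i k)) = (\<Sum>i\<in>I. T (vector_field (F i)))"
  using assms(2,3)
proof (induction I)
  case empty
  have "T (vector_field (\<lambda>k. 0 *\<^sub>R 0)) = 0 * T (vector_field (\<lambda>k. 0))"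
    by (rule lin_on_tests_vector_field(2)[OF assms(1)]) (auto intro: supported_in_0)
  then show ?case
    by simp
next
  case (insert i I)
  then show ?case
    by (simp add: lin_on_tests_vector_field(1)[OF assms(1)] supported_in_sum)
qed

text \<open>Passage from the unit ball to arbitrary vectors by homogeneity. Scaling by 1 / (q + d)
  with a small d > 0 also covers q = 0, where dividing by the norm is impossible.\<close>

lemma scaled_bound:
  fixes t q \<alpha> :: real
  assumes "\<And>r. 0 < r \<Longrightarrow> r * q \<le> 1 \<Longrightarrow> r * t \<le> \<alpha>" "0 \<le> q" "0 \<le> \<alpha>"
  shows "t \<le> \<alpha> * q"
proof (rule field_le_epsilon)
  fix e :: real assume e: "0 < e"
  define d where "d = e / (\<alpha> + 1)"
  have d: "0 < d" "\<alpha> * d \<le> e"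
    using e assms(3) by (auto simp: d_def field_simps)
  have "1 / (q + d) * t \<le> \<alpha>"
    using d assms(2) by (intro assms(1)) (auto simp: field_simps)
  then have "t \<le> \<alpha> * (q + d)"
    using d assms(2) by (simp add: field_simps)
  with d show "t \<le> \<alpha> * q + e"
    by (simp add: ring_distribs)
qed

lemma h1_size_scale: "h1_size (r *\<^sub>R f) = \<bar>r\<bar> * h1_size f"
  by (simp add: h1_size_def tf_scale power_mult_distrib real_sqrt_mult flip: sum_distrib_left distrib_left)

lemma h1_size_nonneg: "0 \<le> h1_size f"
  by (simp add: h1_size_def sum_nonneg)

lemma L2_set_scale: "0 \<le> r \<Longrightarrow> L2_set (\<lambda>k. r * f k) A = r * L2_set f A"
  by (simp add: L2_set_right_distrib)

lemma div_field_scale: "div_field (\<lambda>k. r *\<^sub>R F k) = r *\<^sub>R div_field F"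
  by (simp add: div_field_def tf_scale scaleR_sum_right)

text \<open>Homogeneity turns the supremum over the unit ball into an inequality between reals. All
  estimates use the dual norms in this form, with \<open>\<alpha>\<close> a finite upper
  bound.\<close>

lemma hm1_norm_le_iff:
  fixes \<Omega> :: "(real^'n::finite) set"
  assumes T: "lin_on_tests \<Omega> T" and \<alpha>: "0 \<le> \<alpha>"
  shows "hm1_norm \<Omega> T \<le> ereal \<alpha> \<longleftrightarrow>
    (\<forall>F. (\<forall>k. supported_in \<Omega> (F k)) \<longrightarrow> \<bar>T (vector_field F)\<bar> \<le> \<alpha> * L2_set (\<lambda>k. h1_size (F k)) UNIV)" (is "?l \<longleftrightarrow> ?r")
proof
  assume l: ?l
  show ?r
  proof (intro allI impI)
    fix F :: "'n \<Rightarrow> 'n tf" assume F: "\<forall>k. supported_in \<Omega> (F k)"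
    show "\<bar>T (vector_field F)\<bar> \<le> \<alpha> * L2_set (\<lambda>k. h1_size (F k)) UNIV"
    proof (rule scaled_bound)
      fix r :: real assume r: "0 < r" "r * L2_set (\<lambda>k. h1_size (F k)) UNIV \<le> 1"
      let ?u = "vector_field (\<lambda>k. r *\<^sub>R F k)"
      have "test_field \<Omega> ?u \<and> h1v_norm \<Omega> ?u \<le> 1"
        using F r by (simp add: test_field_vector_field supported_in_scale h1v_norm_vector_field h1_size_scale L2_set_scale)
      then have "ereal \<bar>T ?u\<bar> \<le> ereal \<alpha>"
        using l unfolding hm1_norm_def SUP_le_iff by blast
      moreover have "T ?u = r * T (vector_field F)"
        using F by (intro lin_on_tests_vector_field(2)[OF T]) auto
      ultimately show "r * \<bar>T (vector_field F)\<bar> \<le> \<alpha>"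
        using r by (simp add: abs_mult)
    qed (use \<alpha> in auto)
  qed
next
  assume r: ?r
  show ?l
    unfolding hm1_norm_def
  proof (rule SUP_least)
    fix u :: "real^'n \<Rightarrow> real^'n" assume u: "u \<in> {u. test_field \<Omega> u \<and> h1v_norm \<Omega> u \<le> 1}"
    then obtain F where F: "u = vector_field F" "\<And>k. supported_in \<Omega> (F k)"
      using test_fieldE by blast
    have "\<bar>T u\<bar> \<le> \<alpha> * L2_set (\<lambda>k. h1_size (F k)) UNIV"
      using r F by simp
    also have "\<dots> \<le> \<alpha> * 1"
      using u F \<alpha> by (intro mult_left_mono) (auto simp: h1v_norm_vector_field)
    finally show "ereal \<bar>T u\<bar> \<le> ereal \<alpha>"
      by simp
  qed
qed

lemma hdiv_dual_norm_le_iff: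
  fixes \<Omega> :: "(real^'n::finite) set"
  assumes T: "lin_on_tests \<Omega> T" and \<alpha>: "0 \<le> \<alpha>"
  shows "hdiv_dual_norm \<Omega> T \<le> ereal \<alpha> \<longleftrightarrow>
    (\<forall>F. (\<forall>k. supported_in \<Omega> (F k)) \<longrightarrow> \<bar>T (vector_field F)\<bar> \<le> \<alpha> * sqrt ((\<Sum>k\<in>UNIV. (norm (F k))\<^sup>2) + (norm (div_field F))\<^sup>2))"
    (is "?l \<longleftrightarrow> ?r")
proof
  assume l: ?l
  show ?r
  proof (intro allI impI)
    fix F :: "'n \<Rightarrow> 'n tf" assume F: "\<forall>k. supported_in \<Omega> (F k)"
    show "\<bar>T (vector_field F)\<bar> \<le> \<alpha> * sqrt ((\<Sum>k\<in>UNIV. (norm (F k))\<^sup>2) + (norm (div_field F))\<^sup>2)"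
    proof (rule scaled_bound)
      fix r :: real assume r: "0 < r" "r * sqrt ((\<Sum>k\<in>UNIV. (norm (F k))\<^sup>2) + (norm (div_field F))\<^sup>2) \<le> 1"
      let ?u = "vector_field (\<lambda>k. r *\<^sub>R F k)"
      have "sqrt ((\<Sum>k\<in>UNIV. (norm (r *\<^sub>R F k))\<^sup>2) + (norm (div_field (\<lambda>k. r *\<^sub>R F k)))\<^sup>2) =
          r * sqrt ((\<Sum>k\<in>UNIV. (norm (F k))\<^sup>2) + (norm (div_field F))\<^sup>2)"
        using r by (simp add: div_field_scale power_mult_distrib real_sqrt_mult flip: sum_distrib_left distrib_left)
      then have "test_field \<Omega> ?u \<and> hdiv_norm \<Omega> ?u \<le> 1"
        using F r by (simp add: test_field_vector_field supported_in_scale hdiv_norm_vector_field)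
      then have "ereal \<bar>T ?u\<bar> \<le> ereal \<alpha>"
        using l unfolding hdiv_dual_norm_def SUP_le_iff by blast
      moreover have "T ?u = r * T (vector_field F)"
        using F by (intro lin_on_tests_vector_field(2)[OF T]) auto
      ultimately show "r * \<bar>T (vector_field F)\<bar> \<le> \<alpha>"
        using r by (simp add: abs_mult)
    qed (use \<alpha> in \<open>auto intro!: add_nonneg_nonneg sum_nonneg\<close>)
  qed
next
  assume r: ?r
  show ?l
    unfolding hdiv_dual_norm_def
  proof (rule SUP_least)
    fix u :: "real^'n \<Rightarrow> real^'n" assume u: "u \<in> {u. test_field \<Omega> u \<and> hdiv_norm \<Omega> u \<le> 1}"
    then obtain F where F: "u = vector_field F" "\<And>k. supported_in \<Omega> (F k)"
      using test_fieldE by blast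
    have "\<bar>T u\<bar> \<le> \<alpha> * sqrt ((\<Sum>k\<in>UNIV. (norm (F k))\<^sup>2) + (norm (div_field F))\<^sup>2)"
      using r F by simp
    also have "\<dots> \<le> \<alpha> * 1"
      using u F \<alpha> by (intro mult_left_mono) (auto simp: hdiv_norm_vector_field)
    finally show "ereal \<bar>T u\<bar> \<le> ereal \<alpha>"
      by simp
  qed
qed

lemma curl_hm1_norm_le_iff:
  fixes \<Omega> :: "((real, 'n::{finite,linorder}) vec) set"
  assumes T: "lin_on_tests \<Omega> T" and \<alpha>: "0 \<le> \<alpha>"
  shows "curl_hm1_norm \<Omega> T \<le> ereal \<alpha> \<longleftrightarrow>
    (\<forall>\<Psi>. (\<forall>p\<in>curl_idx. supported_in \<Omega> (\<Psi> p)) \<longrightarrow>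
      \<bar>\<Sum>p\<in>curl_idx. T (vector_field (curl_field p (\<Psi> p)))\<bar> \<le> \<alpha> * L2_set (\<lambda>p. h1_size (\<Psi> p)) curl_idx)"
    (is "?l \<longleftrightarrow> ?r")
proof
  assume l: ?l
  show ?r
  proof (intro allI impI)
    fix \<Psi> :: "'n \<times> 'n \<Rightarrow> 'n tf" assume \<Psi>: "\<forall>p\<in>curl_idx. supported_in \<Omega> (\<Psi> p)"
    show "\<bar>\<Sum>p\<in>curl_idx. T (vector_field (curl_field p (\<Psi> p)))\<bar> \<le> \<alpha> * L2_set (\<lambda>p. h1_size (\<Psi> p)) curl_idx"
    proof (rule scaled_bound)
      fix r :: real assume r: "0 < r" "r * L2_set (\<lambda>p. h1_size (\<Psi> p)) curl_idx \<le> 1"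
      let ?\<psi> = "\<lambda>p. fn (r *\<^sub>R \<Psi> p)"
      have "(\<forall>p\<in>curl_idx. test_fun \<Omega> (?\<psi> p))"
        using \<Psi> supported_in_scale unfolding test_fun_iff by blast
      moreover have "sqrt (\<Sum>p\<in>curl_idx. (h1_norm \<Omega> (?\<psi> p))\<^sup>2) = L2_set (\<lambda>p. r * h1_size (\<Psi> p)) curl_idx"
        unfolding L2_set_def using \<Psi> r
        by (intro arg_cong[where f = sqrt] sum.cong) (auto simp: h1_norm_fn supported_in_scale h1_size_scale)
      then have "sqrt (\<Sum>p\<in>curl_idx. (h1_norm \<Omega> (?\<psi> p))\<^sup>2) \<le> 1"
        using r by (simp only: L2_set_scale)
      ultimately have "?\<psi> \<in> {\<psi>. (\<forall>p\<in>curl_idx. test_fun \<Omega> (\<psi> p)) \<and>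
            sqrt (\<Sum>p\<in>curl_idx. (h1_norm \<Omega> (\<psi> p))\<^sup>2) \<le> 1}"
        by blast
      with l have "ereal \<bar>\<Sum>p\<in>curl_idx. curl_comp T p (?\<psi> p)\<bar> \<le> ereal \<alpha>"
        unfolding curl_hm1_norm_def SUP_le_iff by (rule bspec)
      moreover have "curl_comp T p (?\<psi> p) = r * T (vector_field (curl_field p (\<Psi> p)))" if "p \<in> curl_idx" for p
      proof -
        have "curl_field p (r *\<^sub>R \<Psi> p) = (\<lambda>k. r *\<^sub>R curl_field p (\<Psi> p) k)"
          by (auto simp: curl_field_def fun_eq_iff tf_scale)
        then show ?thesis
          using \<Psi> that lin_on_tests_vector_field(2)[OF T, of "curl_field p (\<Psi> p)" "curl_field p (\<Psi> p)" r]
          by (simp add: curl_comp_fn supported_in_curl_field)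
      qed
      ultimately show "r * \<bar>\<Sum>p\<in>curl_idx. T (vector_field (curl_field p (\<Psi> p)))\<bar> \<le> \<alpha>"
        using r by (simp add: abs_mult flip: sum_distrib_left)
    qed (use \<alpha> in auto)
  qed
next
  assume r: ?r
  show ?l
    unfolding curl_hm1_norm_def
  proof (rule SUP_least)
    fix \<psi> :: "'n \<times> 'n \<Rightarrow> (real, 'n) vec \<Rightarrow> real"
    assume \<psi>: "\<psi> \<in> {\<psi>. (\<forall>p\<in>curl_idx. test_fun \<Omega> (\<psi> p)) \<and>
            sqrt (\<Sum>p\<in>curl_idx. (h1_norm \<Omega> (\<psi> p))\<^sup>2) \<le> 1}"
    then have "\<forall>p\<in>curl_idx. \<exists>f. fn f = \<psi> p \<and> supported_in \<Omega> f"
      by (simp add: test_fun_iff)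
    then obtain \<Psi> where \<Psi>: "\<And>p. p \<in> curl_idx \<Longrightarrow> fn (\<Psi> p) = \<psi> p" "\<And>p. p \<in> curl_idx \<Longrightarrow> supported_in \<Omega> (\<Psi> p)"
      by metis
    have "(\<Sum>p\<in>curl_idx. curl_comp T p (\<psi> p)) = (\<Sum>p\<in>curl_idx. T (vector_field (curl_field p (\<Psi> p))))"
      by (intro sum.cong) (auto simp: curl_comp_fn simp flip: \<Psi>(1))
    then have "\<bar>\<Sum>p\<in>curl_idx. curl_comp T p (\<psi> p)\<bar> \<le> \<alpha> * L2_set (\<lambda>p. h1_size (\<Psi> p)) curl_idx"
      using r \<Psi> by simp
    also have "L2_set (\<lambda>p. h1_size (\<Psi> p)) curl_idx = sqrt (\<Sum>p\<in>curl_idx. (h1_norm \<Omega> (\<psi> p))\<^sup>2)"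
      unfolding L2_set_def by (intro arg_cong[where f = sqrt] sum.cong) (auto simp: h1_norm_fn \<Psi>(2) simp flip: \<Psi>(1))
    also have "\<alpha> * \<dots> \<le> \<alpha> * 1"
      using \<psi> \<alpha> by (intro mult_left_mono) auto
    finally show "ereal \<bar>\<Sum>p\<in>curl_idx. curl_comp T p (\<psi> p)\<bar> \<le> ereal \<alpha>"
      by simp
  qed
qed

lemma norm_le_h1_size: "norm f \<le> h1_size f" and norm_partial_tf_le_h1_size: "norm (partial_tf i f) \<le> h1_size f"
proof -
  show "norm f \<le> h1_size f"
    unfolding h1_size_def by (rule real_le_rsqrt) (simp add: sum_nonneg)
  have "(norm (partial_tf i f))\<^sup>2 \<le> (\<Sum>i\<in>UNIV. (norm (partial_tf i f))\<^sup>2)"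
    by (rule member_le_sum) auto
  then show "norm (partial_tf i f) \<le> h1_size f"
    unfolding h1_size_def by (intro real_le_rsqrt add_increasing) auto
qed

lemma h1_size_le: "h1_size f \<le> norm f + (\<Sum>i\<in>UNIV. norm (partial_tf i f))"
proof -
  have "h1_size f \<le> sqrt ((norm f)\<^sup>2) + sqrt (\<Sum>i\<in>UNIV. (norm (partial_tf i f))\<^sup>2)"
    unfolding h1_size_def by (rule sqrt_add_le_add_sqrt) (auto intro: sum_nonneg)
  also have "sqrt (\<Sum>i\<in>UNIV. (norm (partial_tf i f))\<^sup>2) \<le> (\<Sum>i\<in>UNIV. norm (partial_tf i f))"
    using L2_set_le_sum[of UNIV "\<lambda>i. norm (partial_tf i f)"] by (simp add: L2_set_def)
  finally show ?thesis
    by simp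
qed

subsection \<open>The dual norm of \<open>H\<^sub>0(div)\<close> dominates\<close>

lemma div_field_curl_field:
  assumes "fst p \<noteq> snd p"
  shows "div_field (curl_field p f) = 0"
proof -
  have "partial_tf k (curl_field p f k) = (if k = fst p then partial_tf (fst p) (partial_tf (snd p) f) else 0)
      + (if k = snd p then - partial_tf (snd p) (partial_tf (fst p) f) else 0)" for k
    using assms by (auto simp: curl_field_def tf_0 tf_neg)
  then show ?thesis
    by (simp add: div_field_def sum.distrib partial_tf_commute)
qed

lemma norm_curl_field: "norm (curl_field p f k) \<le> h1_size f"
  by (auto simp: curl_field_def norm_partial_tf_le_h1_size h1_size_nonneg)

lemma hdiv_sqrt_le: "sqrt ((\<Sum>k\<in>UNIV. (norm (F k))\<^sup>2) + (norm (div_field F))\<^sup>2) \<le> (\<Sum>k\<in>UNIV. norm (F k)) + norm (div_field F)"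
proof -
  have "sqrt ((\<Sum>k\<in>UNIV. (norm (F k))\<^sup>2) + (norm (div_field F))\<^sup>2) \<le> L2_set (\<lambda>k. norm (F k)) UNIV + sqrt ((norm (div_field F))\<^sup>2)"
    unfolding L2_set_def by (rule sqrt_add_le_add_sqrt) (auto intro: sum_nonneg)
  also have "L2_set (\<lambda>k. norm (F k)) UNIV \<le> (\<Sum>k\<in>UNIV. norm (F k))"
    by (rule L2_set_le_sum) auto
  finally show ?thesis
    by simp
qed

lemma hdiv_sqrt_ge:
  fixes F :: "'n \<Rightarrow> 'n::finite tf"
  shows "(\<Sum>k\<in>UNIV. norm (F k)) + norm (div_field F) \<le> (real CARD('n) + 1) * sqrt ((\<Sum>k\<in>UNIV. (norm (F k))\<^sup>2) + (norm (div_field F))\<^sup>2)"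
proof -
  let ?s = "sqrt ((\<Sum>k\<in>UNIV. (norm (F k))\<^sup>2) + (norm (div_field F))\<^sup>2)"
  have "norm (F k) \<le> ?s" for k
  proof (rule real_le_rsqrt)
    have "(norm (F k))\<^sup>2 \<le> (\<Sum>k\<in>UNIV. (norm (F k))\<^sup>2)"
      by (rule member_le_sum) auto
    then show "(norm (F k))\<^sup>2 \<le> (\<Sum>k\<in>UNIV. (norm (F k))\<^sup>2) + (norm (div_field F))\<^sup>2"
      by (rule order_trans) simp
  qed
  then have "(\<Sum>k\<in>UNIV. norm (F k)) \<le> real CARD('n) * ?s"
    by (intro sum_bounded_above) auto
  moreover have "norm (div_field F) \<le> ?s"
    by (rule real_le_rsqrt) (simp add: sum_nonneg)
  ultimately show ?thesis
    by (simp add: ring_distribs)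
qed

lemma dual_norm_dominates:
  fixes \<Omega> :: "((real, 'n::{finite,linorder}) vec) set"
  shows "\<exists>C>0. \<forall>T \<alpha>. lin_on_tests \<Omega> T \<longrightarrow> 0 \<le> \<alpha> \<longrightarrow> hdiv_dual_norm \<Omega> T \<le> ereal \<alpha> \<longrightarrow>
    hm1_norm \<Omega> T \<le> ereal (C * \<alpha>) \<and> curl_hm1_norm \<Omega> T \<le> ereal (C * \<alpha>)"
proof -
  let ?d = "real CARD('n)" and ?P = "real (card (curl_idx :: ('n \<times> 'n) set))"
  \<comment> \<open>The first summand serves the H^{-1} norm: the component norms together, and the
    divergence, are each at most \<open>?d\<close> times the H^1 norm. The second serves the curl:
    \<open>?d\<close> components, each a sum of \<open>?P\<close> terms, and zero
    divergence.\<close>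
  define C where "C = 2 * ?d + ?d * ?P"
  have d: "0 < ?d"
    by simp
  have C: "0 < C" "2 * ?d \<le> C" "?d * ?P \<le> C"
    unfolding C_def using d by (auto intro: add_pos_nonneg)
  have "hm1_norm \<Omega> T \<le> ereal (C * \<alpha>) \<and> curl_hm1_norm \<Omega> T \<le> ereal (C * \<alpha>)"
    if T: "lin_on_tests \<Omega> T" and \<alpha>: "0 \<le> \<alpha>" and le: "hdiv_dual_norm \<Omega> T \<le> ereal \<alpha>" for T \<alpha>
  proof
    have bd: "\<bar>T (vector_field F)\<bar> \<le> \<alpha> * ((\<Sum>k\<in>UNIV. norm (F k)) + norm (div_field F))" if "\<forall>k. supported_in \<Omega> (F k)" for F
    proof -
      have "\<bar>T (vector_field F)\<bar> \<le> \<alpha> * sqrt ((\<Sum>k\<in>UNIV. (norm (F k))\<^sup>2) + (norm (div_field F))\<^sup>2)"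
        using le that unfolding hdiv_dual_norm_le_iff[OF T \<alpha>] by blast
      also have "\<dots> \<le> \<alpha> * ((\<Sum>k\<in>UNIV. norm (F k)) + norm (div_field F))"
        by (rule mult_left_mono[OF hdiv_sqrt_le \<alpha>])
      finally show ?thesis .
    qed
    have C\<alpha>: "0 \<le> C * \<alpha>"
      using C \<alpha> by simp
    show "hm1_norm \<Omega> T \<le> ereal (C * \<alpha>)"
      unfolding hm1_norm_le_iff[OF T C\<alpha>]
    proof (intro allI impI)
      fix F :: "'n \<Rightarrow> 'n tf" assume F: "\<forall>k. supported_in \<Omega> (F k)"
      let ?L = "L2_set (\<lambda>k. h1_size (F k)) UNIV"
      have L: "h1_size (F k) \<le> ?L" for k
        by (rule member_le_L2_set) auto
      have "norm (div_field F) \<le> (\<Sum>k\<in>UNIV. norm (partial_tf k (F k)))"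
        unfolding div_field_def by (rule norm_sum)
      also have "\<dots> \<le> ?d * ?L"
        by (intro sum_bounded_above order_trans[OF norm_partial_tf_le_h1_size L])
      finally have 1: "norm (div_field F) \<le> ?d * ?L" .
      have 2: "(\<Sum>k\<in>UNIV. norm (F k)) \<le> ?d * ?L"
        by (intro sum_bounded_above order_trans[OF norm_le_h1_size L])
      have "\<bar>T (vector_field F)\<bar> \<le> \<alpha> * (?d * ?L + ?d * ?L)"
        using bd[OF F] by (rule order_trans) (intro mult_left_mono add_mono 1 2 \<alpha>)
      also have "\<dots> = (2 * ?d) * (\<alpha> * ?L)"
        by simp
      also have "\<dots> \<le> C * (\<alpha> * ?L)"
        using C \<alpha> by (intro mult_right_mono) auto
      finally show "\<bar>T (vector_field F)\<bar> \<le> C * \<alpha> * ?L"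
        by (simp add: mult.assoc)
    qed
    show "curl_hm1_norm \<Omega> T \<le> ereal (C * \<alpha>)"
      unfolding curl_hm1_norm_le_iff[OF T C\<alpha>]
    proof (intro allI impI)
      fix \<Psi> :: "'n \<times> 'n \<Rightarrow> 'n tf" assume \<Psi>: "\<forall>p\<in>curl_idx. supported_in \<Omega> (\<Psi> p)"
      let ?L = "L2_set (\<lambda>p. h1_size (\<Psi> p)) curl_idx"
      let ?F = "\<lambda>k. \<Sum>p\<in>curl_idx. curl_field p (\<Psi> p) k"
      have "div_field ?F = (\<Sum>p\<in>curl_idx. div_field (curl_field p (\<Psi> p)))"
        unfolding div_field_def tf_sum by (rule sum.swap)
      also have "\<dots> = 0"
        by (intro sum.neutral ballI div_field_curl_field) (auto simp: curl_idx_def)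
      finally have 1: "div_field ?F = 0" .
      have "norm (?F k) \<le> ?P * ?L" for k
      proof -
        have "norm (?F k) \<le> (\<Sum>p\<in>curl_idx. norm (curl_field p (\<Psi> p) k))"
          by (rule norm_sum)
        also have "\<dots> \<le> ?P * ?L"
        proof (rule sum_bounded_above)
          fix p :: "'n \<times> 'n" assume "p \<in> curl_idx"
          then have "h1_size (\<Psi> p) \<le> ?L"
            by (intro member_le_L2_set[of curl_idx p "\<lambda>p. h1_size (\<Psi> p)"]) auto
          then show "norm (curl_field p (\<Psi> p) k) \<le> ?L"
            by (rule order_trans[OF norm_curl_field])
        qed
        finally show ?thesis .
      qed
      then have 2: "(\<Sum>k\<in>UNIV. norm (?F k)) \<le> ?d * (?P * ?L)"
        by (intro sum_bounded_above)
      have F: "\<forall>k. supported_in \<Omega> (?F k)"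
        using \<Psi> by (auto intro!: supported_in_sum supported_in_curl_field)
      have "(\<Sum>p\<in>curl_idx. T (vector_field (curl_field p (\<Psi> p)))) = T (vector_field ?F)"
        using \<Psi> by (intro lin_on_tests_sum[OF T, symmetric]) (auto intro: supported_in_curl_field)
      also have "\<bar>\<dots>\<bar> \<le> \<alpha> * (?d * (?P * ?L) + 0)"
        using bd[OF F] by (rule order_trans) (intro mult_left_mono add_mono 2 \<alpha>, simp add: 1)
      also have "\<dots> = (?d * ?P) * (\<alpha> * ?L)"
        by simp
      also have "\<dots> \<le> C * (\<alpha> * ?L)"
        using C \<alpha> by (intro mult_right_mono) auto
      finally show "\<bar>\<Sum>p\<in>curl_idx. T (vector_field (curl_field p (\<Psi> p)))\<bar> \<le> C * \<alpha> * ?L"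
        by (simp add: mult.assoc)
    qed
  qed
  with C(1) show ?thesis
    by blast
qed

subsection \<open>The local regular decomposition\<close>

text \<open>The constant is uniform in \<open>T\<close>. Localisation is imposed on the field and
  not on the functional, so local estimates can be patched by multiplying fields with
  cutoffs.\<close>

definition estimate_on :: "((real, 'n::{finite,linorder}) vec) set \<Rightarrow> ((real, 'n) vec) set \<Rightarrow> bool" where
  "estimate_on \<Omega> U \<longleftrightarrow> (\<exists>C\<ge>0. \<forall>T \<alpha> \<beta> F. lin_on_tests \<Omega> T \<longrightarrow> 0 \<le> \<alpha> \<longrightarrow> 0 \<le> \<beta> \<longrightarrow>
     hm1_norm \<Omega> T \<le> ereal \<alpha> \<longrightarrow> curl_hm1_norm \<Omega> T \<le> ereal \<beta> \<longrightarrow>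
     (\<forall>k. supported_in \<Omega> (F k)) \<longrightarrow> (\<forall>k y. y \<notin> U \<longrightarrow> fn (F k) y = 0) \<longrightarrow>
     \<bar>T (vector_field F)\<bar> \<le> C * (\<alpha> + \<beta>) * ((\<Sum>k\<in>UNIV. norm (F k)) + norm (div_field F)))"

text \<open>The ball takes the place of a bound on \<open>t\<close>: a displaced point must lie in
  the domain only if it has not left the ball. The reach of the operators can therefore be chosen
  afterwards.\<close>

definition cone_at :: "(real^'n::finite) set \<Rightarrow> real^'n \<Rightarrow> real \<Rightarrow> ('n \<Rightarrow> real^'n) \<Rightarrow> bool" where
  "cone_at \<Omega> x r a \<longleftrightarrow> (\<forall>y t. y \<in> \<Omega> \<inter> ball x r \<longrightarrow> (\<forall>k. 0 \<le> t k) \<longrightarrow>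
     y + (\<Sum>k\<in>UNIV. t k *\<^sub>R a k) \<in> ball x r \<longrightarrow> y + (\<Sum>k\<in>UNIV. t k *\<^sub>R a k) \<in> \<Omega>)"

lemma compact_box_cone: "compact (box_cone a \<tau>)"
proof -
  have "box_cone a \<tau> = (\<lambda>t. \<Sum>k\<in>UNIV. (t $ k) *\<^sub>R a k) ` cbox 0 (\<chi> k. \<tau>)"
  proof (intro set_eqI iffI)
    fix w assume "w \<in> box_cone a \<tau>"
    then obtain t where "w = (\<Sum>k\<in>UNIV. t k *\<^sub>R a k)" "\<forall>k. 0 \<le> t k \<and> t k \<le> \<tau>"
      by (auto simp: box_cone_def)
    then show "w \<in> (\<lambda>t. \<Sum>k\<in>UNIV. (t $ k) *\<^sub>R a k) ` cbox 0 (\<chi> k. \<tau>)"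
      by (intro image_eqI[of _ _ "\<chi> k. t k"]) (auto simp: mem_box_cart)
  qed (auto simp: box_cone_def mem_box_cart)
  then show ?thesis
    by (auto intro!: compact_continuous_image continuous_intros)
qed

lemma norm_box_cone:
  assumes "w \<in> box_cone a \<tau>"
  shows "norm w \<le> \<tau> * (\<Sum>k\<in>UNIV. norm (a k))"
proof -
  obtain t where t: "w = (\<Sum>k\<in>UNIV. t k *\<^sub>R a k)" "\<And>k. 0 \<le> t k \<and> t k \<le> \<tau>"
    using assms by (auto simp: box_cone_def)
  have "norm w \<le> (\<Sum>k\<in>UNIV. norm (t k *\<^sub>R a k))"
    unfolding t by (rule norm_sum)
  also have "\<dots> \<le> (\<Sum>k\<in>UNIV. \<tau> * norm (a k))"
    by (intro sum_mono) (simp add: t mult_right_mono)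
  finally show ?thesis
    by (simp add: sum_distrib_left)
qed

text \<open>A support within r/2 of \<open>x\<close>, moved by less than r/2, stays in the open ball
  of radius r, where the cone condition applies. Closed supports are reached because the sum of two
  compact sets is closed.\<close>

lemma adm_op_supported_in:
  assumes cone: "cone_at \<Omega> x r a" and r: "0 < r"
    and small: "\<And>w. w \<in> box_cone a \<tau> \<Longrightarrow> norm w < r / 2"
    and f: "supported_in \<Omega> f" "\<And>y. y \<notin> cball x (r / 2) \<Longrightarrow> fn f y = 0"
    and Y: "adm_op a \<tau> c Y"
  shows "supported_in \<Omega> (Y f)"
proof (rule supported_inI[of "{y + w |y w. y \<in> tsupport (fn f) \<and> w \<in> box_cone a \<tau>}"])
  show "closed {y + w |y w. y \<in> tsupport (fn f) \<and> w \<in> box_cone a \<tau>}"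
    by (intro compact_imp_closed compact_sums[OF compact_fn compact_box_cone])
  have "tsupport (fn f) \<subseteq> cball x (r / 2)"
    by (rule tsupport_subset[OF closed_cball]) (use f(2) in blast)
  show "{y + w |y w. y \<in> tsupport (fn f) \<and> w \<in> box_cone a \<tau>} \<subseteq> \<Omega>"
  proof clarify
    fix y w assume y: "y \<in> tsupport (fn f)" and w: "w \<in> box_cone a \<tau>"
    obtain t where t: "w = (\<Sum>k\<in>UNIV. t k *\<^sub>R a k)" "\<forall>k. 0 \<le> t k"
      using w by (auto simp: box_cone_def)
    have "dist x y \<le> r / 2"
      using y \<open>tsupport (fn f) \<subseteq> cball x (r / 2)\<close> by auto
    moreover have "dist y (y + w) < r / 2"
      using small[OF w] by (simp add: dist_norm)
    ultimately have "y \<in> ball x r" "y + w \<in> ball x r"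
      using r dist_triangle[of x "y + w" y] by auto
    then show "y + w \<in> \<Omega>"
      using cone t y f(1) unfolding cone_at_def supported_in_def by blast
  qed
  fix z assume "fn (Y f) z \<noteq> 0"
  then obtain y where "fn f y \<noteq> 0" "z - y \<in> box_cone a \<tau>"
    using Y unfolding adm_op_def spread_def by blast
  then show "z \<in> {y + w |y w. y \<in> tsupport (fn f) \<and> w \<in> box_cone a \<tau>}"
    using in_tsupport[of "fn f" y] by (intro CollectI exI[of _ y] exI[of _ "z - y"]) auto
qed

text \<open>Antisymmetry folds the entries below the diagonal onto those above it and kills the
  diagonal, so the pairs i < j carry the whole row-wise divergence. In dimension three such a
  \<open>\<psi>\<close> amounts to a vector potential.\<close>

lemma sum_curl_idx:
  fixes \<psi> :: "'n \<Rightarrow> 'n \<Rightarrow> 'n::{finite,linorder} tf"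
  assumes \<psi>: "\<And>i j. \<psi> j i = - \<psi> i j"
  shows "(\<Sum>p\<in>curl_idx. curl_field p (\<psi> (fst p) (snd p)) k) = (\<Sum>j\<in>UNIV. partial_tf j (\<psi> k j))"
proof -
  have \<psi>k: "partial_tf k (\<psi> k k) = 0"
  proof -
    have "2 *\<^sub>R \<psi> k k = 0"
      using \<psi>[of k k] by (simp add: scaleR_2 eq_neg_iff_add_eq_0)
    then show ?thesis
      by (simp add: tf_0)
  qed
  have neg: "- partial_tf i (\<psi> i k) = partial_tf i (\<psi> k i)" for i
    using \<psi>[of k i] by (simp add: tf_neg)
  have "(\<Sum>p\<in>curl_idx. curl_field p (\<psi> (fst p) (snd p)) k) = (\<Sum>p\<in>UNIV. if fst p < snd p then curl_field p (\<psi> (fst p) (snd p)) k else 0)"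
    unfolding curl_idx_def by (intro sum.mono_neutral_cong_left) auto
  also have "\<dots> = (\<Sum>i\<in>UNIV. \<Sum>j\<in>UNIV. if i < j then curl_field (i, j) (\<psi> i j) k else 0)"
    by (simp add: sum.cartesian_product case_prod_unfold cong: if_cong)
  also have "\<dots> = (\<Sum>i\<in>UNIV. \<Sum>j\<in>UNIV. (if i = k then if k < j then partial_tf j (\<psi> k j) else 0 else 0)
      + (if j = k then if i < k then partial_tf i (\<psi> k i) else 0 else 0))"
    by (intro sum.cong refl) (auto simp: curl_field_def neg)
  also have "\<dots> = (\<Sum>j\<in>UNIV. if k < j then partial_tf j (\<psi> k j) else 0) + (\<Sum>i\<in>UNIV. if i < k then partial_tf i (\<psi> k i) else 0)"
    by (simp add: sum.distrib) (subst sum.swap, simp)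
  also have "\<dots> = (\<Sum>j\<in>UNIV. partial_tf j (\<psi> k j))"
    unfolding sum.distrib[symmetric] by (intro sum.cong refl) (use \<psi>k in \<open>auto simp: not_less\<close>)
  finally show ?thesis .
qed

text \<open>An l^1 majorant of \<open>h1_size\<close>, which can be added up without square
  roots.\<close>

definition h1_sum :: "'n::finite tf \<Rightarrow> real" where
  "h1_sum f = norm f + (\<Sum>i\<in>UNIV. norm (partial_tf i f))"

lemma h1_sum_diff: "h1_sum (f - g) \<le> h1_sum f + h1_sum g"
proof -
  have "(\<Sum>i\<in>UNIV. norm (partial_tf i (f - g))) \<le> (\<Sum>i\<in>UNIV. norm (partial_tf i f) + norm (partial_tf i g))"
    by (intro sum_mono) (simp add: tf_diff norm_triangle_ineq4)
  then show ?thesis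
    using norm_triangle_ineq4[of f g] by (simp add: h1_sum_def sum.distrib)
qed

lemma h1_sum_le:
  fixes f :: "'n::finite tf"
  assumes "norm f \<le> p" "\<And>i. norm (partial_tf i f) \<le> q"
  shows "h1_sum f \<le> p + real CARD('n) * q"
  unfolding h1_sum_def using assms by (intro add_mono sum_bounded_above) auto

text \<open>With \<open>\<psi> i j = G j (F i) - G i (F j)\<close>, row k of the divergence of
  \<open>\<psi>\<close> is \<open>H \<epsilon> (F k) - H S (F k) - G k (div_field F)\<close>, since
  the \<open>G j\<close> commute with derivatives. Hence \<open>F\<close> is a smoothing error plus
  \<open>H S F\<close>, plus \<open>G\<close> applied to the divergence, plus a curl. The H^{-1}
  bound handles the first three, the bound on the curl of \<open>T\<close> the last.\<close>

lemma local_bound: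
  fixes \<Omega> :: "((real, 'n::{finite,linorder}) vec) set"
  assumes cone: "cone_at \<Omega> x r a" and r: "0 < r"
    and basis: "\<And>i. axis i 1 = (\<Sum>l\<in>UNIV. c i l *\<^sub>R a l)"
  shows "estimate_on \<Omega> (cball x (r / 2))"
proof -
  obtain C H where C: "0 \<le> C" and H: "\<forall>s\<ge>0. adm_op a (C * s) C (H s)"
    and lim: "\<forall>f. \<exists>K. \<forall>s\<ge>0. norm (H s f - f) \<le> K * s"
    and pdH: "\<forall>s\<ge>0. \<forall>i f. s * norm (partial_tf i (H s f)) \<le> C * norm f"
    and ex_G: "\<forall>S>0. \<forall>N. \<exists>G. (\<forall>j. adm_op a (C * S) (C * S) (G j)) \<and>
      (\<forall>i j f. norm (partial_tf i (G j f)) \<le> C * norm f) \<and>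
      (\<forall>f. H (S / 2^N) f - H S f = (\<Sum>j\<in>UNIV. partial_tf j (G j f)))"
    using homotopy[OF basis] by blast
  define n where "n = (\<Sum>k\<in>UNIV. norm (a k))"
  have n: "0 \<le> n"
    unfolding n_def by (simp add: sum_nonneg)
  \<comment> \<open>The operators reach at most C S n, which is r/2 times C n / (C n + 1) and so
    strictly less than r/2. The added 1 also keeps the denominator positive.\<close>
  define S where "S = r / (2 * (C * n + 1))"
  have Cn: "0 \<le> C * n"
    using C n by simp
  then have S: "0 < S"
    unfolding S_def using r by (intro divide_pos_pos mult_pos_pos) auto
  have small: "norm w < r / 2" if "w \<in> box_cone a (C * S)" for w
  proof -
    have "norm w \<le> C * S * n"
      using norm_box_cone[OF that] by (simp add: n_def)
    also have "\<dots> < r / 2"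
      using r Cn by (simp add: S_def field_simps)
    finally show ?thesis .
  qed
  obtain Kf where Kf: "\<And>f s. 0 \<le> s \<Longrightarrow> norm (H s f - f) \<le> Kf f * s"
    using lim by metis
  let ?d = "real CARD('n)" and ?P = "real (card (curl_idx :: ('n \<times> 'n) set))"
  \<comment> \<open>A common H^1 bound: \<open>C * S + ?d * C\<close> is needed for
    \<open>G j\<close>, and \<open>C + ?d * (C / S)\<close> for \<open>H S\<close>.\<close>
  define m where "m = C + C * S + ?d * C + ?d * (C / S)"
  have "0 \<le> C * S" "0 \<le> ?d * C" "0 \<le> ?d * (C / S)"
    using C S by auto
  then have m: "0 \<le> m" "C + ?d * (C / S) \<le> m" "C * S + ?d * C \<le> m"
    unfolding m_def using C by auto
  define D where "D = (1 + ?d + 2 * ?P) * m"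
  have D: "0 \<le> D" "m \<le> D" "?d * m \<le> D" "2 * ?P * m \<le> D"
    unfolding D_def using m(1) by (auto simp: ring_distribs)
  have "\<bar>T (vector_field F)\<bar> \<le> D * (\<alpha> + \<beta>) * ((\<Sum>k\<in>UNIV. norm (F k)) + norm (div_field F))"
    if T: "lin_on_tests \<Omega> T" and \<alpha>: "0 \<le> \<alpha>" and \<beta>: "0 \<le> \<beta>" and hm1: "hm1_norm \<Omega> T \<le> ereal \<alpha>"
      and curl: "curl_hm1_norm \<Omega> T \<le> ereal \<beta>" and F: "\<forall>k. supported_in \<Omega> (F k)"
      and supp: "\<forall>k y. y \<notin> cball x (r / 2) \<longrightarrow> fn (F k) y = 0" for T \<alpha> \<beta> F
  proof -
    let ?N = "\<Sum>k\<in>UNIV. norm (F k)"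
    have hm1': "\<bar>T (vector_field G)\<bar> \<le> \<alpha> * (\<Sum>k\<in>UNIV. h1_sum (G k))" if "\<And>k. supported_in \<Omega> (G k)" for G
    proof -
      have "\<bar>T (vector_field G)\<bar> \<le> \<alpha> * L2_set (\<lambda>k. h1_size (G k)) UNIV"
        using hm1 that unfolding hm1_norm_le_iff[OF T \<alpha>] by blast
      also have "\<dots> \<le> \<alpha> * (\<Sum>k\<in>UNIV. h1_size (G k))"
        by (intro mult_left_mono L2_set_le_sum h1_size_nonneg \<alpha>)
      also have "\<dots> \<le> \<alpha> * (\<Sum>k\<in>UNIV. h1_sum (G k))"
        unfolding h1_sum_def by (intro mult_left_mono sum_mono h1_size_le \<alpha>)
      finally show ?thesis .
    qed
    have curl': "\<bar>\<Sum>p\<in>curl_idx. T (vector_field (curl_field p (\<Psi> p)))\<bar> \<le> \<beta> * (\<Sum>p\<in>curl_idx. h1_sum (\<Psi> p))" if "\<And>p. supported_in \<Omega> (\<Psi> p)" for \<Psi>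
    proof -
      have "\<bar>\<Sum>p\<in>curl_idx. T (vector_field (curl_field p (\<Psi> p)))\<bar> \<le> \<beta> * L2_set (\<lambda>p. h1_size (\<Psi> p)) curl_idx"
        using curl that unfolding curl_hm1_norm_le_iff[OF T \<beta>] by blast
      also have "\<dots> \<le> \<beta> * (\<Sum>p\<in>curl_idx. h1_size (\<Psi> p))"
        by (intro mult_left_mono L2_set_le_sum h1_size_nonneg \<beta>)
      also have "\<dots> \<le> \<beta> * (\<Sum>p\<in>curl_idx. h1_sum (\<Psi> p))"
        unfolding h1_sum_def by (intro mult_left_mono sum_mono h1_size_le \<beta>)
      finally show ?thesis .
    qed
    have supp_div_field: "fn (div_field F) y = 0" if "y \<notin> cball x (r / 2)" for y
    proof -
      have *: "tsupport (fn (F k)) \<subseteq> cball x (r / 2)" for k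
        by (rule tsupport_subset[OF closed_cball]) (use supp in blast)
      have "fn (partial_tf k (F k)) y = 0" for k
        using order_trans[OF tsupport_partial[of k "fn (F k)"] *[of k]] in_tsupport[of "fn (partial_tf k (F k))" y] that
        unfolding partial_fn by blast
      then show ?thesis
        by (simp add: div_field_def)
    qed
    \<comment> \<open>This constant depends on \<open>F\<close> and its derivatives, so it may
      multiply nothing but the finest scale; \<open>D\<close> is fixed before \<open>T\<close>,
      \<open>F\<close> and that scale.\<close>
    define K where "K = (\<Sum>k\<in>UNIV. Kf (F k) + (\<Sum>i\<in>UNIV. Kf (partial_tf i (F k))))"
    let ?R = "D * (\<alpha> + \<beta>) * (?N + norm (div_field F))"
    have regroup: "k + (\<alpha> * (D * n) + (\<alpha> * (D * x) + \<beta> * (D * n))) \<le> k + D * (\<alpha> + \<beta>) * (n + x)"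
      if "0 \<le> \<beta> * (D * x)" for k n x :: real
      using that by (simp add: algebra_simps)
    have bound: "\<bar>T (vector_field F)\<bar> \<le> \<alpha> * (K * (S * (1 / 2) ^ M)) + ?R" for M
    proof -
      define \<epsilon> where "\<epsilon> = S / 2 ^ M"
      have \<epsilon>: "0 \<le> \<epsilon>" "\<epsilon> \<le> S"
        using S by (auto simp: \<epsilon>_def field_simps)
      obtain G where G: "\<And>j. adm_op a (C * S) (C * S) (G j)" "\<And>i j f. norm (partial_tf i (G j f)) \<le> C * norm f"
        "\<And>f. H \<epsilon> f - H S f = (\<Sum>j\<in>UNIV. partial_tf j (G j f))"
        using ex_G[rule_format, OF S, of M] unfolding \<epsilon>_def by blast
      have HS: "adm_op a (C * S) C (H S)"
        using H S by simp
      have He: "adm_op a (C * S) C (H \<epsilon>)"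
        using H \<epsilon> C by (auto intro: adm_op_mono mult_left_mono)
      have supported_in: "supported_in \<Omega> (Y (F k))" if "adm_op a (C * S) b Y" for Y b k
        using adm_op_supported_in[OF cone r small _ _ that] F supp by blast
      have nsG: "h1_sum (G j f) \<le> m * norm f" for j f
      proof -
        have "h1_sum (G j f) \<le> C * S * norm f + ?d * (C * norm f)"
          using G(1)[of j] G(2) by (intro h1_sum_le) (auto simp: adm_op_def)
        also have "\<dots> = (C * S + ?d * C) * norm f"
          by (simp add: ring_distribs)
        finally show ?thesis
          using mult_right_mono[OF m(3), of "norm f"] by simp
      qed
      have nsH: "h1_sum (H S f) \<le> m * norm f" for f
      proof -
        have "norm (partial_tf i (H S f)) \<le> C / S * norm f" for i
          using pdH S by (simp add: field_simps)
        then have "h1_sum (H S f) \<le> C * norm f + ?d * (C / S * norm f)"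
          using HS by (intro h1_sum_le) (auto simp: adm_op_def)
        also have "\<dots> = (C + ?d * (C / S)) * norm f"
          by (simp add: ring_distribs)
        finally show ?thesis
          using mult_right_mono[OF m(2), of "norm f"] by simp
      qed
      define \<psi> where "\<psi> i j = G j (F i) - G i (F j)" for i j
      define F1 where "F1 k = F k - H \<epsilon> (F k)" for k
      define F2 where "F2 k = H S (F k)" for k
      define F3 where "F3 k = G k (div_field F)" for k
      define F4 where "F4 k = (\<Sum>p\<in>curl_idx. curl_field p (\<psi> (fst p) (snd p)) k)" for k
      have supported_in\<psi>: "supported_in \<Omega> (\<psi> i j)" for i j
        unfolding \<psi>_def by (intro supported_in_diff supported_in[OF G(1)])
      have inn1: "supported_in \<Omega> (F1 k)" and inn2: "supported_in \<Omega> (F2 k)" and inn4: "supported_in \<Omega> (F4 k)" for k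
        unfolding F1_def F2_def F4_def using F by (auto intro!: supported_in_diff supported_in[OF He] supported_in[OF HS] supported_in_sum supported_in_curl_field supported_in\<psi>)
      have inn3: "supported_in \<Omega> (F3 k)" for k
        unfolding F3_def using F by (intro adm_op_supported_in[OF cone r small _ supp_div_field G(1)] supported_in_div_field) auto
      have decomp: "F k = F1 k + (F2 k + (F3 k + F4 k))" for k
      proof -
        have "F4 k = (\<Sum>j\<in>UNIV. partial_tf j (\<psi> k j))"
          unfolding F4_def by (rule sum_curl_idx) (simp add: \<psi>_def)
        also have "\<dots> = (\<Sum>j\<in>UNIV. partial_tf j (G j (F k))) - (\<Sum>j\<in>UNIV. partial_tf j (G k (F j)))"
          by (simp add: \<psi>_def tf_diff sum_subtractf)
        also have "(\<Sum>j\<in>UNIV. partial_tf j (G k (F j))) = F3 k"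
          using G(1)[of k] by (simp add: F3_def div_field_def adm_op_def conv_op_partial_tf conv_op_linear linear_sum)
        also have "(\<Sum>j\<in>UNIV. partial_tf j (G j (F k))) = H \<epsilon> (F k) - H S (F k)"
          by (simp add: G(3))
        finally show ?thesis
          by (simp add: F1_def F2_def)
      qed
      have T_eq: "T (vector_field F) = T (vector_field F1) + (T (vector_field F2) + (T (vector_field F3) + (\<Sum>p\<in>curl_idx. T (vector_field (curl_field p (\<psi> (fst p) (snd p)))))))"
      proof -
        have "T (vector_field F4) = (\<Sum>p\<in>curl_idx. T (vector_field (curl_field p (\<psi> (fst p) (snd p)))))"
          unfolding F4_def[abs_def] by (rule lin_on_tests_sum[OF T]) (auto intro: supported_in_curl_field supported_in\<psi>)
        moreover have "vector_field F = vector_field (\<lambda>k. F1 k + (F2 k + (F3 k + F4 k)))"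
          using decomp by metis
        ultimately show ?thesis
          by (simp add: lin_on_tests_vector_field(1)[OF T] inn1 inn2 inn3 inn4 supported_in_add)
      qed
      have 1: "\<bar>T (vector_field F1)\<bar> \<le> \<alpha> * (K * \<epsilon>)"
      proof -
        have "h1_sum (F1 k) \<le> (Kf (F k) + (\<Sum>i\<in>UNIV. Kf (partial_tf i (F k)))) * \<epsilon>" for k
        proof -
          \<comment> \<open>\<open>H \<epsilon>\<close> commutes with derivatives, so the L^2 rate
            applied to \<open>F k\<close> and to its partials gives a rate in H^1.\<close>
          have "partial_tf i (F1 k) = partial_tf i (F k) - H \<epsilon> (partial_tf i (F k))" for i
            using He by (simp add: F1_def tf_diff adm_op_def conv_op_partial_tf)
          then have "norm (partial_tf i (F1 k)) \<le> Kf (partial_tf i (F k)) * \<epsilon>" for i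
            using Kf[OF \<epsilon>(1), of "partial_tf i (F k)"] by (simp add: norm_minus_commute)
          moreover have "norm (F1 k) \<le> Kf (F k) * \<epsilon>"
            using Kf[OF \<epsilon>(1), of "F k"] by (simp add: F1_def norm_minus_commute)
          ultimately show ?thesis
            unfolding h1_sum_def ring_distribs sum_distrib_right by (intro add_mono sum_mono)
        qed
        then have "(\<Sum>k\<in>UNIV. h1_sum (F1 k)) \<le> K * \<epsilon>"
          unfolding K_def sum_distrib_right by (intro sum_mono)
        from order_trans[OF hm1'[of F1, OF inn1] mult_left_mono[OF this \<alpha>]] show ?thesis .
      qed
      have 2: "\<bar>T (vector_field F2)\<bar> \<le> \<alpha> * (D * ?N)"
      proof -
        have "(\<Sum>k\<in>UNIV. h1_sum (F2 k)) \<le> m * ?N"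
          unfolding F2_def sum_distrib_left by (intro sum_mono nsH)
        also have "\<dots> \<le> D * ?N"
          by (intro mult_right_mono D sum_nonneg) auto
        finally show ?thesis
          using order_trans[OF hm1'[of F2, OF inn2] mult_left_mono[OF _ \<alpha>]] by blast
      qed
      have 3: "\<bar>T (vector_field F3)\<bar> \<le> \<alpha> * (D * norm (div_field F))"
      proof -
        have "(\<Sum>k\<in>UNIV. h1_sum (F3 k)) \<le> ?d * (m * norm (div_field F))"
          unfolding F3_def by (intro sum_bounded_above nsG)
        also have "\<dots> \<le> D * norm (div_field F)"
          using mult_right_mono[OF D(3), of "norm (div_field F)"] by (simp add: mult.assoc)
        finally show ?thesis
          using order_trans[OF hm1'[of F3, OF inn3] mult_left_mono[OF _ \<alpha>]] by blast
      qed
      have 4: "\<bar>\<Sum>p\<in>curl_idx. T (vector_field (curl_field p (\<psi> (fst p) (snd p))))\<bar> \<le> \<beta> * (D * ?N)"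
      proof -
        have N: "norm (F k) \<le> ?N" for k
          by (rule member_le_sum) auto
        have "h1_sum (\<psi> i j) \<le> 2 * m * ?N" for i j
        proof -
          have "h1_sum (\<psi> i j) \<le> m * norm (F i) + m * norm (F j)"
            unfolding \<psi>_def by (rule order_trans[OF h1_sum_diff add_mono[OF nsG nsG]])
          also have "\<dots> \<le> m * ?N + m * ?N"
            by (intro add_mono mult_left_mono N m)
          finally show ?thesis
            by simp
        qed
        then have "(\<Sum>p\<in>curl_idx. h1_sum (\<psi> (fst p) (snd p))) \<le> ?P * (2 * m * ?N)"
          by (intro sum_bounded_above)
        also have "\<dots> = 2 * ?P * m * ?N"
          by simp
        also have "\<dots> \<le> D * ?N"
          by (intro mult_right_mono D sum_nonneg) auto
        finally show ?thesis
          using order_trans[OF curl'[of "\<lambda>p. \<psi> (fst p) (snd p)", OF supported_in\<psi>] mult_left_mono[OF _ \<beta>]] by blast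
      qed
      have "\<bar>T (vector_field F)\<bar> \<le> \<alpha> * (K * \<epsilon>) + (\<alpha> * (D * ?N) + (\<alpha> * (D * norm (div_field F)) + \<beta> * (D * ?N)))"
        unfolding T_eq using 1 2 3 4 by linarith
      also have "\<dots> \<le> \<alpha> * (K * \<epsilon>) + ?R"
        by (rule regroup, intro mult_nonneg_nonneg \<beta> D(1) norm_ge_zero)
      also have "\<epsilon> = S * (1 / 2) ^ M"
        by (simp add: \<epsilon>_def power_one_over)
      finally show ?thesis .
    qed
    have "(\<lambda>M. \<alpha> * (K * (S * (1 / 2) ^ M)) + ?R) \<longlonglongrightarrow> \<alpha> * (K * (S * 0)) + ?R"
      by (intro tendsto_intros LIMSEQ_power_zero) auto
    from LIMSEQ_le_const[OF this] bound show ?thesis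
      by simp
  qed
  with D(1) show ?thesis
    unfolding estimate_on_def by blast
qed

text \<open>A cutoff equal to 1 on the half ball splits the field: the product vanishes outside the
  ball of radius r, the remainder outside \<open>U\<close>. The divergence of the product gains the
  gradient of the cutoff times \<open>F\<close>, which the L^2 part of the norm controls, so the
  splitting is bounded in H(div).\<close>

lemma estimate_on_insert:
  assumes U: "estimate_on \<Omega> U" and B: "estimate_on \<Omega> (cball x r)" and r: "0 < r"
  shows "estimate_on \<Omega> (ball x (r / 2) \<union> U)"
proof -
  obtain \<phi> where \<phi>: "\<forall>y\<in>ball x (r / 2). fn \<phi> y = 1" "\<forall>y. y \<notin> cball x r \<longrightarrow> fn \<phi> y = 0"
    using plateau[OF r] by blast
  obtain b where b: "0 \<le> b" "\<And>f. norm (times_tf \<phi> f) \<le> b * norm f"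
    using norm_times_tf_bound by blast
  have "\<forall>i. \<exists>B\<ge>0. \<forall>f. norm (times_tf (partial_tf i \<phi>) f) \<le> B * norm f"
    using norm_times_tf_bound by blast
  then obtain b' where b': "\<And>i. 0 \<le> b' i" "\<And>i f. norm (times_tf (partial_tf i \<phi>) f) \<le> b' i * norm f"
    by metis
  define e where "e = b + (\<Sum>i\<in>UNIV. b' i)"
  have sb': "0 \<le> (\<Sum>i\<in>UNIV. b' i)"
    by (intro sum_nonneg b')
  have e: "0 \<le> e"
    unfolding e_def using b(1) sb' by simp
  obtain C1 where C1: "0 \<le> C1" "\<And>T \<alpha> \<beta> F. lin_on_tests \<Omega> T \<Longrightarrow> 0 \<le> \<alpha> \<Longrightarrow> 0 \<le> \<beta> \<Longrightarrow>
     hm1_norm \<Omega> T \<le> ereal \<alpha> \<Longrightarrow> curl_hm1_norm \<Omega> T \<le> ereal \<beta> \<Longrightarrow>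
     (\<forall>k. supported_in \<Omega> (F k)) \<Longrightarrow> (\<forall>k y. y \<notin> U \<longrightarrow> fn (F k) y = 0) \<Longrightarrow>
     \<bar>T (vector_field F)\<bar> \<le> C1 * (\<alpha> + \<beta>) * ((\<Sum>k\<in>UNIV. norm (F k)) + norm (div_field F))"
    using U unfolding estimate_on_def by blast
  obtain C2 where C2: "0 \<le> C2" "\<And>T \<alpha> \<beta> F. lin_on_tests \<Omega> T \<Longrightarrow> 0 \<le> \<alpha> \<Longrightarrow> 0 \<le> \<beta> \<Longrightarrow>
     hm1_norm \<Omega> T \<le> ereal \<alpha> \<Longrightarrow> curl_hm1_norm \<Omega> T \<le> ereal \<beta> \<Longrightarrow>
     (\<forall>k. supported_in \<Omega> (F k)) \<Longrightarrow> (\<forall>k y. y \<notin> cball x r \<longrightarrow> fn (F k) y = 0) \<Longrightarrow>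
     \<bar>T (vector_field F)\<bar> \<le> C2 * (\<alpha> + \<beta>) * ((\<Sum>k\<in>UNIV. norm (F k)) + norm (div_field F))"
    using B unfolding estimate_on_def by blast
  define C where "C = C2 * e + C1 * (1 + e)"
  have C: "0 \<le> C"
    unfolding C_def using C1(1) C2(1) e by simp
  have "\<bar>T (vector_field F)\<bar> \<le> C * (\<alpha> + \<beta>) * ((\<Sum>k\<in>UNIV. norm (F k)) + norm (div_field F))"
    if T: "lin_on_tests \<Omega> T" and \<alpha>: "0 \<le> \<alpha>" and \<beta>: "0 \<le> \<beta>" and hm1: "hm1_norm \<Omega> T \<le> ereal \<alpha>"
      and curl: "curl_hm1_norm \<Omega> T \<le> ereal \<beta>" and F: "\<forall>k. supported_in \<Omega> (F k)"
      and supp: "\<forall>k y. y \<notin> ball x (r / 2) \<union> U \<longrightarrow> fn (F k) y = 0" for T \<alpha> \<beta> F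
  proof -
    let ?N = "\<Sum>k\<in>UNIV. norm (F k)"
    have N: "norm (F k) \<le> ?N" for k
      by (rule member_le_sum) auto
    define F1 where "F1 k = times_tf \<phi> (F k)" for k
    define F2 where "F2 k = F k - F1 k" for k
    have supported_in: "\<forall>k. supported_in \<Omega> (F1 k)" "\<forall>k. supported_in \<Omega> (F2 k)"
      using F by (auto simp: F1_def F2_def intro: supported_in_times_tf supported_in_diff)
    have "div_field F1 = times_tf \<phi> (div_field F) + (\<Sum>k\<in>UNIV. times_tf (partial_tf k \<phi>) (F k))"
      by (simp add: div_field_def F1_def partial_tf_times_tf tf_sum sum.distrib)
    also have "norm \<dots> \<le> b * norm (div_field F) + (\<Sum>k\<in>UNIV. b' k * ?N)"
    proof (rule order_trans[OF norm_triangle_ineq add_mono[OF b(2)]])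
      show "norm (\<Sum>k\<in>UNIV. times_tf (partial_tf k \<phi>) (F k)) \<le> (\<Sum>k\<in>UNIV. b' k * ?N)"
        by (rule order_trans[OF norm_sum sum_mono]) (rule order_trans[OF b'(2) mult_left_mono[OF N b'(1)]])
    qed
    finally have dv1: "norm (div_field F1) \<le> b * norm (div_field F) + (\<Sum>k\<in>UNIV. b' k) * ?N"
      by (simp add: sum_distrib_right)
    have N1: "(\<Sum>k\<in>UNIV. norm (F1 k)) \<le> b * ?N"
      unfolding F1_def sum_distrib_left by (intro sum_mono b(2))
    have Q1: "(\<Sum>k\<in>UNIV. norm (F1 k)) + norm (div_field F1) \<le> e * (?N + norm (div_field F))"
    proof -
      have "e * (?N + norm (div_field F)) = b * ?N + (b * norm (div_field F) + (\<Sum>k\<in>UNIV. b' k) * ?N) + (\<Sum>k\<in>UNIV. b' k) * norm (div_field F)"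
        by (simp add: e_def ring_distribs)
      then show ?thesis
        using N1 dv1 mult_nonneg_nonneg[OF sb' norm_ge_zero[of "div_field F"]] by linarith
    qed
    have "div_field F2 = div_field F - div_field F1"
      by (simp add: div_field_def F2_def tf_diff sum_subtractf)
    then have "norm (div_field F2) \<le> norm (div_field F) + norm (div_field F1)"
      by (simp add: norm_triangle_ineq4)
    moreover have "(\<Sum>k\<in>UNIV. norm (F2 k)) \<le> (\<Sum>k\<in>UNIV. norm (F k) + norm (F1 k))"
      unfolding F2_def by (intro sum_mono norm_triangle_ineq4)
    ultimately have Q2: "(\<Sum>k\<in>UNIV. norm (F2 k)) + norm (div_field F2) \<le> (1 + e) * (?N + norm (div_field F))"
      using Q1 by (simp add: sum.distrib ring_distribs)
    have "\<bar>T (vector_field F1)\<bar> \<le> C2 * (\<alpha> + \<beta>) * ((\<Sum>k\<in>UNIV. norm (F1 k)) + norm (div_field F1))"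
      using \<phi>(2) by (intro C2(2)[OF T \<alpha> \<beta> hm1 curl supported_in(1)]) (simp add: F1_def fn_times_tf)
    also have "\<dots> \<le> C2 * (\<alpha> + \<beta>) * (e * (?N + norm (div_field F)))"
      using C2(1) \<alpha> \<beta> by (intro mult_left_mono Q1) auto
    finally have 1: "\<bar>T (vector_field F1)\<bar> \<le> C2 * (\<alpha> + \<beta>) * (e * (?N + norm (div_field F)))" .
    have "fn (F2 k) y = 0" if "y \<notin> U" for k y
    proof (cases "y \<in> ball x (r / 2)")
      case True
      then show ?thesis
        using \<phi>(1) by (simp add: F2_def F1_def fn_times_tf del: mem_ball)
    next
      case False
      then show ?thesis
        using supp that by (simp add: F2_def F1_def fn_times_tf del: mem_ball)
    qed
    then have "\<bar>T (vector_field F2)\<bar> \<le> C1 * (\<alpha> + \<beta>) * ((\<Sum>k\<in>UNIV. norm (F2 k)) + norm (div_field F2))"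
      by (intro C1(2)[OF T \<alpha> \<beta> hm1 curl supported_in(2)]) blast
    also have "\<dots> \<le> C1 * (\<alpha> + \<beta>) * ((1 + e) * (?N + norm (div_field F)))"
      using C1(1) \<alpha> \<beta> by (intro mult_left_mono Q2) auto
    finally have 2: "\<bar>T (vector_field F2)\<bar> \<le> C1 * (\<alpha> + \<beta>) * ((1 + e) * (?N + norm (div_field F)))" .
    have "vector_field F = vector_field (\<lambda>k. F1 k + F2 k)"
      by (simp add: F2_def)
    then have "T (vector_field F) = T (vector_field F1) + T (vector_field F2)"
      using lin_on_tests_vector_field(1)[OF T, of F1 F2] supported_in by simp
    then have "\<bar>T (vector_field F)\<bar> \<le> C2 * (\<alpha> + \<beta>) * (e * (?N + norm (div_field F))) + C1 * (\<alpha> + \<beta>) * ((1 + e) * (?N + norm (div_field F)))"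
      using 1 2 by linarith
    also have "\<dots> = (C2 * e + C1 * (1 + e)) * (\<alpha> + \<beta>) * (?N + norm (div_field F))"
      by (simp only: ring_distribs mult.assoc mult.commute mult.left_commute)
    finally show ?thesis
      by (simp only: C_def)
  qed
  with C show ?thesis
    unfolding estimate_on_def by blast
qed

lemma estimate_on_UN:
  assumes "finite I" "\<And>x. x \<in> I \<Longrightarrow> 0 < r x \<and> estimate_on \<Omega> (cball x (r x))"
  shows "estimate_on \<Omega> (\<Union>x\<in>I. ball x (r x / 2))"
  using assms
proof (induction I)
  case empty
  \<comment> \<open>A field that vanishes off the empty set is zero, and so is its pairing with
    \<open>T\<close>.\<close>
  have "\<bar>T (vector_field F)\<bar> \<le> 0 * (\<alpha> + \<beta>) * ((\<Sum>k\<in>UNIV. norm (F k)) + norm (div_field F))"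
    if T: "lin_on_tests \<Omega> T" and F: "\<forall>k y. y \<notin> (\<Union>x\<in>{}. ball x (r x / 2)) \<longrightarrow> fn (F k) y = 0" for T \<alpha> \<beta> F
  proof -
    have "F k = 0" for k
      by (rule tf_eqI) (use F in simp)
    then have "F = (\<lambda>k. 0)"
      by auto
    then show ?thesis
      using lin_on_tests_sum[OF T, of "{} :: nat set" "\<lambda>_ _. 0"] by simp
  qed
  then show ?case
    unfolding estimate_on_def by (intro exI[of _ 0]) blast
next
  case (insert x I)
  then show ?case
    using estimate_on_insert[of \<Omega> "\<Union>x\<in>I. ball x (r x / 2)" x "r x"] by simp
qed

subsection \<open>Cones in Lipschitz domains\<close>

text \<open>A ball contained in the domain satisfies the condition for any directions; the
  coordinate axes supply a basis.\<close>

lemma cone_at_interior: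
  fixes \<Omega> :: "(real^'n::finite) set"
  assumes "open \<Omega>" "x \<in> \<Omega>"
  shows "\<exists>r>0. \<exists>a c. (\<forall>i. axis i 1 = (\<Sum>l\<in>UNIV. c i l *\<^sub>R a l)) \<and> cone_at \<Omega> x r a"
proof -
  obtain r where r: "0 < r" "ball x r \<subseteq> \<Omega>"
    using assms open_contains_ball by blast
  define a where "a l = axis l (1::real)" for l :: 'n
  define c where "c i l = (if l = i then 1 else 0 :: real)" for i l :: 'n
  have "axis i 1 = (\<Sum>l\<in>UNIV. c i l *\<^sub>R a l)" for i
    by (simp add: c_def a_def if_distrib[of "\<lambda>c. c *\<^sub>R _"] cong: if_cong)
  moreover have "cone_at \<Omega> x r a"
    using r(2) unfolding cone_at_def by blast
  ultimately show ?thesis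
    using r(1) by blast
qed

text \<open>Below a graph of slope at most \<open>L\<close>, moving sideways by t while descending
  by \<open>L * t\<close> cannot cross the graph. The horizontal directions are therefore tilted
  downwards by \<open>L\<close>, and the vertical descent completes the basis.\<close>

lemma cone_at_graph:
  fixes \<Omega> :: "(real^'n::finite) set" and R :: "real^'n \<Rightarrow> real^'n"
  assumes r: "0 < r" and R: "orthogonal_transformation R" and g: "L-lipschitz_on UNIV g"
    and gk: "\<forall>y z. (\<forall>i. i \<noteq> k \<longrightarrow> y $ i = z $ i) \<longrightarrow> g y = g z"
    and graph: "\<Omega> \<inter> ball x r = {y \<in> ball x r. (R y) $ k < g (R y)}"
  shows "\<exists>a c. (\<forall>i. axis i 1 = (\<Sum>l\<in>UNIV. c i l *\<^sub>R a l)) \<and> cone_at \<Omega> x r a"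
proof -
  have L: "0 \<le> L"
    using g by (rule lipschitz_on_nonneg)
  have lin: "linear R"
    using R by (rule orthogonal_transformation_linear)
  have inj: "inj R" and surj: "surj R"
    using R orthogonal_transformation_inj orthogonal_transformation_surj by blast+
  define b where "b l = (if l = k then - axis k 1 else axis l 1 - L *\<^sub>R axis k 1 :: real^'n)" for l
  define a where "a l = inv R (b l)" for l
  have Ra: "R (a l) = b l" for l
    unfolding a_def by (rule surj_f_inv_f[OF surj])
  have bnth: "(\<Sum>l\<in>UNIV. t l *\<^sub>R b l) $ j = (if j = k then - t k - L * (\<Sum>l\<in>UNIV - {k}. t l) else t j)" for t j
  proof (cases "j = k")
    case True
    have "(\<Sum>l\<in>UNIV. t l *\<^sub>R b l) $ k = (\<Sum>l\<in>UNIV. t l * b l $ k)"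
      by simp
    also have "\<dots> = t k * b k $ k + (\<Sum>l\<in>UNIV - {k}. t l * b l $ k)"
      by (rule sum.remove) auto
    also have "(\<Sum>l\<in>UNIV - {k}. t l * b l $ k) = (\<Sum>l\<in>UNIV - {k}. - (L * t l))"
      by (intro sum.cong refl) (auto simp: b_def axis_def)
    finally show ?thesis
      using True by (simp add: b_def axis_def sum_negf sum_distrib_left)
  next
    case False
    have "(\<Sum>l\<in>UNIV. t l *\<^sub>R b l) $ j = (\<Sum>l\<in>UNIV. if l = j then t l else 0)"
      unfolding sum_component using False by (intro sum.cong refl) (auto simp: b_def axis_def)
    then show ?thesis
      using False by simp
  qed
  \<comment> \<open>These are the coordinates of \<open>R (axis i 1)\<close> in the basis
    \<open>b\<close>: the horizontal ones are read off directly, and the one at \<open>k\<close>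
    also undoes the descent caused by the tilted vectors.\<close>
  define c where "c i l = (if l = k then - (R (axis i 1) $ k) - L * (\<Sum>l\<in>UNIV - {k}. R (axis i 1) $ l) else R (axis i 1) $ l)" for i l
  have "axis i 1 = (\<Sum>l\<in>UNIV. c i l *\<^sub>R a l)" for i
  proof (rule injD[OF inj])
    have "(\<Sum>l\<in>UNIV - {k}. c i l) = (\<Sum>l\<in>UNIV - {k}. R (axis i 1) $ l)"
      by (intro sum.cong) (auto simp: c_def)
    then have "(\<Sum>l\<in>UNIV. c i l *\<^sub>R b l) = R (axis i 1)"
      unfolding vec_eq_iff bnth by (auto simp: c_def)
    then show "R (axis i 1) = R (\<Sum>l\<in>UNIV. c i l *\<^sub>R a l)"
      by (simp add: linear_sum[OF lin] linear_scale[OF lin] Ra)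
  qed
  moreover have "cone_at \<Omega> x r a"
    unfolding cone_at_def
  proof (intro allI impI)
    fix y and t :: "'n \<Rightarrow> real"
    let ?w = "\<Sum>k\<in>UNIV. t k *\<^sub>R a k"
    assume y: "y \<in> \<Omega> \<inter> ball x r" and t: "\<forall>k. 0 \<le> t k" and yw: "y + ?w \<in> ball x r"
    let ?s = "\<Sum>l\<in>UNIV - {k}. t l"
    \<comment> \<open>The horizontal part of the displacement, which is all that \<open>g\<close>
      can see. Its norm is at most \<open>?s\<close>, so the graph drops by at most
      \<open>L * ?s\<close>, while the point descends by at least that much.\<close>
    define v where "v = (\<Sum>l\<in>UNIV - {k}. t l *\<^sub>R (axis l 1 :: real^'n))"
    have Rw: "R (y + ?w) = R y + (\<Sum>l\<in>UNIV. t l *\<^sub>R b l)"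
      by (simp add: linear_add[OF lin] linear_sum[OF lin] linear_scale[OF lin] Ra)
    have vj: "v $ j = t j" if "j \<noteq> k" for j
    proof -
      have "v $ j = (\<Sum>l\<in>UNIV - {k}. if l = j then t l else 0)"
        unfolding v_def sum_component by (intro sum.cong refl) (auto simp: axis_def)
      then show ?thesis
        using that by simp
    qed
    have "norm v \<le> (\<Sum>l\<in>UNIV - {k}. norm (t l *\<^sub>R (axis l 1 :: real^'n)))"
      unfolding v_def by (rule norm_sum)
    then have "norm v \<le> ?s"
      using t by simp
    have "g (R (y + ?w)) = g (R y + v)"
      using gk bnth vj by (auto simp: Rw)
    moreover have "dist (g (R y + v)) (g (R y)) \<le> L * dist (R y + v) (R y)"
      using lipschitz_onD[OF g] by blast
    then have "\<bar>g (R y + v) - g (R y)\<bar> \<le> L * norm v"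
      by (simp add: dist_norm)
    moreover have "L * norm v \<le> L * ?s"
      using \<open>norm v \<le> ?s\<close> L by (rule mult_left_mono)
    moreover have "R (y + ?w) $ k = R y $ k - t k - L * ?s"
      by (simp add: Rw bnth del: sum_component)
    moreover have "R y $ k < g (R y)"
      using y graph by blast
    ultimately have "R (y + ?w) $ k < g (R (y + ?w))"
      using t by (smt (verit))
    then show "y + ?w \<in> \<Omega>"
      using graph yw by blast
  qed
  ultimately show ?thesis
    by blast
qed

lemma estimate_on_closure:
  fixes \<Omega> :: "((real, 'n::{finite,linorder}) vec) set"
  assumes "lipschitz_domain \<Omega>" "x \<in> closure \<Omega>"
  shows "\<exists>r>0. estimate_on \<Omega> (cball x r)"
proof -
  have "\<exists>r>0. \<exists>a c. (\<forall>i. axis i 1 = (\<Sum>l\<in>UNIV. c i l *\<^sub>R a l)) \<and> cone_at \<Omega> x r a"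
  proof (cases "x \<in> \<Omega>")
    case True
    then show ?thesis
      using assms(1) cone_at_interior unfolding lipschitz_domain_def by blast
  next
    case False
    then have "x \<in> frontier \<Omega>"
      using assms by (simp add: frontier_def lipschitz_domain_def interior_open)
    moreover have "\<forall>x\<in>frontier \<Omega>. \<exists>r>0. \<exists>(R :: (real, 'n) vec \<Rightarrow> (real, 'n) vec) k (g :: (real, 'n) vec \<Rightarrow> real) L.
        orthogonal_transformation R \<and> L-lipschitz_on UNIV g \<and>
        (\<forall>y z. (\<forall>i. i \<noteq> k \<longrightarrow> y $ i = z $ i) \<longrightarrow> g y = g z) \<and>
        \<Omega> \<inter> ball x r = {y \<in> ball x r. (R y) $ k < g (R y)}"
      using assms(1) unfolding lipschitz_domain_def by (elim conjE)
    ultimately obtain r R k g L where graph: "0 < r"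
      "orthogonal_transformation (R :: (real, 'n) vec \<Rightarrow> (real, 'n) vec)"
      "L-lipschitz_on UNIV (g :: (real, 'n) vec \<Rightarrow> real)"
      "\<forall>y z. (\<forall>i. i \<noteq> k \<longrightarrow> y $ i = z $ i) \<longrightarrow> g y = g z"
      "\<Omega> \<inter> ball x r = {y \<in> ball x r. (R y) $ k < g (R y)}"
      by blast
    from cone_at_graph[OF graph] graph(1) show ?thesis
      by blast
  qed
  then obtain r a c where "0 < r" "\<And>i. axis i 1 = (\<Sum>l\<in>UNIV. c i l *\<^sub>R a l)" "cone_at \<Omega> x r a"
    by blast
  then have "0 < r / 2" "estimate_on \<Omega> (cball x (r / 2))"
    by (simp, intro local_bound)
  then show ?thesis
    by blast
qed

section \<open>Compactness and equivalence of the norms\<close>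

theorem hdiv_bound:
  fixes \<Omega> :: "((real, 'n::{finite,linorder}) vec) set"
  assumes "bounded \<Omega>" and lip: "lipschitz_domain \<Omega>"
  shows "\<exists>C>0. \<forall>T \<alpha> \<beta>. lin_on_tests \<Omega> T \<longrightarrow> 0 \<le> \<alpha> \<longrightarrow> 0 \<le> \<beta> \<longrightarrow>
     hm1_norm \<Omega> T \<le> ereal \<alpha> \<longrightarrow> curl_hm1_norm \<Omega> T \<le> ereal \<beta> \<longrightarrow>
     hdiv_dual_norm \<Omega> T \<le> ereal (C * (\<alpha> + \<beta>))"
proof -
  obtain r where r: "\<And>x. x \<in> closure \<Omega> \<Longrightarrow> 0 < r x \<and> estimate_on \<Omega> (cball x (r x))"
    using estimate_on_closure[OF lip] by metis
  have "compact (closure \<Omega>)"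
    using assms(1) by (simp add: compact_closure)
  \<comment> \<open>Half radii are used because each patching step enlarges the covered region by
    the half ball, where the cutoff is 1.\<close>
  moreover have "closure \<Omega> \<subseteq> (\<Union>x\<in>closure \<Omega>. ball x (r x / 2))"
    using r by fastforce
  ultimately obtain I where I: "I \<subseteq> closure \<Omega>" "finite I" "closure \<Omega> \<subseteq> (\<Union>x\<in>I. ball x (r x / 2))"
    by (elim compactE_image[of _ _ "\<lambda>x. ball x (r x / 2)"]) auto
  have "estimate_on \<Omega> (\<Union>x\<in>I. ball x (r x / 2))"
    using I r by (intro estimate_on_UN) auto
  then obtain C where C: "0 \<le> C" "\<And>T \<alpha> \<beta> F. lin_on_tests \<Omega> T \<Longrightarrow> 0 \<le> \<alpha> \<Longrightarrow> 0 \<le> \<beta> \<Longrightarrow>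
     hm1_norm \<Omega> T \<le> ereal \<alpha> \<Longrightarrow> curl_hm1_norm \<Omega> T \<le> ereal \<beta> \<Longrightarrow>
     (\<forall>k. supported_in \<Omega> (F k)) \<Longrightarrow> (\<forall>k y. y \<notin> (\<Union>x\<in>I. ball x (r x / 2)) \<longrightarrow> fn (F k) y = 0) \<Longrightarrow>
     \<bar>T (vector_field F)\<bar> \<le> C * (\<alpha> + \<beta>) * ((\<Sum>k\<in>UNIV. norm (F k)) + norm (div_field F))"
    unfolding estimate_on_def by blast
  \<comment> \<open>\<open>C + 1\<close> makes the constant positive, and the other factor passes
    from the sum of norms to the graph norm.\<close>
  define C' where "C' = (C + 1) * (real CARD('n) + 1)"
  have C': "0 < C'" "C * (real CARD('n) + 1) \<le> C'"
    unfolding C'_def using C(1) by (auto intro!: mult_right_mono)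
  have "hdiv_dual_norm \<Omega> T \<le> ereal (C' * (\<alpha> + \<beta>))"
    if T: "lin_on_tests \<Omega> T" and \<alpha>: "0 \<le> \<alpha>" and \<beta>: "0 \<le> \<beta>" and hm1: "hm1_norm \<Omega> T \<le> ereal \<alpha>"
      and curl: "curl_hm1_norm \<Omega> T \<le> ereal \<beta>" for T \<alpha> \<beta>
  proof -
    have nn: "0 \<le> C' * (\<alpha> + \<beta>)"
      using C' \<alpha> \<beta> by simp
    show ?thesis
      unfolding hdiv_dual_norm_le_iff[OF T nn]
    proof (intro allI impI)
      fix F :: "'n \<Rightarrow> 'n tf" assume F: "\<forall>k. supported_in \<Omega> (F k)"
      let ?s = "sqrt ((\<Sum>k\<in>UNIV. (norm (F k))\<^sup>2) + (norm (div_field F))\<^sup>2)"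
      have s: "0 \<le> ?s"
        by (intro real_sqrt_ge_zero add_nonneg_nonneg sum_nonneg) auto
      have "fn (F k) y = 0" if "y \<notin> (\<Union>x\<in>I. ball x (r x / 2))" for k y
      proof -
        have "y \<notin> tsupport (fn (F k))"
          using F that I(3) closure_subset[of \<Omega>] unfolding supported_in_def by blast
        then show ?thesis
          using in_tsupport[of "fn (F k)" y] by blast
      qed
      then have "\<bar>T (vector_field F)\<bar> \<le> C * (\<alpha> + \<beta>) * ((\<Sum>k\<in>UNIV. norm (F k)) + norm (div_field F))"
        by (intro C(2)[OF T \<alpha> \<beta> hm1 curl F]) blast
      also have "\<dots> \<le> C * (\<alpha> + \<beta>) * ((real CARD('n) + 1) * ?s)"
        using C(1) \<alpha> \<beta> by (intro mult_left_mono hdiv_sqrt_ge) auto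
      also have "\<dots> = (C * (real CARD('n) + 1)) * ((\<alpha> + \<beta>) * ?s)"
        by (simp only: mult.assoc mult.commute mult.left_commute)
      also have "\<dots> \<le> C' * ((\<alpha> + \<beta>) * ?s)"
        using C'(2) \<alpha> \<beta> s by (intro mult_right_mono) auto
      finally show "\<bar>T (vector_field F)\<bar> \<le> C' * (\<alpha> + \<beta>) * ?s"
        by (simp only: mult.assoc)
    qed
  qed
  with C'(1) show ?thesis
    by blast
qed

text \<open>The zero field is admissible in each supremum; over an empty set an extended-real
  supremum would be minus infinity.\<close>

lemma dual_norms_nonneg:
  assumes T: "lin_on_tests \<Omega> T"
  shows "0 \<le> hdiv_dual_norm \<Omega> T" "0 \<le> hm1_norm \<Omega> T" "0 \<le> curl_hm1_norm \<Omega> T"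
proof -
  have inn0: "\<And>k. supported_in \<Omega> ((\<lambda>_. 0) k)"
    by (rule supported_in_0)
  have T0: "ereal \<bar>T (vector_field (\<lambda>_. 0))\<bar> = 0"
    using lin_on_tests_sum[OF T, of "{} :: nat set" "\<lambda>_ _. 0"] by simp
  have dv0: "div_field (\<lambda>_. 0) = 0"
    by (simp add: div_field_def tf_0)
  have nh0: "h1_size 0 = 0"
    by (simp add: h1_size_def tf_0)
  have "vector_field (\<lambda>_. 0) \<in> {u. test_field \<Omega> u \<and> hdiv_norm \<Omega> u \<le> 1}"
    using test_field_vector_field[OF inn0] hdiv_norm_vector_field[OF inn0] by (simp add: dv0)
  from SUP_upper[OF this, of "\<lambda>u. ereal \<bar>T u\<bar>"] show "0 \<le> hdiv_dual_norm \<Omega> T"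
    unfolding hdiv_dual_norm_def T0 .
  have "vector_field (\<lambda>_. 0) \<in> {u. test_field \<Omega> u \<and> h1v_norm \<Omega> u \<le> 1}"
    using test_field_vector_field[OF inn0] h1v_norm_vector_field[OF inn0] by (simp add: nh0 L2_set_def)
  from SUP_upper[OF this, of "\<lambda>u. ereal \<bar>T u\<bar>"] show "0 \<le> hm1_norm \<Omega> T"
    unfolding hm1_norm_def T0 .
  have "test_fun \<Omega> (fn 0)"
    using supported_in_0 test_fun_iff by blast
  then have "(\<lambda>_. fn 0) \<in> {\<psi>. (\<forall>p\<in>curl_idx. test_fun \<Omega> (\<psi> p)) \<and> sqrt (\<Sum>p\<in>curl_idx. (h1_norm \<Omega> (\<psi> p))\<^sup>2) \<le> 1}"
    by (simp add: h1_norm_fn supported_in_0 nh0)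
  from SUP_upper[OF this, of "\<lambda>\<psi>. ereal \<bar>\<Sum>p\<in>curl_idx. curl_comp T p (\<psi> p)\<bar>"]
  have "ereal \<bar>\<Sum>p\<in>curl_idx. curl_comp T p (fn 0)\<bar> \<le> curl_hm1_norm \<Omega> T"
    unfolding curl_hm1_norm_def .
  moreover have "(0::ereal) \<le> ereal \<bar>\<Sum>p\<in>curl_idx. curl_comp T p (fn 0)\<bar>"
    by simp
  ultimately show "0 \<le> curl_hm1_norm \<Omega> T"
    by (rule order_trans[rotated])
qed

theorem theorem2p2:
  fixes \<Omega> :: "((real, 'n::{finite,linorder}) vec) set"
  assumes "CARD('n) = 2 \<or> CARD('n) = 3"
    and "bounded \<Omega>" and "lipschitz_domain \<Omega>"
  shows "(\<forall>T. lin_on_tests \<Omega> T \<longrightarrow>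
            (hdiv_dual_norm \<Omega> T < \<infinity> \<longleftrightarrow> hm1curl_norm \<Omega> T < \<infinity>))
       \<and> (\<exists>c C. 0 < c \<and> 0 < C \<and>
            (\<forall>T. lin_on_tests \<Omega> T \<longrightarrow>
               ereal c * hm1curl_norm \<Omega> T \<le> hdiv_dual_norm \<Omega> T \<and>
               hdiv_dual_norm \<Omega> T \<le> ereal C * hm1curl_norm \<Omega> T))"
proof -
  obtain C1 where C1: "0 < C1" "\<And>T \<alpha>. lin_on_tests \<Omega> T \<Longrightarrow> 0 \<le> \<alpha> \<Longrightarrow> hdiv_dual_norm \<Omega> T \<le> ereal \<alpha> \<Longrightarrow>
    hm1_norm \<Omega> T \<le> ereal (C1 * \<alpha>) \<and> curl_hm1_norm \<Omega> T \<le> ereal (C1 * \<alpha>)"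
    using dual_norm_dominates by blast
  obtain C2 where C2: "0 < C2" "\<And>T \<alpha> \<beta>. lin_on_tests \<Omega> T \<Longrightarrow> 0 \<le> \<alpha> \<Longrightarrow> 0 \<le> \<beta> \<Longrightarrow>
     hm1_norm \<Omega> T \<le> ereal \<alpha> \<Longrightarrow> curl_hm1_norm \<Omega> T \<le> ereal \<beta> \<Longrightarrow>
     hdiv_dual_norm \<Omega> T \<le> ereal (C2 * (\<alpha> + \<beta>))"
    using hdiv_bound[OF assms(2,3)] by blast
  \<comment> \<open>The 2 comes from adding the bounds for the two summands of the H^{-1}(curl)
    norm.\<close>
  define c where "c = 1 / (2 * C1)"
  have c: "0 < c" "c * (2 * C1) = 1"
    using C1(1) by (auto simp: c_def)
  have bounds: "ereal c * hm1curl_norm \<Omega> T \<le> hdiv_dual_norm \<Omega> T \<and>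
               hdiv_dual_norm \<Omega> T \<le> ereal C2 * hm1curl_norm \<Omega> T" if T: "lin_on_tests \<Omega> T" for T
  proof
    note nn = dual_norms_nonneg[OF T]
    show "ereal c * hm1curl_norm \<Omega> T \<le> hdiv_dual_norm \<Omega> T"
    proof (cases "hdiv_dual_norm \<Omega> T")
      case (real \<alpha>)
      then have \<alpha>: "0 \<le> \<alpha>" "hdiv_dual_norm \<Omega> T \<le> ereal \<alpha>"
        using nn(1) by auto
      have "hm1curl_norm \<Omega> T \<le> ereal (C1 * \<alpha>) + ereal (C1 * \<alpha>)"
        unfolding hm1curl_norm_def using C1(2)[OF T \<alpha>] by (intro add_mono) auto
      then have "hm1curl_norm \<Omega> T \<le> ereal (2 * C1 * \<alpha>)"
        by (simp add: mult.assoc)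
      then have "ereal c * hm1curl_norm \<Omega> T \<le> ereal c * ereal (2 * C1 * \<alpha>)"
        by (rule ereal_mult_left_mono) (use c in simp)
      also have "\<dots> = ereal ((c * (2 * C1)) * \<alpha>)"
        by (simp add: mult.assoc)
      finally show ?thesis
        using real c by simp
    qed (use nn in auto)
    show "hdiv_dual_norm \<Omega> T \<le> ereal C2 * hm1curl_norm \<Omega> T"
    proof (cases "hm1_norm \<Omega> T"; cases "curl_hm1_norm \<Omega> T")
      \<comment> \<open>The case with content is that of two finite norms. If one is infinite, so is
        the right-hand side, since both are nonnegative and \<open>C2\<close> is positive.\<close>
      fix \<alpha> \<beta> assume *: "hm1_norm \<Omega> T = ereal \<alpha>" "curl_hm1_norm \<Omega> T = ereal \<beta>"
      then show ?thesis
        using C2(2)[OF T, of \<alpha> \<beta>] nn by (simp add: hm1curl_norm_def)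
    qed (use nn C2(1) in \<open>auto simp: hm1curl_norm_def\<close>)
  qed
  have "hdiv_dual_norm \<Omega> T < \<infinity> \<longleftrightarrow> hm1curl_norm \<Omega> T < \<infinity>" if T: "lin_on_tests \<Omega> T" for T
    using bounds[OF T] c C2(1) by (cases "hm1curl_norm \<Omega> T"; cases "hdiv_dual_norm \<Omega> T") auto
  with bounds c(1) C2(1) show ?thesis
    by blast
qed

end
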